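(* Let $\mathcal{X}=\{X_i\}_{i\in I}$ be a quantum set, $A:=\ell^\infty(\mathcal{X})$, and $\mathrm{U}:=\mathrm{U}(A)$ the unitary group of $A$. The following conditions are equivalent. (a) $\mathcal{X}$ is virtually classical. (b) For all $n\in\mathbb{Z}_{\ge1}$, the conjugation action of $\mathrm{U}$ on $A^{\overline{\otimes} n}$ is jointly continuous for the product topology on $\mathrm{U}$ and the $\sigma$-weak topology on $A^{\overline{\otimes} n}$. (c) The conjugation action of $\mathrm{U}$ on $A$ is jointly continuous for the product topology on $\mathrm{U}$ and the $\sigma$-weak topology on $A$. (d) For some $n\in\mathbb{Z}_{\ge 1}$, the conjugation action of $\mathrm{U}$ on $A^{\overline{\otimes} n}$ is jointly continuous for the product topology on $\mathrm{U}$ and the $\sigma$-weak topology on $A^{\overline{\otimes} n}$.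
   Context: A quantum set $\mathcal{X}=\{X_i\}_{i\in I}$ is a family of (non-zero) finite-dimensional Hilbert spaces. $\mathcal{L}(X_i)$ is the algebra of operators on $X_i$, and $\ell^\infty(\mathcal{X})=\prod^{W^*}_i\mathcal{L}(X_i)$ is the von Neumann algebra of uniformly bounded tuples $(a_i)_i$, $a_i\in\mathcal{L}(X_i)$. $\mathcal{X}$ is virtually classical if at most finitely many of the algebras $\mathcal{L}(X_i)$ are non-abelian (i.e. at most finitely many $X_i$ have dimension $\ge2$). $\mathrm{U}(A)=\prod_i\mathrm{U}(\mathcal{L}(X_i))$ carries its product topology (each factor having the usual topology of a finite-dimensional unitary group), for which it is a compact Hausdorff group. $\overline{\otimes}$ is the von Neumann algebra tensor product and $A^{\overline{\otimes}n}$ the $n$-fold tensor power. The conjugation action of $u\in\mathrm{U}$ on $A^{\overline{\otimes}n}$ is conjugation by $u^{\otimes n}$, so that $a_1\otimes\cdots\otimes a_n\mapsto ua_1u^*\otimes\cdots\otimes ua_nu^*$. The $\sigma$-weak topology is the weak$^*$ topology with respect to the predual. An action $\mathrm{G}\times E\to E$ is jointly continuous if it is continuous for the product topology on $\mathrm{G}\times E$. *)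

theory Defs
  imports "HOL-Analysis.Analysis" "HOL-Library.Function_Algebras"
begin

text \<open>
  Hilbert spaces are carrier-based, so that a family of them may have members of varying dimension.
  Addition is that of the ambient type; the inner product is conjugate-linear in the first and
  linear in the second argument.
\<close>

record 'v hilb =
  hcarrier :: "'v set"
  hscale :: "complex \<Rightarrow> 'v \<Rightarrow> 'v"
  hinner :: "'v \<Rightarrow> 'v \<Rightarrow> complex"

definition hnorm :: "'v hilb \<Rightarrow> 'v \<Rightarrow> real" where
  "hnorm V x = sqrt (Re (hinner V x x))"

text \<open>Completeness is automatic in finite dimension.\<close>

definition fin_dim_hilbert :: "'v::ab_group_add hilb \<Rightarrow> bool" where
  "fin_dim_hilbert V \<longleftrightarrow>
     vector_space (hscale V) \<and>
     module.subspace (hscale V) (hcarrier V) \<and>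
     (\<exists>B. finite B \<and> module.span (hscale V) B = hcarrier V) \<and>
     (\<forall>x\<in>hcarrier V. \<forall>y\<in>hcarrier V. hinner V y x = cnj (hinner V x y)) \<and>
     (\<forall>x\<in>hcarrier V. \<forall>y\<in>hcarrier V. \<forall>z\<in>hcarrier V.
        hinner V x (y + z) = hinner V x y + hinner V x z) \<and>
     (\<forall>x\<in>hcarrier V. \<forall>y\<in>hcarrier V. \<forall>c. hinner V x (hscale V c y) = c * hinner V x y) \<and>
     (\<forall>x\<in>hcarrier V. x \<noteq> 0 \<longrightarrow> Re (hinner V x x) > 0)"

text \<open>
  The algebra of bounded operators on \<open>V\<close>. Operators vanish outside the carrier, so that equality of
  operators is equality of functions and composition is \<open>\<circ>\<close>.
\<close>

definition hops :: "'v::ab_group_add hilb \<Rightarrow> ('v \<Rightarrow> 'v) set" where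
  "hops V = {T.
     (\<forall>x\<in>hcarrier V. T x \<in> hcarrier V) \<and>
     (\<forall>x\<in>hcarrier V. \<forall>y\<in>hcarrier V. T (x + y) = T x + T y) \<and>
     (\<forall>x\<in>hcarrier V. \<forall>c. T (hscale V c x) = hscale V c (T x)) \<and>
     (\<exists>C. \<forall>x\<in>hcarrier V. hnorm V (T x) \<le> C * hnorm V x) \<and>
     (\<forall>x. x \<notin> hcarrier V \<longrightarrow> T x = 0)}"

definition hid :: "'v::ab_group_add hilb \<Rightarrow> 'v \<Rightarrow> 'v" where
  "hid V = (\<lambda>x. if x \<in> hcarrier V then x else 0)"

definition hopnorm :: "'v hilb \<Rightarrow> ('v \<Rightarrow> 'v) \<Rightarrow> real" where
  "hopnorm V T = (SUP x\<in>{x \<in> hcarrier V. hnorm V x \<le> 1}. hnorm V (T x))"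

definition hadj :: "'v::ab_group_add hilb \<Rightarrow> ('v \<Rightarrow> 'v) \<Rightarrow> 'v \<Rightarrow> 'v" where
  "hadj V T = (THE S. S \<in> hops V \<and>
     (\<forall>x\<in>hcarrier V. \<forall>y\<in>hcarrier V. hinner V (S x) y = hinner V x (T y)))"

definition unitaries :: "'v::ab_group_add hilb \<Rightarrow> ('v \<Rightarrow> 'v) set" where
  "unitaries V = {u \<in> hops V. hadj V u \<circ> u = hid V \<and> u \<circ> hadj V u = hid V}"

text \<open>
  The operator-norm topology. The locale \<^locale>\<open>Metric_space\<close> asks for non-negativity and symmetry of
  the distance also outside the space, hence the case distinction.
\<close>

definition unitary_topology :: "'v::ab_group_add hilb \<Rightarrow> ('v \<Rightarrow> 'v) topology" where
  "unitary_topology V = Metric_space.mtopology (unitaries V)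
     (\<lambda>u v. if u \<in> unitaries V \<and> v \<in> unitaries V then hopnorm V (\<lambda>x. u x - v x) else 0)"

text \<open>
  For a von Neumann algebra \<open>M\<close> of operators on \<open>V\<close>, the predual consists of the restrictions to \<open>M\<close>
  of the functionals below, and the \<open>\<sigma>\<close>-weak topology is the coarsest topology on \<open>M\<close> making
  all of them continuous.
\<close>

definition normal_functionals :: "'v hilb \<Rightarrow> (('v \<Rightarrow> 'v) \<Rightarrow> complex) set" where
  "normal_functionals V = {(\<lambda>T. \<Sum>k. hinner V (\<eta> k) (T (\<xi> k))) | \<xi> \<eta> :: nat \<Rightarrow> 'v.
     range \<xi> \<subseteq> hcarrier V \<and> range \<eta> \<subseteq> hcarrier V \<and>
     summable (\<lambda>k. (hnorm V (\<xi> k))\<^sup>2) \<and> summable (\<lambda>k. (hnorm V (\<eta> k))\<^sup>2)}"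

definition sigma_weak :: "'v hilb \<Rightarrow> ('v \<Rightarrow> 'v) set \<Rightarrow> ('v \<Rightarrow> 'v) topology" where
  "sigma_weak V M = topology_generated_by
     {{T \<in> M. \<phi> T \<in> W} | \<phi> W. \<phi> \<in> normal_functionals V \<and> open W}"

definition commutant :: "'v::ab_group_add hilb \<Rightarrow> ('v \<Rightarrow> 'v) set \<Rightarrow> ('v \<Rightarrow> 'v) set" where
  "commutant V N = {T \<in> hops V. \<forall>R\<in>N. T \<circ> R = R \<circ> T}"

definition conj_by :: "'v::ab_group_add hilb \<Rightarrow> ('v \<Rightarrow> 'v) \<Rightarrow> ('v \<Rightarrow> 'v) \<Rightarrow> 'v \<Rightarrow> 'v" where
  "conj_by V w T = w \<circ> T \<circ> hadj V w"

definition l2 :: "'w set \<Rightarrow> ('w \<Rightarrow> complex) hilb" where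
  "l2 \<Omega> = \<lparr>
     hcarrier = {f. (\<lambda>w. (cmod (f w))\<^sup>2) summable_on \<Omega> \<and> (\<forall>w. w \<notin> \<Omega> \<longrightarrow> f w = 0)},
     hscale = (\<lambda>c f w. c * f w),
     hinner = (\<lambda>f g. \<Sum>\<^sub>\<infinity>w\<in>\<Omega>. cnj (f w) * g w)\<rparr>"

text \<open>
  The Hilbert space tensor power \<open>V\<^sup>\<otimes>\<^sup>n\<close>, in coordinates with respect to an orthonormal basis \<open>E\<close> of
  \<open>V\<close>: the \<open>n\<close>-tuples from \<open>E\<close>, encoded as lists, index its orthonormal basis
  \<open>e\<^sub>1 \<otimes> \<dots> \<otimes> e\<^sub>n\<close>.
\<close>

definition tensor_power :: "'v set \<Rightarrow> nat \<Rightarrow> ('v list \<Rightarrow> complex) hilb" where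
  "tensor_power E n = l2 {es. length es = n \<and> set es \<subseteq> E}"

definition elem_tensor :: "'v hilb \<Rightarrow> 'v set \<Rightarrow> 'v list \<Rightarrow> 'v list \<Rightarrow> complex" where
  "elem_tensor V E xs = (\<lambda>es. if length es = length xs \<and> set es \<subseteq> E
     then \<Prod>j<length xs. hinner V (es ! j) (xs ! j) else 0)"

text \<open>\<open>R = a\<^sub>1 \<otimes> \<dots> \<otimes> a\<^sub>n\<close>, where \<open>as = [a\<^sub>1, \<dots>, a\<^sub>n]\<close>.\<close>

definition is_tensor_op ::
  "'v hilb \<Rightarrow> 'v set \<Rightarrow> ('v \<Rightarrow> 'v) list \<Rightarrow> (('v list \<Rightarrow> complex) \<Rightarrow> 'v list \<Rightarrow> complex) \<Rightarrow> bool" where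
  "is_tensor_op V E as R \<longleftrightarrow> R \<in> hops (tensor_power E (length as)) \<and>
     (\<forall>xs. length xs = length as \<and> set xs \<subseteq> hcarrier V \<longrightarrow>
        R (elem_tensor V E xs) = elem_tensor V E (map2 (\<lambda>a x. a x) as xs))"

definition op_tensor_power ::
  "'v hilb \<Rightarrow> 'v set \<Rightarrow> nat \<Rightarrow> ('v \<Rightarrow> 'v) \<Rightarrow> ('v list \<Rightarrow> complex) \<Rightarrow> 'v list \<Rightarrow> complex" where
  "op_tensor_power V E n a = (THE R. is_tensor_op V E (replicate n a) R)"

text \<open>
  \<open>n\<close>-fold von Neumann tensor power of \<open>M\<close>: the von Neumann algebra generated by the elementary
  tensors of elements of \<open>M\<close>, as a double commutant.
\<close>

definition vn_tensor_power ::
  "'v hilb \<Rightarrow> 'v set \<Rightarrow> ('v \<Rightarrow> 'v) set \<Rightarrow> nat \<Rightarrow> (('v list \<Rightarrow> complex) \<Rightarrow> 'v list \<Rightarrow> complex) set" where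
  "vn_tensor_power V E M n = commutant (tensor_power E n) (commutant (tensor_power E n)
     {R. \<exists>as. length as = n \<and> set as \<subseteq> M \<and> is_tensor_op V E as R})"

definition quantum_set :: "'i set \<Rightarrow> ('i \<Rightarrow> 'v::ab_group_add hilb) \<Rightarrow> bool" where
  "quantum_set I X \<longleftrightarrow> (\<forall>i\<in>I. fin_dim_hilbert (X i) \<and> hcarrier (X i) \<noteq> {0})"

definition virtually_classical :: "'i set \<Rightarrow> ('i \<Rightarrow> 'v::ab_group_add hilb) \<Rightarrow> bool" where
  "virtually_classical I X \<longleftrightarrow>
     finite {i \<in> I. \<not> (\<forall>S\<in>hops (X i). \<forall>T\<in>hops (X i). S \<circ> T = T \<circ> S)}"

definition hsum :: "'i set \<Rightarrow> ('i \<Rightarrow> 'v::ab_group_add hilb) \<Rightarrow> ('i \<Rightarrow> 'v) hilb" where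
  "hsum I X = \<lparr>
     hcarrier = {x. (\<forall>i\<in>I. x i \<in> hcarrier (X i)) \<and> (\<forall>i. i \<notin> I \<longrightarrow> x i = 0) \<and>
                    (\<lambda>i. (hnorm (X i) (x i))\<^sup>2) summable_on I},
     hscale = (\<lambda>c x i. if i \<in> I then hscale (X i) c (x i) else 0),
     hinner = (\<lambda>x y. \<Sum>\<^sub>\<infinity>i\<in>I. hinner (X i) (x i) (y i))\<rparr>"

definition linf :: "'i set \<Rightarrow> ('i \<Rightarrow> 'v::ab_group_add hilb) \<Rightarrow> ('i \<Rightarrow> 'v \<Rightarrow> 'v) set" where
  "linf I X = {a \<in> (\<Pi>\<^sub>E i\<in>I. hops (X i)). bdd_above ((\<lambda>i. hopnorm (X i) (a i)) ` I)}"

text \<open>The faithful representation of tuples as block-diagonal operators on the Hilbert sum.\<close>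

definition diag_op ::
  "'i set \<Rightarrow> ('i \<Rightarrow> 'v::ab_group_add hilb) \<Rightarrow> ('i \<Rightarrow> 'v \<Rightarrow> 'v) \<Rightarrow> ('i \<Rightarrow> 'v) \<Rightarrow> 'i \<Rightarrow> 'v" where
  "diag_op I X a = (\<lambda>x. if x \<in> hcarrier (hsum I X) then (\<lambda>i. if i \<in> I then a i (x i) else 0) else 0)"

definition linf_alg ::
  "'i set \<Rightarrow> ('i \<Rightarrow> 'v::ab_group_add hilb) \<Rightarrow> (('i \<Rightarrow> 'v) \<Rightarrow> 'i \<Rightarrow> 'v) set" where
  "linf_alg I X = diag_op I X ` linf I X"

definition linf_unitary_topology ::
  "'i set \<Rightarrow> ('i \<Rightarrow> 'v::ab_group_add hilb) \<Rightarrow> ('i \<Rightarrow> 'v \<Rightarrow> 'v) topology" where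
  "linf_unitary_topology I X = product_topology (\<lambda>i. unitary_topology (X i)) I"

definition fin_onb :: "'v::ab_group_add hilb \<Rightarrow> 'v set" where
  "fin_onb V = (SOME B. B \<subseteq> hcarrier V \<and> module.span (hscale V) B = hcarrier V \<and>
     (\<forall>b\<in>B. \<forall>c\<in>B. hinner V b c = (if b = c then 1 else 0)))"

text \<open>An orthonormal basis of the Hilbert sum, assembled from bases of the summands.\<close>

definition hsum_onb :: "'i set \<Rightarrow> ('i \<Rightarrow> 'v::ab_group_add hilb) \<Rightarrow> ('i \<Rightarrow> 'v) set" where
  "hsum_onb I X = {(\<lambda>j. if j = i then b else 0) | i b. i \<in> I \<and> b \<in> fin_onb (X i)}"

definition linf_tensor_power ::
  "'i set \<Rightarrow> ('i \<Rightarrow> 'v::ab_group_add hilb) \<Rightarrow> nat \<Rightarrow>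
     ((('i \<Rightarrow> 'v) list \<Rightarrow> complex) \<Rightarrow> ('i \<Rightarrow> 'v) list \<Rightarrow> complex) set" where
  "linf_tensor_power I X n = vn_tensor_power (hsum I X) (hsum_onb I X) (linf_alg I X) n"

definition jointly_continuous :: "'g topology \<Rightarrow> 'e topology \<Rightarrow> ('g \<Rightarrow> 'e \<Rightarrow> 'e) \<Rightarrow> bool" where
  "jointly_continuous G E act \<longleftrightarrow> continuous_map (prod_topology G E) E (\<lambda>(g, x). act g x)"

definition conj_jointly_continuous :: "'i set \<Rightarrow> ('i \<Rightarrow> 'v::ab_group_add hilb) \<Rightarrow> bool" where
  "conj_jointly_continuous I X \<longleftrightarrow>
     jointly_continuous (linf_unitary_topology I X) (sigma_weak (hsum I X) (linf_alg I X))
       (\<lambda>u. conj_by (hsum I X) (diag_op I X u))"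

definition tensor_conj_jointly_continuous ::
  "'i set \<Rightarrow> ('i \<Rightarrow> 'v::ab_group_add hilb) \<Rightarrow> nat \<Rightarrow> bool" where
  "tensor_conj_jointly_continuous I X n \<longleftrightarrow>
     jointly_continuous (linf_unitary_topology I X)
       (sigma_weak (tensor_power (hsum_onb I X) n) (linf_tensor_power I X n))
       (\<lambda>u. conj_by (tensor_power (hsum_onb I X) n)
          (op_tensor_power (hsum I X) (hsum_onb I X) n (diag_op I X u)))"

end

theory Submission
  imports Defs
begin

text \<open>
  If only finitely many summands are non-abelian, a unitary tuple factors as \<open>u = u' d\<close>, where \<open>d\<close> is
  central and \<open>u'\<close> is trivial outside finitely many matrix blocks. Conjugation by \<open>d\<^sup>\<otimes>\<^sup>n\<close> is trivial on
  the tensor power, and \<open>u'\<^sup>\<otimes>\<^sup>n\<close> is a finite sum \<open>\<Sum>\<^sub>t c\<^sub>t(u) E\<^sub>t\<close> with fixed operators \<open>E\<^sub>t\<close> and continuous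
  coefficients \<open>c\<^sub>t\<close>. Hence \<open>\<phi>(u T u\<^sup>*)\<close> is a finite sum of products of a continuous function of \<open>u\<close> and
  a normal functional of \<open>T\<close>.

  If infinitely many summands contain orthonormal vectors \<open>e\<^sub>k, f\<^sub>k\<close>, let \<open>T\<^sub>k\<close> be the matrix unit that maps
  \<open>f\<^sub>k \<otimes> \<dots> \<otimes> f\<^sub>k\<close> to \<open>e\<^sub>k \<otimes> f\<^sub>k \<otimes> \<dots> \<otimes> f\<^sub>k\<close>. Every \<open>\<sigma>\<close>-weak neighbourhood of \<open>0\<close> contains the line through
  some nonzero \<open>T = \<Sum>\<^sub>k t\<^sub>k T\<^sub>k\<close>, with \<open>k\<close> ranging over an arbitrarily late finite set. The reflections at the
  vectors \<open>e\<^sub>k\<close> tend to \<open>1\<close>, and each of them changes the sign of a single coefficient \<open>t\<^sub>k\<close>, so that a suitable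
  normal functional cannot stay bounded on both \<open>T\<close> and its conjugates.
\<close>

section \<open>Pre-Hilbert spaces on a carrier\<close>

text \<open>The obstacle is that a sigma-weak neighbourhood of 0 contains a subspace of finite
  codimension and so is in general unbounded in norm; norm estimates on \<open>u\<close> cannot
  control the conjugates of its elements. Joint continuity is therefore obtained by separating the
  variables into finitely many products, and the central factor \<open>d\<close> has to be removed
  first because it carries infinitely many coordinates. The same unboundedness drives the converse,
  where being small on a line means vanishing on it. Condition (c) is not literally the case n = 1
  of (b): \<open>A\<close> acts on the Hilbert sum, its first tensor power on square-summable
  functions of one-element lists. Both directions are proved for each of the two representations,
  from common criteria for operators on one carrier. Completeness is not at hand in these criteria.
  Adjoints are exhibited instead of being derived from a representation theorem, and operators on
  tensor powers are given by matrices with finite rows, whose boundedness follows from Bessel's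
  inequality.\<close>

locale pre_hilbert =
  fixes V :: "'v::ab_group_add hilb"
  assumes zero_closed [simp]: "0 \<in> hcarrier V"
    and add_closed [simp]: "x \<in> hcarrier V \<Longrightarrow> y \<in> hcarrier V \<Longrightarrow> x + y \<in> hcarrier V"
    and scale_closed [simp]: "x \<in> hcarrier V \<Longrightarrow> hscale V c x \<in> hcarrier V"
    and scale_add_right: "x \<in> hcarrier V \<Longrightarrow> y \<in> hcarrier V \<Longrightarrow>
           hscale V c (x + y) = hscale V c x + hscale V c y"
    and scale_add_left: "x \<in> hcarrier V \<Longrightarrow> hscale V (c + d) x = hscale V c x + hscale V d x"
    and scale_scale: "x \<in> hcarrier V \<Longrightarrow> hscale V c (hscale V d x) = hscale V (c * d) x"
    and scale_one [simp]: "x \<in> hcarrier V \<Longrightarrow> hscale V 1 x = x"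
    and inner_cnj: "x \<in> hcarrier V \<Longrightarrow> y \<in> hcarrier V \<Longrightarrow> hinner V y x = cnj (hinner V x y)"
    and inner_add_right: "x \<in> hcarrier V \<Longrightarrow> y \<in> hcarrier V \<Longrightarrow> z \<in> hcarrier V \<Longrightarrow>
           hinner V x (y + z) = hinner V x y + hinner V x z"
    and inner_scale_right: "x \<in> hcarrier V \<Longrightarrow> y \<in> hcarrier V \<Longrightarrow>
           hinner V x (hscale V c y) = c * hinner V x y"
    and inner_pos: "x \<in> hcarrier V \<Longrightarrow> x \<noteq> 0 \<Longrightarrow> Re (hinner V x x) > 0"
begin

abbreviation \<V> where "\<V> \<equiv> hcarrier V"

lemma scale_zero_left [simp]: "x \<in> \<V> \<Longrightarrow> hscale V 0 x = 0"
  using scale_add_left[of x 0 0] by simp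

lemma scale_zero_right [simp]: "hscale V c 0 = 0"
  using scale_add_right[of 0 0 c] by simp

lemma uminus_eq_scale: "x \<in> \<V> \<Longrightarrow> - x = hscale V (-1) x"
  using scale_add_left[of x "1" "-1"] by (simp add: eq_neg_iff_add_eq_0 add.commute minus_equation_iff
      flip: neg_eq_iff_add_eq_0)

lemma uminus_closed [simp]: "x \<in> \<V> \<Longrightarrow> - x \<in> \<V>"
  by (simp add: uminus_eq_scale)

lemma diff_closed [simp]: "x \<in> \<V> \<Longrightarrow> y \<in> \<V> \<Longrightarrow> x - y \<in> \<V>"
  using add_closed[of x "-y"] by simp

lemma sum_closed [simp]: "(\<And>i. i \<in> A \<Longrightarrow> f i \<in> \<V>) \<Longrightarrow> sum f A \<in> \<V>"
  by (induction A rule: infinite_finite_induct) auto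

lemma scale_sum_right:
  "(\<And>i. i \<in> A \<Longrightarrow> f i \<in> \<V>) \<Longrightarrow> hscale V c (sum f A) = (\<Sum>i\<in>A. hscale V c (f i))"
  by (induction A rule: infinite_finite_induct) (auto simp: scale_add_right)

lemma inner_add_left:
  assumes "x \<in> \<V>" "y \<in> \<V>" "z \<in> \<V>"
  shows "hinner V (x + y) z = hinner V x z + hinner V y z"
  using assms by (simp add: inner_cnj[of z] inner_add_right)

lemma inner_scale_left:
  assumes "x \<in> \<V>" "y \<in> \<V>"
  shows "hinner V (hscale V c x) y = cnj c * hinner V x y"
  using assms by (simp add: inner_cnj[of y] inner_scale_right)

lemma inner_zero_right [simp]: "x \<in> \<V> \<Longrightarrow> hinner V x 0 = 0"
  using inner_scale_right[of x 0 0] by simp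

lemma inner_zero_left [simp]: "x \<in> \<V> \<Longrightarrow> hinner V 0 x = 0"
  using inner_cnj[of x 0] by simp

lemma inner_minus_right: "x \<in> \<V> \<Longrightarrow> y \<in> \<V> \<Longrightarrow> hinner V x (- y) = - hinner V x y"
  by (simp add: uminus_eq_scale inner_scale_right)

lemma inner_minus_left: "x \<in> \<V> \<Longrightarrow> y \<in> \<V> \<Longrightarrow> hinner V (- x) y = - hinner V x y"
  by (simp add: uminus_eq_scale inner_scale_left)

lemma inner_diff_right:
  "x \<in> \<V> \<Longrightarrow> y \<in> \<V> \<Longrightarrow> z \<in> \<V> \<Longrightarrow>
     hinner V x (y - z) = hinner V x y - hinner V x z"
  using inner_add_right[of x y "- z"] by (simp add: inner_minus_right)

lemma inner_diff_left:
  "x \<in> \<V> \<Longrightarrow> y \<in> \<V> \<Longrightarrow> z \<in> \<V> \<Longrightarrow>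
     hinner V (x - y) z = hinner V x z - hinner V y z"
  using inner_add_left[of x "- y" z] by (simp add: inner_minus_left)

lemma inner_sum_right:
  "x \<in> \<V> \<Longrightarrow> (\<And>i. i \<in> A \<Longrightarrow> f i \<in> \<V>) \<Longrightarrow>
     hinner V x (sum f A) = (\<Sum>i\<in>A. hinner V x (f i))"
  by (induction A rule: infinite_finite_induct) (auto simp: inner_add_right)

lemma inner_sum_left:
  "x \<in> \<V> \<Longrightarrow> (\<And>i. i \<in> A \<Longrightarrow> f i \<in> \<V>) \<Longrightarrow>
     hinner V (sum f A) x = (\<Sum>i\<in>A. hinner V (f i) x)"
  by (induction A rule: infinite_finite_induct) (auto simp: inner_add_left)

lemma inner_self_nonneg: "x \<in> \<V> \<Longrightarrow> Re (hinner V x x) \<ge> 0"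
  using inner_pos[of x] by (cases "x = 0") auto

lemma hnorm_sq: "x \<in> \<V> \<Longrightarrow> (hnorm V x)\<^sup>2 = Re (hinner V x x)"
  by (simp add: hnorm_def inner_self_nonneg)

lemma inner_self: "x \<in> \<V> \<Longrightarrow> hinner V x x = complex_of_real ((hnorm V x)\<^sup>2)"
  using inner_cnj[of x x] by (simp add: hnorm_sq complex_eq_iff del: of_real_power)

lemma hnorm_nonneg [simp]: "x \<in> \<V> \<Longrightarrow> hnorm V x \<ge> 0"
  by (simp add: hnorm_def inner_self_nonneg)

lemma hnorm_eq_0_iff: "x \<in> \<V> \<Longrightarrow> hnorm V x = 0 \<longleftrightarrow> x = 0"
  using inner_pos[of x] by (cases "x = 0") (auto simp: hnorm_def)

lemma hnorm_zero [simp]: "hnorm V 0 = 0"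
  by (simp add: hnorm_eq_0_iff)

lemma hnorm_scale: "x \<in> \<V> \<Longrightarrow> hnorm V (hscale V c x) = cmod c * hnorm V x"
proof (rule power2_eq_imp_eq)
  assume x: "x \<in> \<V>"
  have "hinner V (hscale V c x) (hscale V c x) = of_real ((cmod c)\<^sup>2) * of_real ((hnorm V x)\<^sup>2)"
    by (simp add: inner_scale_left inner_scale_right x inner_self[OF x] complex_norm_square
        del: of_real_power)
  then show "(hnorm V (hscale V c x))\<^sup>2 = (cmod c * hnorm V x)\<^sup>2"
    by (simp only: hnorm_sq scale_closed x power_mult_distrib flip: of_real_mult) simp
qed auto

lemma hnorm_uminus: "x \<in> \<V> \<Longrightarrow> hnorm V (- x) = hnorm V x"
  by (simp add: uminus_eq_scale hnorm_scale)

lemma hnorm_minus_commute: "x \<in> \<V> \<Longrightarrow> y \<in> \<V> \<Longrightarrow> hnorm V (x - y) = hnorm V (y - x)"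
  using hnorm_uminus[of "x - y"] by simp

lemma Cauchy_Schwarz:
  assumes x: "x \<in> \<V>" and y: "y \<in> \<V>"
  shows "cmod (hinner V x y) \<le> hnorm V x * hnorm V y"
proof (cases "x = 0")
  case False
  define N where "N = (hnorm V x)\<^sup>2"
  have N: "N > 0" using inner_pos[OF x False] by (simp add: N_def hnorm_sq x)
  define c where "c = hinner V x y"
  \<comment> \<open>\<open>z\<close> is \<open>N\<close> times the component of \<open>y\<close>
    orthogonal to \<open>x\<close>; the factor avoids a division, and nonnegativity of its square
    norm is the claim.\<close>
  define z where "z = hscale V N y - hscale V c x"
  have z: "z \<in> \<V>" by (simp add: z_def x y)
  have "hinner V z z = of_real N * (of_real N * of_real ((hnorm V y)\<^sup>2)) - of_real N * (c * cnj c)"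
    using inner_cnj[OF x y]
    by (simp add: z_def inner_diff_left inner_diff_right inner_scale_left inner_scale_right x y
        inner_self[OF x] inner_self[OF y] flip: c_def N_def) (simp add: algebra_simps)
  also have "c * cnj c = of_real ((cmod c)\<^sup>2)" by (simp add: complex_norm_square del: of_real_power)
  finally have "hinner V z z = of_real (N * (N * (hnorm V y)\<^sup>2 - (cmod c)\<^sup>2))"
    by (simp only: of_real_mult of_real_diff right_diff_distrib)
  then have "Re (hinner V z z) = N * (N * (hnorm V y)\<^sup>2 - (cmod c)\<^sup>2)"
    by (simp only: Re_complex_of_real)
  then have "N * (N * (hnorm V y)\<^sup>2 - (cmod c)\<^sup>2) \<ge> 0"
    using inner_self_nonneg[OF z] by simp
  then have "(cmod c)\<^sup>2 \<le> (hnorm V x * hnorm V y)\<^sup>2"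
    using N by (simp add: zero_le_mult_iff N_def power_mult_distrib)
  then show ?thesis
    by (metis c_def hnorm_nonneg mult_nonneg_nonneg power2_le_imp_le x y)
qed (use y in simp)

lemma hnorm_triangle:
  assumes x: "x \<in> \<V>" and y: "y \<in> \<V>"
  shows "hnorm V (x + y) \<le> hnorm V x + hnorm V y"
proof (rule power2_le_imp_le)
  have "(hnorm V (x + y))\<^sup>2 = (hnorm V x)\<^sup>2 + (hnorm V y)\<^sup>2 + 2 * Re (hinner V x y)"
    using inner_cnj[OF x y] by (simp add: hnorm_sq x y inner_add_left inner_add_right)
  also have "\<dots> \<le> (hnorm V x)\<^sup>2 + (hnorm V y)\<^sup>2 + 2 * (hnorm V x * hnorm V y)"
    using Cauchy_Schwarz[OF x y] complex_Re_le_cmod[of "hinner V x y"] by simp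
  finally show "(hnorm V (x + y))\<^sup>2 \<le> (hnorm V x + hnorm V y)\<^sup>2"
    by (simp add: power2_sum)
qed (use x y in simp)

lemma inner_ext:
  assumes "x \<in> \<V>" "y \<in> \<V>" "\<And>z. z \<in> \<V> \<Longrightarrow> hinner V z x = hinner V z y"
  shows "x = y"
proof -
  have "hinner V (x - y) (x - y) = 0" using assms by (simp add: inner_diff_right)
  then have "x - y = 0" using inner_pos[of "x - y"] assms(1,2) by fastforce
  then show ?thesis by simp
qed

section \<open>Bounded operators on the carrier\<close>

lemma hopsI:
  assumes "\<And>x. x \<in> \<V> \<Longrightarrow> T x \<in> \<V>"
    and "\<And>x y. x \<in> \<V> \<Longrightarrow> y \<in> \<V> \<Longrightarrow> T (x + y) = T x + T y"
    and "\<And>x c. x \<in> \<V> \<Longrightarrow> T (hscale V c x) = hscale V c (T x)"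
    and "\<And>x. x \<in> \<V> \<Longrightarrow> hnorm V (T x) \<le> K * hnorm V x"
    and "\<And>x. x \<notin> \<V> \<Longrightarrow> T x = 0"
  shows "T \<in> hops V"
  unfolding hops_def using assms by (intro CollectI conjI ballI allI impI exI[of _ K]) simp_all

lemma hops_closed [simp]: "T \<in> hops V \<Longrightarrow> T x \<in> \<V>"
  unfolding hops_def by (cases "x \<in> \<V>") simp_all

lemma hops_add: "T \<in> hops V \<Longrightarrow> x \<in> \<V> \<Longrightarrow> y \<in> \<V> \<Longrightarrow> T (x + y) = T x + T y"
  unfolding hops_def by blast

lemma hops_scale: "T \<in> hops V \<Longrightarrow> x \<in> \<V> \<Longrightarrow> T (hscale V c x) = hscale V c (T x)"
  unfolding hops_def by blast

lemma hops_outside: "T \<in> hops V \<Longrightarrow> x \<notin> \<V> \<Longrightarrow> T x = 0"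
  unfolding hops_def by blast

lemma hops_bounded:
  assumes "T \<in> hops V"
  obtains K where "K \<ge> 0" "\<And>x. x \<in> \<V> \<Longrightarrow> hnorm V (T x) \<le> K * hnorm V x"
proof -
  from assms obtain K where K: "\<And>x. x \<in> \<V> \<Longrightarrow> hnorm V (T x) \<le> K * hnorm V x"
    unfolding hops_def by blast
  \<comment> \<open>On the zero carrier the bound provided by \<open>hops_def\<close> can be
    negative; the maximum with 0 makes it usable in all cases.\<close>
  have "hnorm V (T x) \<le> max K 0 * hnorm V x" if "x \<in> \<V>" for x
    using K[OF that] mult_right_mono[of K "max K 0" "hnorm V x"] that by simp
  then show ?thesis using that[of "max K 0"] by simp
qed

lemma hops_zero [simp]: "T \<in> hops V \<Longrightarrow> T 0 = 0"
  using hops_add[of T 0 0] by simp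

lemma hops_diff: "T \<in> hops V \<Longrightarrow> x \<in> \<V> \<Longrightarrow> y \<in> \<V> \<Longrightarrow> T (x - y) = T x - T y"
  by (metis diff_add_cancel diff_closed eq_diff_eq hops_add)

lemma hops_sum:
  "T \<in> hops V \<Longrightarrow> (\<And>i. i \<in> A \<Longrightarrow> f i \<in> \<V>) \<Longrightarrow> T (sum f A) = (\<Sum>i\<in>A. T (f i))"
  by (induction A rule: infinite_finite_induct) (auto simp: hops_add)

lemma hops_ext:
  assumes "S \<in> hops V" "T \<in> hops V" "\<And>x. x \<in> \<V> \<Longrightarrow> S x = T x"
  shows "S = T"
  by (metis assms ext hops_outside)

lemma hops_comp [simp]:
  assumes "S \<in> hops V" "T \<in> hops V"
  shows "S \<circ> T \<in> hops V"
proof -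
  obtain K where K: "K \<ge> 0" "\<And>x. x \<in> \<V> \<Longrightarrow> hnorm V (S x) \<le> K * hnorm V x"
    using hops_bounded assms by metis
  obtain L where L: "L \<ge> 0" "\<And>x. x \<in> \<V> \<Longrightarrow> hnorm V (T x) \<le> L * hnorm V x"
    using hops_bounded assms by metis
  show ?thesis
  proof (rule hopsI[where K = "K * L"])
    fix x assume x: "x \<in> \<V>"
    have "hnorm V (S (T x)) \<le> K * hnorm V (T x)" using assms by (intro K) simp
    also have "\<dots> \<le> K * (L * hnorm V x)" using L x K by (intro mult_left_mono) auto
    finally show "hnorm V ((S \<circ> T) x) \<le> K * L * hnorm V x" by (simp add: mult.assoc)
  qed (use assms in \<open>auto simp: hops_add hops_scale hops_outside\<close>)
qed

lemma hid_apply [simp]: "x \<in> \<V> \<Longrightarrow> hid V x = x"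
  by (simp add: hid_def)

lemma hid_hops [simp]: "hid V \<in> hops V"
  by (rule hopsI[where K = 1]) (auto simp: hid_def)

lemma zero_hops [simp]: "(\<lambda>x. 0) \<in> hops V"
  by (rule hopsI[where K = 0]) auto

lemma add_hops:
  assumes "S \<in> hops V" "T \<in> hops V"
  shows "(\<lambda>x. S x + T x) \<in> hops V"
proof -
  obtain K where K: "K \<ge> 0" "\<And>x. x \<in> \<V> \<Longrightarrow> hnorm V (S x) \<le> K * hnorm V x"
    using hops_bounded assms by metis
  obtain L where L: "L \<ge> 0" "\<And>x. x \<in> \<V> \<Longrightarrow> hnorm V (T x) \<le> L * hnorm V x"
    using hops_bounded assms by metis
  show ?thesis
  proof (rule hopsI[where K = "K + L"])
    fix x assume x: "x \<in> \<V>"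
    have "hnorm V (S x + T x) \<le> hnorm V (S x) + hnorm V (T x)"
      using assms by (intro hnorm_triangle) auto
    also have "\<dots> \<le> (K + L) * hnorm V x" using K(2)[OF x] L(2)[OF x] by (simp add: algebra_simps)
    finally show "hnorm V (S x + T x) \<le> (K + L) * hnorm V x" .
  qed (use assms in \<open>auto simp: hops_add hops_scale hops_outside scale_add_right\<close>)
qed

lemma scale_hops:
  assumes "T \<in> hops V"
  shows "(\<lambda>x. hscale V c (T x)) \<in> hops V"
proof -
  obtain K where K: "K \<ge> 0" "\<And>x. x \<in> \<V> \<Longrightarrow> hnorm V (T x) \<le> K * hnorm V x"
    using hops_bounded assms by metis
  show ?thesis
  proof (rule hopsI[where K = "cmod c * K"])
    fix x assume x: "x \<in> \<V>"
    have "cmod c * hnorm V (T x) \<le> cmod c * (K * hnorm V x)" using x by (intro mult_left_mono K) auto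
    then show "hnorm V (hscale V c (T x)) \<le> cmod c * K * hnorm V x"
      using assms by (simp add: hnorm_scale mult.assoc)
  qed (use assms in \<open>auto simp: hops_add hops_scale hops_outside scale_add_right scale_scale mult.commute\<close>)
qed

lemma sum_hops:
  "(\<And>i. i \<in> A \<Longrightarrow> T i \<in> hops V) \<Longrightarrow> (\<lambda>x. \<Sum>i\<in>A. T i x) \<in> hops V"
  by (induction A rule: infinite_finite_induct) (auto simp: add_hops)

section \<open>Adjoint pairs, the operator norm and the unitary topology\<close>

definition adj_pair :: "('v \<Rightarrow> 'v) \<Rightarrow> ('v \<Rightarrow> 'v) \<Rightarrow> bool" where
  "adj_pair S T \<longleftrightarrow> S \<in> hops V \<and> T \<in> hops V \<and>
     (\<forall>x\<in>\<V>. \<forall>y\<in>\<V>. hinner V (S x) y = hinner V x (T y))"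

lemma adj_pairD:
  assumes "adj_pair S T"
  shows "S \<in> hops V" "T \<in> hops V"
    "x \<in> \<V> \<Longrightarrow> y \<in> \<V> \<Longrightarrow> hinner V (S x) y = hinner V x (T y)"
  using assms by (auto simp: adj_pair_def)

lemma adj_pair_sym: "adj_pair S T \<Longrightarrow> adj_pair T S"
  unfolding adj_pair_def by (metis hops_closed inner_cnj)

lemma hadj_eq:
  assumes "adj_pair S T"
  shows "hadj V T = S"
  unfolding hadj_def
proof (rule the_equality)
  show "S \<in> hops V \<and> (\<forall>x\<in>\<V>. \<forall>y\<in>\<V>. hinner V (S x) y = hinner V x (T y))"
    using assms by (simp add: adj_pair_def)
next
  fix R assume R: "R \<in> hops V \<and> (\<forall>x\<in>\<V>. \<forall>y\<in>\<V>. hinner V (R x) y = hinner V x (T y))"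
  show "R = S"
  proof (rule hops_ext)
    fix x assume x: "x \<in> \<V>"
    show "R x = S x"
    proof (rule inner_ext)
      fix z assume z: "z \<in> \<V>"
      then have "hinner V (R x) z = hinner V (S x) z" using R x assms by (simp add: adj_pair_def)
      then show "hinner V z (R x) = hinner V z (S x)"
        using inner_cnj[of "R x" z] inner_cnj[of "S x" z] R assms z by (simp add: adj_pair_def)
    qed (use R assms in \<open>auto simp: adj_pair_def\<close>)
  qed (use R assms in \<open>auto simp: adj_pair_def\<close>)
qed

lemma unitariesI:
  assumes "adj_pair S T" "\<And>x. x \<in> \<V> \<Longrightarrow> S (T x) = x" "\<And>x. x \<in> \<V> \<Longrightarrow> T (S x) = x"
  shows "T \<in> unitaries V"
proof -
  note [simp] = hadj_eq[OF assms(1)] adj_pairD(1,2)[OF assms(1)]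
  have "S \<circ> T = hid V" "T \<circ> S = hid V"
    by (rule hops_ext; simp add: assms)+
  then show ?thesis by (simp add: unitaries_def)
qed

lemma hopnorm_bdd:
  assumes "T \<in> hops V"
  shows "bdd_above ((\<lambda>x. hnorm V (T x)) ` {x \<in> \<V>. hnorm V x \<le> 1})"
proof -
  obtain K where K: "K \<ge> 0" "\<And>x. x \<in> \<V> \<Longrightarrow> hnorm V (T x) \<le> K * hnorm V x"
    using hops_bounded assms by metis
  show ?thesis
  proof (rule bdd_aboveI2)
    fix x assume "x \<in> {x \<in> \<V>. hnorm V x \<le> 1}"
    then show "hnorm V (T x) \<le> K" using K(1) K(2)[of x] mult_left_le[of "hnorm V x" K] by auto
  qed
qed

lemma hnorm_le_hopnorm:
  assumes T: "T \<in> hops V" and x: "x \<in> \<V>"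
  shows "hnorm V (T x) \<le> hopnorm V T * hnorm V x"
proof (cases "x = 0")
  case False
  define c where "c = complex_of_real (1 / hnorm V x)"
  have n: "hnorm V x > 0" using hnorm_eq_0_iff[OF x] False hnorm_nonneg[OF x] by linarith
  have "hnorm V (T (hscale V c x)) \<le> hopnorm V T"
    unfolding hopnorm_def
    by (rule cSUP_upper) (use n x in \<open>auto simp: hopnorm_bdd[OF T] hnorm_scale c_def norm_divide\<close>)
  then show ?thesis using n x T by (simp add: hops_scale hnorm_scale c_def norm_divide field_simps)
qed (use T in simp)

lemma hopnorm_le:
  assumes "\<And>x. x \<in> \<V> \<Longrightarrow> hnorm V (T x) \<le> K * hnorm V x" "K \<ge> 0"
  shows "hopnorm V T \<le> K"
  unfolding hopnorm_def
proof (rule cSUP_least)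
  show "{x \<in> \<V>. hnorm V x \<le> 1} \<noteq> {}" using zero_closed hnorm_zero by fastforce
  fix x assume "x \<in> {x \<in> \<V>. hnorm V x \<le> 1}"
  then show "hnorm V (T x) \<le> K"
    using assms(1)[of x] assms(2) mult_left_le[of "hnorm V x" K] by auto
qed

lemma hopnorm_nonneg: "T \<in> hops V \<Longrightarrow> hopnorm V T \<ge> 0"
  unfolding hopnorm_def
  by (rule cSUP_upper2[where x = 0]) (auto simp: hopnorm_bdd)

lemma hopnorm_triangle:
  assumes "S \<in> hops V" "T \<in> hops V"
  shows "hopnorm V (\<lambda>x. S x + T x) \<le> hopnorm V S + hopnorm V T"
proof (rule hopnorm_le)
  fix x assume x: "x \<in> \<V>"
  have "hnorm V (S x + T x) \<le> hnorm V (S x) + hnorm V (T x)"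
    using assms by (intro hnorm_triangle) auto
  also have "\<dots> \<le> hopnorm V S * hnorm V x + hopnorm V T * hnorm V x"
    using assms x by (intro add_mono hnorm_le_hopnorm)
  finally show "hnorm V (S x + T x) \<le> (hopnorm V S + hopnorm V T) * hnorm V x"
    by (simp add: algebra_simps)
qed (use assms hopnorm_nonneg in auto)

lemma diff_hops: "S \<in> hops V \<Longrightarrow> T \<in> hops V \<Longrightarrow> (\<lambda>x. S x - T x) \<in> hops V"
  using add_hops[of S "\<lambda>x. hscale V (-1) (T x)"] scale_hops[of T "-1"]
  by (simp flip: uminus_eq_scale)

definition unitary_dist :: "('v \<Rightarrow> 'v) \<Rightarrow> ('v \<Rightarrow> 'v) \<Rightarrow> real" where
  "unitary_dist u v = (if u \<in> unitaries V \<and> v \<in> unitaries V then hopnorm V (\<lambda>x. u x - v x) else 0)"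

lemma unitary_topology_eq: "unitary_topology V = Metric_space.mtopology (unitaries V) unitary_dist"
  unfolding unitary_topology_def unitary_dist_def[abs_def] ..

lemma unitary_hops: "u \<in> unitaries V \<Longrightarrow> u \<in> hops V"
  by (simp add: unitaries_def)

lemma Metric_space_unitaries: "Metric_space (unitaries V) unitary_dist"
proof
  show "0 \<le> unitary_dist u v" for u v
    by (auto simp: unitary_dist_def unitary_hops intro!: hopnorm_nonneg diff_hops)
  show "unitary_dist u v = unitary_dist v u" for u v
    by (auto simp: unitary_dist_def hopnorm_def hnorm_minus_commute unitary_hops intro!: SUP_cong)
  fix u v assume uv: "u \<in> unitaries V" "v \<in> unitaries V"
  note hops = unitary_hops[OF uv(1)] unitary_hops[OF uv(2)]
  show "unitary_dist u v = 0 \<longleftrightarrow> u = v"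
  proof
    assume "unitary_dist u v = 0"
    then have 0: "hopnorm V (\<lambda>x. u x - v x) = 0" using uv by (simp add: unitary_dist_def)
    show "u = v"
    proof (rule hops_ext[OF hops])
      fix x assume x: "x \<in> \<V>"
      have "hnorm V (u x - v x) \<le> 0"
        using hnorm_le_hopnorm[OF diff_hops[OF hops] x] 0 by simp
      then have "hnorm V (u x - v x) = 0" using hops by (intro antisym) simp_all
      then show "u x = v x" using hnorm_eq_0_iff[of "u x - v x"] hops by simp
    qed
  next
    assume "u = v"
    then have "hopnorm V (\<lambda>x. u x - v x) \<le> 0" by (intro hopnorm_le) auto
    then show "unitary_dist u v = 0"
      using hopnorm_nonneg[OF diff_hops[OF hops]] by (simp add: unitary_dist_def)
  qed
  show "unitary_dist u w \<le> unitary_dist u v + unitary_dist v w" if "w \<in> unitaries V" for w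
    using hopnorm_triangle[OF diff_hops[OF hops] diff_hops[OF hops(2) unitary_hops[OF that]]] uv that
    by (simp add: unitary_dist_def)
qed

lemma topspace_unitary_topology [simp]: "topspace (unitary_topology V) = unitaries V"
  unfolding unitary_topology_eq
  by (rule Metric_space.topspace_mtopology[OF Metric_space_unitaries])

text \<open>By Cauchy-Schwarz the coefficient is Lipschitz with constant
  \<open>hnorm V x * hnorm V y\<close>. The scalar functions of \<open>u\<close> in the positive
  direction are built from such coefficients by products and conjugation.\<close>

lemma continuous_map_unitary_coefficient:
  assumes x: "x \<in> \<V>" and y: "y \<in> \<V>"
  shows "continuous_map (unitary_topology V) euclidean (\<lambda>u. hinner V x (u y))"
proof -
  interpret U: Metric_space "unitaries V" unitary_dist by (rule Metric_space_unitaries)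
  have "Lipschitz_continuous_map (metric (unitaries V, unitary_dist)) euclidean_metric
     (\<lambda>u. hinner V x (u y))"
    unfolding Lipschitz_continuous_map_def
  proof (intro conjI exI ballI)
    fix v w assume "v \<in> mspace (metric (unitaries V, unitary_dist))"
      "w \<in> mspace (metric (unitaries V, unitary_dist))"
    then have vw: "v \<in> unitaries V" "w \<in> unitaries V" by simp_all
    note h = unitary_hops[OF vw(1)] unitary_hops[OF vw(2)]
    have "dist (hinner V x (v y)) (hinner V x (w y)) = cmod (hinner V x (v y - w y))"
      using h x by (simp add: dist_norm inner_diff_right)
    also have "\<dots> \<le> hnorm V x * hnorm V (v y - w y)"
      using h x by (intro Cauchy_Schwarz) auto
    also have "\<dots> \<le> hnorm V x * (hopnorm V (\<lambda>z. v z - w z) * hnorm V y)"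
      using hnorm_le_hopnorm[OF diff_hops[OF h] y] x by (intro mult_left_mono) auto
    finally show "mdist euclidean_metric (hinner V x (v y)) (hinner V x (w y)) \<le>
        (hnorm V x * hnorm V y) * mdist (metric (unitaries V, unitary_dist)) v w"
      using vw by (simp add: unitary_dist_def mult_ac)
  qed auto
  from Lipschitz_continuous_imp_continuous_map[OF this] show ?thesis
    by (simp add: unitary_topology_eq mtopology_of_def)
qed

end

section \<open>The sigma-weak topology\<close>

text \<open>More unknowns than equations, on a support as late as desired. The induction adds one
  functional at a time and eliminates it between two solutions of the previous system; leaving
  \<open>K\<close> arbitrary lets the second solution start behind the first.\<close>

lemma exists_common_kernel:
  fixes \<Phi> :: "(nat \<Rightarrow> complex) set"
  assumes "finite \<Phi>"
  shows "\<exists>S t. finite S \<and> S \<subseteq> {K..} \<and> (\<exists>k\<in>S. t k \<noteq> 0) \<and> (\<forall>g\<in>\<Phi>. (\<Sum>k\<in>S. t k * g k) = 0)"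
  using assms
proof (induction \<Phi> arbitrary: K rule: finite_induct)
  case empty
  show ?case by (rule exI[of _ "{K}"], rule exI[of _ "\<lambda>_. 1"]) auto
next
  case (insert h \<Phi>)
  obtain S t where S: "finite S" "S \<subseteq> {K..}" "\<exists>k\<in>S. t k \<noteq> 0"
    "\<And>g. g \<in> \<Phi> \<Longrightarrow> (\<Sum>k\<in>S. t k * g k) = 0"
    using insert.IH[of K] by blast
  obtain R r where R: "finite R" "R \<subseteq> {max K (Suc (Max S))..}" "\<exists>k\<in>R. r k \<noteq> 0"
    "\<And>g. g \<in> \<Phi> \<Longrightarrow> (\<Sum>k\<in>R. r k * g k) = 0"
    using insert.IH[of "max K (Suc (Max S))"] by blast
  \<comment> \<open>Disjoint supports keep the combination of the two solutions from
    cancelling.\<close>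
  have disj: "S \<inter> R = {}"
    using R(2) Max_ge[OF S(1)] by fastforce
  define a where "a = (\<Sum>k\<in>S. t k * h k)"
  define b where "b = (\<Sum>k\<in>R. r k * h k)"
  show ?case
  proof (cases "a = 0")
    case True
    then show ?thesis using S by (intro exI[of _ S] exI[of _ t]) (auto simp: a_def)
  next
    case False
    \<comment> \<open>This is \<open>b t - a r\<close>, whose sum against \<open>h\<close> is
      \<open>b a - a b = 0\<close>. It is nonzero because \<open>a \<noteq> 0\<close> and
      \<open>r\<close> is not identically 0 on \<open>R\<close>.\<close>
    define s where "s k = (if k \<in> S then b * t k else - a * r k)" for k
    have sum: "(\<Sum>k\<in>S \<union> R. s k * g k) = b * (\<Sum>k\<in>S. t k * g k) - a * (\<Sum>k\<in>R. r k * g k)" for g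
    proof -
      have "(\<Sum>k\<in>S \<union> R. s k * g k) = (\<Sum>k\<in>S. s k * g k) + (\<Sum>k\<in>R. s k * g k)"
        by (rule sum.union_disjoint) (use S R disj in auto)
      also have "(\<Sum>k\<in>S. s k * g k) = b * (\<Sum>k\<in>S. t k * g k)"
        by (simp add: s_def sum_distrib_left mult.assoc)
      also have "(\<Sum>k\<in>R. s k * g k) = (\<Sum>k\<in>R. - a * (r k * g k))"
        by (rule sum.cong) (use disj in \<open>auto simp: s_def\<close>)
      finally show ?thesis by (simp add: sum_distrib_left sum_negf)
    qed
    obtain k where k: "k \<in> R" "r k \<noteq> 0" using R by blast
    show ?thesis
    proof (intro exI[of _ "S \<union> R"] exI[of _ s] conjI ballI)
      show "\<exists>k\<in>S \<union> R. s k \<noteq> 0"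
        using k False disj by (intro bexI[of _ k]) (auto simp: s_def)
      fix g assume "g \<in> insert h \<Phi>"
      then show "(\<Sum>k\<in>S \<union> R. s k * g k) = 0"
        unfolding sum using S(4) R(4) by (auto simp: a_def b_def)
    qed (use S R in auto)
  qed
qed

lemma continuous_map_complex_mult:
  fixes f g :: "'a \<Rightarrow> complex"
  assumes "continuous_map X euclidean f" "continuous_map X euclidean g"
  shows "continuous_map X euclidean (\<lambda>x. f x * g x)"
  using assms by (auto simp: continuous_map_atin intro: tendsto_mult)

lemma continuous_map_complex_cnj:
  assumes "continuous_map X euclidean f"
  shows "continuous_map X euclidean (\<lambda>x. cnj (f x))"
  using assms by (auto simp: continuous_map_atin intro: tendsto_cnj)

lemma continuous_map_complex_prod:
  fixes f :: "'i \<Rightarrow> 'a \<Rightarrow> complex"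
  assumes "\<And>i. i \<in> A \<Longrightarrow> continuous_map X euclidean (f i)"
  shows "continuous_map X euclidean (\<lambda>x. \<Prod>i\<in>A. f i x)"
  using assms by (induction A rule: infinite_finite_induct) (auto intro: continuous_map_complex_mult)

context pre_hilbert
begin

section \<open>Normal functionals and the topology they generate\<close>

lemma normal_functionalE:
  assumes "\<phi> \<in> normal_functionals V"
  obtains \<xi> \<eta> :: "nat \<Rightarrow> 'v" where "\<phi> = (\<lambda>T. \<Sum>k. hinner V (\<eta> k) (T (\<xi> k)))"
    "\<And>k. \<xi> k \<in> \<V>" "\<And>k. \<eta> k \<in> \<V>"
    "summable (\<lambda>k. (hnorm V (\<xi> k))\<^sup>2)" "summable (\<lambda>k. (hnorm V (\<eta> k))\<^sup>2)"
  using assms unfolding normal_functionals_def by blast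

lemma normal_functionalI:
  assumes "\<And>k. \<xi> k \<in> \<V>" "\<And>k. \<eta> k \<in> \<V>"
    "summable (\<lambda>k. (hnorm V (\<xi> k))\<^sup>2)" "summable (\<lambda>k. (hnorm V (\<eta> k))\<^sup>2)"
  shows "(\<lambda>T. \<Sum>k. hinner V (\<eta> k) (T (\<xi> k))) \<in> normal_functionals V"
  using assms unfolding normal_functionals_def by blast

lemma summable_normal:
  fixes \<xi> \<eta> :: "nat \<Rightarrow> 'v"
  assumes "\<And>k. \<xi> k \<in> \<V>" "\<And>k. \<eta> k \<in> \<V>"
    and s: "summable (\<lambda>k. (hnorm V (\<xi> k))\<^sup>2)" "summable (\<lambda>k. (hnorm V (\<eta> k))\<^sup>2)"
    and T: "T \<in> hops V"
  shows "summable (\<lambda>k. hinner V (\<eta> k) (T (\<xi> k)))"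
proof -
  obtain K where K: "K \<ge> 0" "\<And>x. x \<in> \<V> \<Longrightarrow> hnorm V (T x) \<le> K * hnorm V x"
    using hops_bounded T by metis
  show ?thesis
  proof (rule summable_comparison_test')
    show "summable (\<lambda>k. K * ((hnorm V (\<xi> k))\<^sup>2 + (hnorm V (\<eta> k))\<^sup>2))"
      by (intro summable_mult summable_add s)
    fix k
    define a where "a = hnorm V (\<xi> k)"
    define b where "b = hnorm V (\<eta> k)"
    have ab: "a \<ge> 0" "b \<ge> 0" using assms by (auto simp: a_def b_def)
    have "a * b \<le> a\<^sup>2 + b\<^sup>2"
      using sum_squares_bound[of a b] mult_nonneg_nonneg[OF ab] by simp
    have "norm (hinner V (\<eta> k) (T (\<xi> k))) \<le> b * hnorm V (T (\<xi> k))"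
      unfolding b_def by (intro Cauchy_Schwarz hops_closed T assms(2))
    also have "\<dots> \<le> b * (K * a)"
      unfolding a_def by (intro mult_left_mono K(2) assms(1) ab(2))
    also have "\<dots> = K * (a * b)" by simp
    also have "\<dots> \<le> K * (a\<^sup>2 + b\<^sup>2)"
      by (intro mult_left_mono K(1)) fact
    finally show "norm (hinner V (\<eta> k) (T (\<xi> k))) \<le> K * ((hnorm V (\<xi> k))\<^sup>2 + (hnorm V (\<eta> k))\<^sup>2)"
      by (simp add: a_def b_def)
  qed
qed

lemma normal_functional_sum:
  assumes \<phi>: "\<phi> \<in> normal_functionals V" and T: "\<And>i. i \<in> A \<Longrightarrow> T i \<in> hops V"
  shows "\<phi> (\<lambda>x. \<Sum>i\<in>A. hscale V (c i) (T i x)) = (\<Sum>i\<in>A. c i * \<phi> (T i))"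
proof -
  obtain \<xi> \<eta> :: "nat \<Rightarrow> 'v" where \<phi>_eq: "\<phi> = (\<lambda>T. \<Sum>k. hinner V (\<eta> k) (T (\<xi> k)))"
    and \<xi>: "\<And>k. \<xi> k \<in> \<V>" and \<eta>: "\<And>k. \<eta> k \<in> \<V>"
    and s: "summable (\<lambda>k. (hnorm V (\<xi> k))\<^sup>2)" "summable (\<lambda>k. (hnorm V (\<eta> k))\<^sup>2)"
    by (rule normal_functionalE[OF \<phi>]) (rule that)
  note summ = summable_normal[OF \<xi> \<eta> s T]
  have "\<phi> (\<lambda>x. \<Sum>i\<in>A. hscale V (c i) (T i x)) = (\<Sum>k. \<Sum>i\<in>A. c i * hinner V (\<eta> k) (T i (\<xi> k)))"
    unfolding \<phi>_eq using T \<eta> by (simp add: inner_sum_right inner_scale_right cong: sum.cong)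
  also have "\<dots> = (\<Sum>i\<in>A. \<Sum>k. c i * hinner V (\<eta> k) (T i (\<xi> k)))"
    by (rule suminf_sum) (intro summable_mult summ)
  also have "\<dots> = (\<Sum>i\<in>A. c i * \<phi> (T i))"
    unfolding \<phi>_eq by (intro sum.cong refl suminf_mult summ)
  finally show ?thesis .
qed

text \<open>\<open>L\<close> moves to the vectors \<open>\<eta> k\<close> as its adjoint
  \<open>L'\<close>, \<open>R\<close> is applied to the vectors \<open>\<xi> k\<close>, and bounded
  operators preserve square-summability; so two-sided multiplication preserves normality.\<close>

lemma normal_functional_conj:
  assumes \<phi>: "\<phi> \<in> normal_functionals V" and L: "adj_pair L' L" and R: "R \<in> hops V"
  obtains \<psi> where "\<psi> \<in> normal_functionals V"
    "\<And>T. T \<in> hops V \<Longrightarrow> \<phi> (\<lambda>x. L (T (R x))) = \<psi> T"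
proof -
  obtain \<xi> \<eta> :: "nat \<Rightarrow> 'v" where \<phi>_eq: "\<phi> = (\<lambda>T. \<Sum>k. hinner V (\<eta> k) (T (\<xi> k)))"
    and \<xi>: "\<And>k. \<xi> k \<in> \<V>" and \<eta>: "\<And>k. \<eta> k \<in> \<V>"
    and s: "summable (\<lambda>k. (hnorm V (\<xi> k))\<^sup>2)" "summable (\<lambda>k. (hnorm V (\<eta> k))\<^sup>2)"
    by (rule normal_functionalE[OF \<phi>]) (rule that)
  have bd: "summable (\<lambda>k. (hnorm V (S (\<zeta> k)))\<^sup>2)"
    if S: "S \<in> hops V" and \<zeta>: "\<And>k. \<zeta> k \<in> \<V>" and s: "summable (\<lambda>k. (hnorm V (\<zeta> k))\<^sup>2)"
    for S and \<zeta> :: "nat \<Rightarrow> 'v"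
  proof -
    obtain K where K: "K \<ge> 0" "\<And>x. x \<in> \<V> \<Longrightarrow> hnorm V (S x) \<le> K * hnorm V x"
      using hops_bounded S by metis
    show ?thesis
    proof (rule summable_comparison_test')
      show "summable (\<lambda>k. K\<^sup>2 * (hnorm V (\<zeta> k))\<^sup>2)" by (intro summable_mult s)
      fix k
      show "norm ((hnorm V (S (\<zeta> k)))\<^sup>2) \<le> K\<^sup>2 * (hnorm V (\<zeta> k))\<^sup>2"
        using power_mono[OF K(2)[OF \<zeta>[of k]] hnorm_nonneg[OF hops_closed[OF S]], of 2]
          by (simp add: power_mult_distrib)
    qed
  qed
  show ?thesis
  proof
    show "(\<lambda>T. \<Sum>k. hinner V (L' (\<eta> k)) (T (R (\<xi> k)))) \<in> normal_functionals V"
      using bd[OF R \<xi> s(1)] bd[OF adj_pairD(1)[OF L] \<eta> s(2)] R adj_pairD(1)[OF L]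
      by (intro normal_functionalI) auto
    fix T assume T: "T \<in> hops V"
    show "\<phi> (\<lambda>x. L (T (R x))) = (\<Sum>k. hinner V (L' (\<eta> k)) (T (R (\<xi> k))))"
      unfolding \<phi>_eq using adj_pairD(3)[OF L \<eta>] T by simp
  qed
qed

text \<open>The zero functional with the open set \<open>UNIV\<close> makes \<open>M\<close> itself
  a generating set, so the generated topology lives on all of \<open>M\<close>.\<close>

lemma topspace_sigma_weak [simp]: "topspace (sigma_weak V M) = M"
proof -
  have "(\<lambda>T. \<Sum>k. hinner V 0 (T 0)) \<in> normal_functionals V"
    using normal_functionalI[of "\<lambda>_. 0" "\<lambda>_. 0"] by simp
  then have "M \<in> {{T \<in> M. \<phi> T \<in> W} | \<phi> W. \<phi> \<in> normal_functionals V \<and> open W}"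
    by (auto intro!: exI[of _ UNIV])
  then show ?thesis unfolding sigma_weak_def topology_generated_by_topspace by blast
qed

lemma continuous_map_normal_functional:
  assumes "\<phi> \<in> normal_functionals V"
  shows "continuous_map (sigma_weak V M) euclidean \<phi>"
proof (rule continuous_map_openin_preimage_eq[THEN iffD2], intro conjI allI impI)
  fix W :: "complex set" assume "openin euclidean W"
  then have "openin (sigma_weak V M) {T \<in> M. \<phi> T \<in> W}"
    unfolding sigma_weak_def using assms by (intro topology_generated_by_Basis) auto
  then show "openin (sigma_weak V M) (topspace (sigma_weak V M) \<inter> \<phi> -` W)"
    by (simp add: Collect_conj_eq vimage_def)
qed auto

lemma continuous_map_into_sigma_weak:
  assumes "\<And>g. g \<in> topspace G \<Longrightarrow> f g \<in> M"
    and "\<And>\<phi>. \<phi> \<in> normal_functionals V \<Longrightarrow> continuous_map G euclidean (\<lambda>g. \<phi> (f g))"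
  shows "continuous_map G (sigma_weak V M) f"
  unfolding sigma_weak_def continuous_on_generated_topo_iff
proof (intro conjI allI impI)
  fix U assume "U \<in> {{T \<in> M. \<phi> T \<in> W} | \<phi> W. \<phi> \<in> normal_functionals V \<and> open W}"
  then obtain \<phi> W where U: "U = {T \<in> M. \<phi> T \<in> W}" "\<phi> \<in> normal_functionals V" "open W" by blast
  have "openin G {g \<in> topspace G. \<phi> (f g) \<in> W}"
    using openin_continuous_map_preimage[OF assms(2)[OF U(2)]] U(3) by simp
  also have "{g \<in> topspace G. \<phi> (f g) \<in> W} = f -` U \<inter> topspace G"
    using assms(1) by (auto simp: U)
  finally show "openin G (f -` U \<inter> topspace G)" .
next
  show "f ` topspace G \<subseteq> \<Union> {{T \<in> M. \<phi> T \<in> W} | \<phi> W. \<phi> \<in> normal_functionals V \<and> open W}"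
    using topspace_sigma_weak[of M] assms(1)
    unfolding sigma_weak_def topology_generated_by_topspace by auto
qed

text \<open>Exact agreement on finitely many functionals is recorded instead of an approximate one,
  because for linear \<open>M\<close> it cuts out an affine subspace. That a neighbourhood contains
  such a subspace is the unboundedness behind the negative direction.\<close>

lemma sigma_weak_nbhd:
  assumes "openin (sigma_weak V M) W" "T0 \<in> W"
  obtains \<Phi> where "finite \<Phi>" "\<Phi> \<subseteq> normal_functionals V"
    "\<forall>T\<in>M. (\<forall>\<phi>\<in>\<Phi>. \<phi> T = \<phi> T0) \<longrightarrow> T \<in> W"
proof -
  have "generate_topology_on {{T \<in> M. \<phi> T \<in> W} | \<phi> W. \<phi> \<in> normal_functionals V \<and> open W} W"
    using assms(1) unfolding sigma_weak_def by (rule openin_topology_generated_by)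
  then have "\<exists>\<Phi>. finite \<Phi> \<and> \<Phi> \<subseteq> normal_functionals V \<and> (\<forall>T\<in>M. (\<forall>\<phi>\<in>\<Phi>. \<phi> T = \<phi> T0) \<longrightarrow> T \<in> W)"
    using assms(2)
  proof induction
    case (Int a b)
    then obtain \<Phi> \<Psi> where "finite \<Phi> \<and> \<Phi> \<subseteq> normal_functionals V \<and> (\<forall>T\<in>M. (\<forall>\<phi>\<in>\<Phi>. \<phi> T = \<phi> T0) \<longrightarrow> T \<in> a)"
      "finite \<Psi> \<and> \<Psi> \<subseteq> normal_functionals V \<and> (\<forall>T\<in>M. (\<forall>\<phi>\<in>\<Psi>. \<phi> T = \<phi> T0) \<longrightarrow> T \<in> b)"
      by auto
    then show ?case by (intro exI[of _ "\<Phi> \<union> \<Psi>"]) auto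
  next
    case (UN K)
    from UN.prems obtain k where k: "k \<in> K" "T0 \<in> k" by blast
    then obtain \<Phi> where "finite \<Phi> \<and> \<Phi> \<subseteq> normal_functionals V \<and> (\<forall>T\<in>M. (\<forall>\<phi>\<in>\<Phi>. \<phi> T = \<phi> T0) \<longrightarrow> T \<in> k)"
      using UN.IH[OF k] by (elim exE)
    then show ?case
      by (intro exI[of _ \<Phi>]) (use k in \<open>simp del: Union_iff, meson UnionI\<close>)
  next
    case (Basis s)
    then obtain \<phi> W where "s = {T \<in> M. \<phi> T \<in> W}" "\<phi> \<in> normal_functionals V" by blast
    then show ?case using Basis(2) by (intro exI[of _ "{\<phi>}"]) simp
  qed simp
  then obtain \<Phi> where \<Phi>: "finite \<Phi> \<and> \<Phi> \<subseteq> normal_functionals V \<and>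
      (\<forall>T\<in>M. (\<forall>\<phi>\<in>\<Phi>. \<phi> T = \<phi> T0) \<longrightarrow> T \<in> W)" ..
  show ?thesis by (rule that[of \<Phi>]) (use \<Phi> in simp_all)
qed

text \<open>It suffices to test the action against one normal functional. \<open>L p\<close> and
  \<open>R p\<close> are absorbed into that functional, so each summand becomes a function of
  \<open>g\<close> times a normal functional of \<open>T\<close>, and finitely many such products
  are jointly continuous.\<close>

lemma jointly_continuousI:
  assumes M: "M \<subseteq> hops V" and P: "finite P"
    and c: "\<And>p. p \<in> P \<Longrightarrow> continuous_map G euclidean (\<lambda>g. c g p)"
    and L: "\<And>p. p \<in> P \<Longrightarrow> adj_pair (L' p) (L p)"
    and R: "\<And>p. p \<in> P \<Longrightarrow> R p \<in> hops V"
    and act: "\<And>g T. g \<in> topspace G \<Longrightarrow> T \<in> M \<Longrightarrow> act g T \<in> M"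
    and act_eq: "\<And>g T. g \<in> topspace G \<Longrightarrow> T \<in> M \<Longrightarrow>
           act g T = (\<lambda>x. \<Sum>p\<in>P. hscale V (c g p) (L p (T (R p x))))"
  shows "jointly_continuous G (sigma_weak V M) act"
  unfolding jointly_continuous_def
proof (rule continuous_map_into_sigma_weak)
  fix gT assume "gT \<in> topspace (prod_topology G (sigma_weak V M))"
  then show "(case gT of (g, T) \<Rightarrow> act g T) \<in> M" using act by auto
next
  fix \<phi> assume \<phi>: "\<phi> \<in> normal_functionals V"
  have "\<exists>\<psi>. \<psi> \<in> normal_functionals V \<and> (\<forall>T\<in>hops V. \<phi> (\<lambda>x. L p (T (R p x))) = \<psi> T)" if "p \<in> P" for p
    by (rule normal_functional_conj[OF \<phi> L[OF that] R[OF that]]) blast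
  then obtain \<psi> where \<psi>: "\<And>p. p \<in> P \<Longrightarrow> \<psi> p \<in> normal_functionals V"
    "\<And>p T. p \<in> P \<Longrightarrow> T \<in> hops V \<Longrightarrow> \<phi> (\<lambda>x. L p (T (R p x))) = \<psi> p T" by metis
  have LTR: "(\<lambda>x. L p (T (R p x))) \<in> hops V" if "p \<in> P" "T \<in> M" for p T
  proof -
    have "L p \<circ> (T \<circ> R p) \<in> hops V" using that M R adj_pairD(2)[OF L] by (intro hops_comp) auto
    then show ?thesis by (simp add: o_def)
  qed
  have eq: "\<phi> (act g T) = (\<Sum>p\<in>P. c g p * \<psi> p T)" if "g \<in> topspace G" "T \<in> M" for g T
  proof -
    have "\<phi> (act g T) = (\<Sum>p\<in>P. c g p * \<phi> (\<lambda>x. L p (T (R p x))))"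
      unfolding act_eq[OF that] by (rule normal_functional_sum[OF \<phi> LTR]) (use that in auto)
    also have "\<dots> = (\<Sum>p\<in>P. c g p * \<psi> p T)"
      using that M by (intro sum.cong refl) (simp add: \<psi>(2) subset_iff)
    finally show ?thesis .
  qed
  have "continuous_map (prod_topology G (sigma_weak V M)) euclidean
     (\<lambda>gT. \<Sum>p\<in>P. c (fst gT) p * \<psi> p (snd gT))"
    by (intro continuous_map_sum P continuous_map_complex_mult
        continuous_map_compose[OF continuous_map_fst c, unfolded o_def]
        continuous_map_compose[OF continuous_map_snd continuous_map_normal_functional[OF \<psi>(1)], unfolded o_def])
  then show "continuous_map (prod_topology G (sigma_weak V M)) euclidean
     (\<lambda>gT. \<phi> (case gT of (g, T) \<Rightarrow> act g T))"
    by (rule continuous_map_eq) (auto simp: eq)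
qed

text \<open>
  Every neighbourhood of \<open>0\<close> contains a nonzero subspace of the span of the \<open>T l\<close>, because it
  contains the common kernel of finitely many functionals; on such a subspace \<open>\<phi> \<circ> act g\<close> would
  have to vanish for all \<open>g\<close> close to \<open>g0\<close>.
\<close>

lemma not_jointly_continuousI:
  fixes T :: "nat \<Rightarrow> 'v \<Rightarrow> 'v"
  defines "comb \<equiv> \<lambda>S t x. \<Sum>l\<in>S. hscale V (t l) (T l x)"
  assumes T: "\<And>l. T l \<in> hops V" and M: "\<And>S t. finite S \<Longrightarrow> comb S t \<in> M"
    and \<phi>: "\<phi> \<in> normal_functionals V" and \<phi>T: "\<And>l. \<phi> (T l) \<noteq> 0"
    and g0: "g0 \<in> topspace G"
    and lim: "\<And>N. openin G N \<Longrightarrow> g0 \<in> N \<Longrightarrow> \<exists>K. \<forall>k\<ge>K. g k \<in> N"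
    and act0: "\<And>S t. finite S \<Longrightarrow> act g0 (comb S t) = comb S t"
    and act: "\<And>S t k. finite S \<Longrightarrow> act (g k) (comb S t) = comb S (t(k := - t k))"
  shows "\<not> jointly_continuous G (sigma_weak V M) act"
proof
  assume "jointly_continuous G (sigma_weak V M) act"
  then have cont: "continuous_map (prod_topology G (sigma_weak V M)) euclidean (\<lambda>gT. \<phi> (act (fst gT) (snd gT)))"
    unfolding jointly_continuous_def case_prod_beta
    using continuous_map_compose[OF _ continuous_map_normal_functional[OF \<phi>], unfolded o_def] by blast
  have \<phi>_comb: "\<psi> (comb S t) = (\<Sum>l\<in>S. t l * \<psi> (T l))" if "\<psi> \<in> normal_functionals V" for \<psi> S t
    unfolding comb_def using that T by (rule normal_functional_sum)
  define Q where "Q = {gT \<in> topspace (prod_topology G (sigma_weak V M)). \<phi> (act (fst gT) (snd gT)) \<in> ball 0 1}"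
  have "openin (prod_topology G (sigma_weak V M)) Q"
    unfolding Q_def by (rule openin_continuous_map_preimage[OF cont]) simp
  \<comment> \<open>The empty combination stands for the zero operator, the point at which
    continuity is violated.\<close>
  moreover have "(g0, comb {} (\<lambda>_. 0)) \<in> Q"
    using g0 M[of "{}"] act0[of "{}"] \<phi>_comb[OF \<phi>, of "{}"] by (simp add: Q_def)
  ultimately obtain N W where NW: "openin G N" "openin (sigma_weak V M) W" "g0 \<in> N"
    "comb {} (\<lambda>_. 0) \<in> W" "N \<times> W \<subseteq> Q"
    unfolding openin_prod_topology_alt by meson
  obtain K where K: "\<And>k. k \<ge> K \<Longrightarrow> g k \<in> N" using lim NW by meson
  obtain \<Phi> where \<Phi>: "finite \<Phi>" "\<Phi> \<subseteq> normal_functionals V"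
    "\<forall>T\<in>M. (\<forall>\<psi>\<in>\<Phi>. \<psi> T = \<psi> (comb {} (\<lambda>_. 0))) \<longrightarrow> T \<in> W"
    by (rule sigma_weak_nbhd[OF NW(2,4)]) (rule that)
  obtain S t where S: "finite S" "S \<subseteq> {K..}" "\<exists>k\<in>S. t k \<noteq> 0"
    "\<forall>g\<in>(\<lambda>\<psi> l. \<psi> (T l)) ` \<Phi>. (\<Sum>k\<in>S. t k * g k) = 0"
    using exists_common_kernel[of "(\<lambda>\<psi> l. \<psi> (T l)) ` \<Phi>" K] \<Phi>(1) by blast
  \<comment> \<open>The functionals in \<open>\<Phi>\<close> vanish along the whole real line
    through the combination and cannot tell its points from 0.\<close>
  have W: "comb S (\<lambda>l. of_real r * t l) \<in> W" for r :: real
  proof (rule \<Phi>(3)[rule_format])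
    fix \<psi> assume \<psi>: "\<psi> \<in> \<Phi>"
    have "\<psi> (comb S (\<lambda>l. of_real r * t l)) = of_real r * (\<Sum>l\<in>S. t l * \<psi> (T l))"
      using \<psi> \<Phi>(2) by (subst \<phi>_comb) (auto simp: sum_distrib_left mult.assoc)
    also have "\<dots> = 0" using S(4) \<psi> by auto
    finally show "\<psi> (comb S (\<lambda>l. of_real r * t l)) = \<psi> (comb {} (\<lambda>_. 0))"
      using \<psi> \<Phi>(2) \<phi>_comb[of \<psi> "{}"] by auto
  qed (use M S in auto)
  \<comment> \<open>If the sum were nonzero, the multiple with \<open>r\<close> the inverse of its
    modulus would give \<open>\<phi>\<close> a value of modulus 1, outside the open unit ball that
    defines \<open>Q\<close>.\<close>
  have zero: "(\<Sum>l\<in>S. s l * \<phi> (T l)) = 0"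
    if h: "h \<in> N" and eq: "\<And>r::real. act h (comb S (\<lambda>l. of_real r * t l)) = comb S (\<lambda>l. of_real r * s l)" for h s
  proof (rule ccontr)
    assume ne: "(\<Sum>l\<in>S. s l * \<phi> (T l)) \<noteq> 0"
    define r where "r = 1 / cmod (\<Sum>l\<in>S. s l * \<phi> (T l))"
    have "\<phi> (act h (comb S (\<lambda>l. of_real r * t l))) = of_real r * (\<Sum>l\<in>S. s l * \<phi> (T l))"
      by (simp add: eq \<phi>_comb[OF \<phi>] sum_distrib_left mult.assoc)
    moreover have "(h, comb S (\<lambda>l. of_real r * t l)) \<in> Q" using NW(5) W h by blast
    ultimately have "cmod (of_real r * (\<Sum>l\<in>S. s l * \<phi> (T l))) < 1" by (simp add: Q_def)
    then show False using ne by (simp add: r_def norm_mult norm_divide)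
  qed
  obtain k where k: "k \<in> S" "t k \<noteq> 0" using S by blast
  have 1: "(\<Sum>l\<in>S. t l * \<phi> (T l)) = 0"
    using NW(3) act0[OF S(1)] by (intro zero) auto
  have 2: "(\<Sum>l\<in>S. (t(k := - t k)) l * \<phi> (T l)) = 0"
  proof (rule zero)
    show "g k \<in> N" using K S k by auto
    fix r :: real
    show "act (g k) (comb S (\<lambda>l. of_real r * t l)) = comb S (\<lambda>l. of_real r * (t(k := - t k)) l)"
      by (subst act[OF S(1)]) (rule arg_cong[where f = "comb S"], auto)
  qed
  \<comment> \<open>The two vanishing sums differ only at \<open>k\<close>, so their difference
    isolates that term.\<close>
  have "(\<Sum>l\<in>S. t l * \<phi> (T l)) - (\<Sum>l\<in>S. (t(k := - t k)) l * \<phi> (T l)) =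
      (\<Sum>l\<in>S. if l = k then 2 * (t k * \<phi> (T k)) else 0)"
    unfolding sum_subtractf[symmetric] by (rule sum.cong) auto
  then have "2 * (t k * \<phi> (T k)) = 0" using 1 2 S(1) k(1) by simp
  then show False using k \<phi>T by simp
qed

section \<open>Commutants\<close>

lemma commutant_hops: "commutant V N \<subseteq> hops V"
  by (auto simp: commutant_def)

lemma commutantD: "T \<in> commutant V N \<Longrightarrow> R \<in> N \<Longrightarrow> T (R x) = R (T x)"
  by (auto simp: commutant_def o_def dest: fun_cong)

lemma commutantI:
  assumes "T \<in> hops V" "N \<subseteq> hops V" "\<And>R x. R \<in> N \<Longrightarrow> x \<in> \<V> \<Longrightarrow> T (R x) = R (T x)"
  shows "T \<in> commutant V N"
proof -
  have "T \<circ> R = R \<circ> T" if "R \<in> N" for R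
    by (rule hops_ext) (use that assms in auto)
  then show ?thesis using assms by (simp add: commutant_def)
qed

lemma commutant_comp:
  assumes "S \<in> commutant V N" "T \<in> commutant V N" "N \<subseteq> hops V"
  shows "S \<circ> T \<in> commutant V N"
  using assms subsetD[OF commutant_hops] by (intro commutantI hops_comp) (auto simp: commutantD)

lemma commutant_sum:
  assumes "\<And>i. i \<in> A \<Longrightarrow> T i \<in> commutant V N" "N \<subseteq> hops V"
  shows "(\<lambda>x. \<Sum>i\<in>A. hscale V (c i) (T i x)) \<in> commutant V N"
proof (rule commutantI)
  have T: "T i \<in> hops V" if "i \<in> A" for i using assms(1)[OF that] commutant_hops by blast
  then show "(\<lambda>x. \<Sum>i\<in>A. hscale V (c i) (T i x)) \<in> hops V" by (intro sum_hops scale_hops)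
  fix R x assume R: "R \<in> N" and "x \<in> \<V>"
  have "R \<in> hops V" using R assms(2) by blast
  then show "(\<Sum>i\<in>A. hscale V (c i) (T i (R x))) = R (\<Sum>i\<in>A. hscale V (c i) (T i x))"
    using T commutantD[OF assms(1) R] by (simp add: hops_sum hops_scale cong: sum.cong)
qed (rule assms)

lemma subset_bicommutant:
  "N \<subseteq> hops V \<Longrightarrow> N \<subseteq> commutant V (commutant V N)"
  by (auto intro!: commutantI simp: commutantD dest: subsetD[OF commutant_hops])

end

section \<open>Rank-one operators and reflections\<close>

context pre_hilbert
begin

text \<open>This is \<open>|a><b|\<close>; on orthonormal vectors it is a matrix unit.\<close>

definition rank_one :: "'v \<Rightarrow> 'v \<Rightarrow> 'v \<Rightarrow> 'v" where
  "rank_one a b x = (if x \<in> \<V> then hscale V (hinner V b x) a else 0)"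

lemma rank_one_hops [simp]:
  assumes "a \<in> \<V>" "b \<in> \<V>"
  shows "rank_one a b \<in> hops V"
proof (rule hopsI[where K = "hnorm V a * hnorm V b"])
  fix x assume x: "x \<in> \<V>"
  have "cmod (hinner V b x) * hnorm V a \<le> hnorm V b * hnorm V x * hnorm V a"
    using assms x by (intro mult_right_mono Cauchy_Schwarz) auto
  then show "hnorm V (rank_one a b x) \<le> hnorm V a * hnorm V b * hnorm V x"
    using x assms by (simp add: rank_one_def hnorm_scale mult_ac)
qed (use assms in \<open>auto simp: rank_one_def inner_add_right inner_scale_right scale_add_left
       scale_scale\<close>)

lemma rank_one_adj:
  assumes "a \<in> \<V>" "b \<in> \<V>"
  shows "adj_pair (rank_one b a) (rank_one a b)"
  using assms inner_cnj[of a]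
  by (auto simp: adj_pair_def rank_one_def inner_scale_left inner_scale_right)

text \<open>The Householder reflection \<open>1 - 2 |e><e|\<close> is a self-adjoint involution,
  hence both its own adjoint and its own inverse.\<close>

lemma reflection_unitary:
  assumes e: "e \<in> \<V>" "hinner V e e = 1"
  shows "(\<lambda>x. hid V x - hscale V 2 (rank_one e e x)) \<in> unitaries V"
    (is "?u \<in> _")
proof (rule unitariesI)
  have u: "?u \<in> hops V" by (intro diff_hops scale_hops hid_hops rank_one_hops e)
  show "adj_pair ?u ?u"
    unfolding adj_pair_def
  proof (intro conjI ballI u)
    fix x y assume x: "x \<in> \<V>" and y: "y \<in> \<V>"
    show "hinner V (?u x) y = hinner V x (?u y)"
      using x y e adj_pairD(3)[OF rank_one_adj[OF e(1) e(1)] x y] hops_closed[OF rank_one_hops[OF e(1) e(1)]]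
      by (simp add: inner_diff_left inner_diff_right inner_scale_left inner_scale_right)
  qed
  have inv: "?u (?u x) = x" if x: "x \<in> \<V>" for x
  proof -
    define u where "u = ?u"
    define c where "c = hinner V e x"
    define r where "r = hscale V (2 * c) e"
    have r: "r \<in> \<V>" by (simp add: r_def e)
    have "u x = x - r"
      using x e by (simp add: u_def rank_one_def scale_scale c_def r_def)
    moreover have "hinner V e (x - r) = - c"
      using x e by (simp add: r_def inner_diff_right inner_scale_right c_def)
    then have "u (x - r) = x - r - hscale V (- (2 * c)) e"
      using x e r by (simp add: u_def rank_one_def scale_scale)
    moreover have "hscale V (- (2 * c)) e = - r"
      using scale_add_left[of e "- (2 * c)" "2 * c"] e by (simp add: r_def eq_neg_iff_add_eq_0)
    ultimately have "u (u x) = x" by simp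
    then show ?thesis unfolding u_def .
  qed
  show "?u (?u x) = x" "?u (?u x) = x" if "x \<in> \<V>" for x
    by (rule inv[OF that])+
qed

end

section \<open>Finite-dimensional Hilbert spaces\<close>

locale fin_hilbert =
  fixes V :: "'v::ab_group_add hilb"
  assumes fin_dim: "fin_dim_hilbert V"

sublocale fin_hilbert \<subseteq> vs: vector_space "hscale V"
  using fin_dim unfolding fin_dim_hilbert_def by blast

sublocale fin_hilbert \<subseteq> pre_hilbert V
proof
  have sub: "vs.subspace (hcarrier V)" using fin_dim unfolding fin_dim_hilbert_def by blast
  show "0 \<in> hcarrier V" by (rule vs.subspace_0[OF sub])
  show "x + y \<in> hcarrier V" if "x \<in> hcarrier V" "y \<in> hcarrier V" for x y
    using that by (rule vs.subspace_add[OF sub])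
  show "hscale V c x \<in> hcarrier V" if "x \<in> hcarrier V" for c x
    using that by (rule vs.subspace_scale[OF sub])
  show "hinner V y x = cnj (hinner V x y)" if "x \<in> hcarrier V" "y \<in> hcarrier V" for x y
  proof -
    have "\<forall>x\<in>hcarrier V. \<forall>y\<in>hcarrier V. hinner V y x = cnj (hinner V x y)"
      using fin_dim unfolding fin_dim_hilbert_def by (elim conjE)
    from bspec[OF bspec[OF this that(1)] that(2)] show ?thesis .
  qed
  have add: "\<forall>x\<in>hcarrier V. \<forall>y\<in>hcarrier V. \<forall>z\<in>hcarrier V.
      hinner V x (y + z) = hinner V x y + hinner V x z"
    using fin_dim unfolding fin_dim_hilbert_def by (elim conjE)
  have scale: "\<forall>x\<in>hcarrier V. \<forall>y\<in>hcarrier V. \<forall>c. hinner V x (hscale V c y) = c * hinner V x y"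
    using fin_dim unfolding fin_dim_hilbert_def by (elim conjE)
  have pos: "\<forall>x\<in>hcarrier V. x \<noteq> 0 \<longrightarrow> Re (hinner V x x) > 0"
    using fin_dim unfolding fin_dim_hilbert_def by (elim conjE)
  show "hinner V x (y + z) = hinner V x y + hinner V x z"
    if "x \<in> hcarrier V" "y \<in> hcarrier V" "z \<in> hcarrier V" for x y z
    using add that by simp
  show "hinner V x (hscale V c y) = c * hinner V x y"
    if "x \<in> hcarrier V" "y \<in> hcarrier V" for c x y
    using scale that by simp
  show "Re (hinner V x x) > 0" if "x \<in> hcarrier V" "x \<noteq> 0" for x
    using pos that by simp
qed (simp_all add: vs.scale_right_distrib vs.scale_left_distrib)

context fin_hilbert
begin

definition orthonormal :: "'v set \<Rightarrow> bool" where
  "orthonormal B \<longleftrightarrow> (\<forall>b\<in>B. \<forall>c\<in>B. hinner V b c = (if b = c then 1 else 0))"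

lemma exists_finite_span:
  obtains S where "finite S" "vs.span S = \<V>"
proof -
  have "\<exists>S. finite S \<and> vs.span S = \<V>"
    using fin_dim unfolding fin_dim_hilbert_def by (elim conjE)
  then show ?thesis using that by blast
qed

text \<open>Gram-Schmidt, one vector at a time. A vector whose remainder \<open>y\<close> is 0 adds
  nothing to the span and is dropped, so the spanning set may be dependent.\<close>

lemma exists_orthonormal_span:
  assumes "finite S" "S \<subseteq> \<V>"
  shows "\<exists>B. finite B \<and> B \<subseteq> \<V> \<and> vs.span B = vs.span S \<and> orthonormal B"
  using assms
proof (induction S rule: finite_induct)
  case empty
  show ?case by (rule exI[of _ "{}"]) (simp add: orthonormal_def)
next
  case (insert x S)
  then obtain B where B: "finite B" "B \<subseteq> \<V>" "vs.span B = vs.span S" "orthonormal B"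
    by auto
  have x: "x \<in> \<V>" using insert by simp
  define p where "p = (\<Sum>b\<in>B. hscale V (hinner V b x) b)"
  define y where "y = x - p"
  have p: "p \<in> \<V>"
    unfolding p_def using B(2) by (intro sum_closed scale_closed) auto
  have p_span: "p \<in> vs.span B"
    unfolding p_def by (intro vs.span_sum vs.span_scale vs.span_base)
  have y: "y \<in> \<V>" by (simp add: y_def x p)
  have by0: "hinner V b y = 0" if b: "b \<in> B" for b
  proof -
    have "hinner V b p = (\<Sum>c\<in>B. hinner V c x * hinner V b c)"
      unfolding p_def using B b by (subst inner_sum_right) (auto simp: inner_scale_right subset_iff)
    also have "\<dots> = (\<Sum>c\<in>B. if c = b then hinner V b x else 0)"
      by (rule sum.cong) (use B b in \<open>auto simp: orthonormal_def\<close>)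
    also have "\<dots> = hinner V b x" using B b by simp
    finally show ?thesis using b B x p by (simp add: y_def inner_diff_right subset_iff)
  qed
  have span_x: "vs.span (insert x S) = vs.span (insert x B)"
    unfolding vs.span_eq
    using B(3) vs.span_superset[of S] vs.span_superset[of B] vs.span_mono[of S "insert x S"]
      vs.span_mono[of B "insert x B"] by (auto intro: vs.span_base)
  show ?case
  proof (cases "y = 0")
    case True
    then have "x \<in> vs.span B" using p_span by (simp add: y_def)
    then have "vs.span (insert x B) = vs.span B" by (rule vs.span_redundant)
    then show ?thesis using B span_x by (intro exI[of _ B]) simp
  next
    case False
    define n where "n = complex_of_real (hnorm V y)"
    define e where "e = hscale V (inverse n) y"
    have n: "n \<noteq> 0" using False y by (simp add: n_def hnorm_eq_0_iff)
    have e: "e \<in> \<V>" by (simp add: e_def y)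
    have ye: "y = hscale V n e" using n y by (simp add: e_def)
    have be: "hinner V b e = 0" if "b \<in> B" for b
      using by0[OF that] B that y by (simp add: e_def inner_scale_right subset_iff)
    have eb: "hinner V e b = 0" if "b \<in> B" for b
      using be[OF that] inner_cnj[OF subsetD[OF B(2) that] e] by simp
    have ee: "hinner V e e = 1"
      using y n by (simp add: e_def inner_scale_left inner_scale_right inner_self[OF y] n_def power2_eq_square
          field_simps)
    have pe: "p \<in> vs.span (insert z B)" for z
      using p_span vs.span_mono[of B "insert z B"] by blast
    have "e \<in> vs.span (insert x B)"
      unfolding e_def y_def by (intro vs.span_scale vs.span_diff pe) (simp add: vs.span_base)
    moreover have "x = hscale V n e + p" unfolding ye[symmetric] by (simp add: y_def)
    then have "x \<in> vs.span (insert e B)"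
      using vs.span_add[OF vs.span_scale[OF vs.span_base[of e "insert e B"]] pe] by simp
    ultimately have "vs.span (insert e B) = vs.span (insert x B)"
      unfolding vs.span_eq by (auto intro: vs.span_base)
    moreover have "orthonormal (insert e B)"
      using B(4) be eb ee by (auto simp: orthonormal_def)
    ultimately show ?thesis
      using B e span_x by (intro exI[of _ "insert e B"]) auto
  qed
qed

text \<open>\<open>fin_onb\<close> is chosen without a finiteness clause. Finiteness comes from
  independence: an orthonormal set is no larger than a finite spanning set.\<close>

lemma orthonormal_finite:
  assumes B: "B \<subseteq> \<V>" "orthonormal B"
  shows "finite B"
proof -
  obtain S where S: "finite S" "vs.span S = \<V>"
    by (rule exists_finite_span)
  have "vs.independent B"
  proof
    assume "vs.dependent B"
    then obtain b where b: "b \<in> B" "b \<in> vs.span (B - {b})" unfolding vs.dependent_def by blast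
    \<comment> \<open>The fixed vector is renamed \<open>b'\<close>, so that the induction over the
      span of \<open>B - {b}\<close> varies only the second argument. The result at \<open>b\<close>
      itself contradicts \<open>hinner V b b = 1\<close>.\<close>
    have "b \<in> \<V> \<and> hinner V b' b = 0" if "b' = b" for b'
      using b(2)
    proof (induction rule: vs.span_induct_alt)
      case (step c x y)
      then have "x \<in> \<V>" "hinner V b' x = 0" "b' \<in> \<V>"
        using b B that by (auto simp: orthonormal_def)
      then show ?case using step by (auto simp: inner_add_right inner_scale_right)
    qed (use b B that in auto)
    then show False using b B by (auto simp: orthonormal_def)
  qed
  then show ?thesis using vs.independent_span_bound[of S B] S B by auto
qed

lemma fin_onb_props: "fin_onb V \<subseteq> \<V> \<and> vs.span (fin_onb V) = \<V> \<and> orthonormal (fin_onb V)"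
proof -
  obtain S where S: "finite S" "vs.span S = \<V>"
    by (rule exists_finite_span)
  have "S \<subseteq> \<V>" using S(2) vs.span_superset by blast
  then obtain B where "B \<subseteq> \<V> \<and> vs.span B = \<V> \<and> orthonormal B"
    using exists_orthonormal_span[OF S(1)] S(2) by auto
  then show ?thesis unfolding fin_onb_def orthonormal_def by (rule someI)
qed

lemma fin_onb_carrier [simp]: "b \<in> fin_onb V \<Longrightarrow> b \<in> \<V>"
  using fin_onb_props by blast

lemma fin_onb_inner: "b \<in> fin_onb V \<Longrightarrow> c \<in> fin_onb V \<Longrightarrow> hinner V b c = (if b = c then 1 else 0)"
  using fin_onb_props unfolding orthonormal_def by blast

lemma finite_fin_onb [simp]: "finite (fin_onb V)"
  using fin_onb_props orthonormal_finite by blast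

lemma zero_notin_fin_onb [simp]: "0 \<notin> fin_onb V"
  using fin_onb_inner[of 0 0] by auto

lemma fin_onb_expand:
  assumes x: "x \<in> \<V>"
  shows "x = (\<Sum>b\<in>fin_onb V. hscale V (hinner V b x) b)"
proof -
  define p where "p = (\<Sum>b\<in>fin_onb V. hscale V (hinner V b x) b)"
  have p: "p \<in> \<V>" by (auto simp: p_def)
  have bp: "hinner V b p = hinner V b x" if b: "b \<in> fin_onb V" for b
  proof -
    have "hinner V b p = (\<Sum>c\<in>fin_onb V. if c = b then hinner V b x else 0)"
      unfolding p_def using b
      by (subst inner_sum_right) (auto simp: inner_scale_right fin_onb_inner if_distrib intro!: sum.cong cong: if_cong)
    then show ?thesis using b by simp
  qed
  have "hinner V z (x - p) = 0" if "z \<in> \<V>" for z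
  proof -
    have "z \<in> vs.span (fin_onb V)" using that fin_onb_props by blast
    then have "z \<in> \<V> \<and> hinner V z (x - p) = 0"
      by (induction rule: vs.span_induct_alt)
        (use x p in \<open>auto simp: inner_add_left inner_scale_left inner_diff_right bp\<close>)
    then show ?thesis by simp
  qed
  then have "x = p" using x p by (intro inner_ext) (auto simp: inner_diff_right)
  then show ?thesis by (simp add: p_def)
qed

lemma fin_onb_Parseval:
  assumes x: "x \<in> \<V>" and y: "y \<in> \<V>"
  shows "hinner V x y = (\<Sum>b\<in>fin_onb V. hinner V x b * hinner V b y)"
  by (subst fin_onb_expand[OF y], subst inner_sum_right)
    (use x in \<open>auto simp: inner_scale_right mult.commute\<close>)

lemma hadj_pair:
  assumes T: "T \<in> hops V"
  shows "adj_pair (hadj V T) T"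
proof -
  \<comment> \<open>Expanding the adjoint of \<open>T\<close> at \<open>x\<close> in the basis gives
    the coefficients \<open><T b, x>\<close>, so it must be the sum of the operators
    \<open>|b><T b|\<close>.\<close>
  define S where "S x = (\<Sum>b\<in>fin_onb V. rank_one b (T b) x)" for x
  have "S \<in> hops V"
    unfolding S_def by (intro sum_hops rank_one_hops) (use T in auto)
  moreover have "hinner V (S x) y = hinner V x (T y)" if x: "x \<in> \<V>" and y: "y \<in> \<V>" for x y
  proof -
    have "hinner V (S x) y = (\<Sum>b\<in>fin_onb V. hinner V b y * hinner V x (T b))"
      unfolding S_def using x y T inner_cnj[OF hops_closed[OF T] x]
      by (subst inner_sum_left) (auto simp: rank_one_def inner_scale_left mult.commute intro!: sum.cong)
    also have "\<dots> = hinner V x (T (\<Sum>b\<in>fin_onb V. hscale V (hinner V b y) b))"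
      using x T by (subst hops_sum[OF T], simp, subst inner_sum_right)
        (auto simp: hops_scale inner_scale_right)
    also have "\<dots> = hinner V x (T y)" by (simp flip: fin_onb_expand[OF y])
    finally show ?thesis .
  qed
  ultimately have "adj_pair S T" using T by (simp add: adj_pair_def)
  then show ?thesis using hadj_eq by simp
qed

lemma unitary_hadj_left:
  assumes "u \<in> unitaries V" "x \<in> \<V>"
  shows "hadj V u (u x) = x"
proof -
  have "hadj V u \<circ> u = hid V" using assms by (simp add: unitaries_def)
  from fun_cong[OF this, of x] show ?thesis using assms by simp
qed

lemma unitary_hadj_right:
  assumes "u \<in> unitaries V" "x \<in> \<V>"
  shows "u (hadj V u x) = x"
proof -
  have "u \<circ> hadj V u = hid V" using assms by (simp add: unitaries_def)
  from fun_cong[OF this, of x] show ?thesis using assms by simp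
qed

lemma hadj_unitary:
  assumes "u \<in> unitaries V"
  shows "hadj V u \<in> unitaries V"
  using adj_pair_sym[OF hadj_pair[OF unitary_hops[OF assms]]]
    unitary_hadj_right[OF assms] unitary_hadj_left[OF assms]
  by (rule unitariesI)

lemma unitary_isometry:
  assumes u: "u \<in> unitaries V" and x: "x \<in> \<V>"
  shows "hnorm V (u x) = hnorm V x"
proof -
  have "hinner V (u x) (u x) = hinner V (hadj V u (u x)) x"
    using adj_pairD(3)[OF hadj_pair[OF unitary_hops[OF u]], of "u x" x] u x unitary_hops by simp
  then show ?thesis using unitary_hadj_left[OF u x] by (simp add: hnorm_def)
qed

text \<open>Parseval turns the row product into the inner product of the adjoint of \<open>u\<close>
  at \<open>b\<close> and at \<open>b'\<close>. Moving one adjoint across leaves \<open>u\<close>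
  times its adjoint, which is the identity.\<close>

lemma unitary_rows:
  assumes u: "u \<in> unitaries V" and b: "b \<in> fin_onb V" "b' \<in> fin_onb V"
  shows "(\<Sum>c\<in>fin_onb V. hinner V b (u c) * cnj (hinner V b' (u c))) = (if b = b' then 1 else 0)"
proof -
  note adj = hadj_pair[OF unitary_hops[OF u]]
  have "(\<Sum>c\<in>fin_onb V. hinner V b (u c) * cnj (hinner V b' (u c))) =
     (\<Sum>c\<in>fin_onb V. hinner V (hadj V u b) c * hinner V c (hadj V u b'))"
  proof (rule sum.cong)
    fix c assume c: "c \<in> fin_onb V"
    show "hinner V b (u c) * cnj (hinner V b' (u c)) =
      hinner V (hadj V u b) c * hinner V c (hadj V u b')"
      using adj_pairD(3)[OF adj] adj_pairD(3)[OF adj_pair_sym[OF adj]] b c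
        inner_cnj[of b' "u c"] unitary_hops[OF u] by simp
  qed simp
  also have "\<dots> = hinner V (hadj V u b) (hadj V u b')"
    using b adj_pairD(1)[OF adj] by (intro fin_onb_Parseval[symmetric]) auto
  also have "\<dots> = hinner V b b'"
    using adj_pairD(3)[OF adj, of b "hadj V u b'"] adj_pairD(1)[OF adj] b unitary_hadj_right[OF u] by simp
  finally show ?thesis using b by (simp add: fin_onb_inner)
qed

text \<open>Two distinct basis vectors give matrix units that do not commute; with at most one basis
  vector every operator is a scalar. This turns a non-abelian summand into a pair of orthonormal
  vectors.\<close>

lemma hops_commute_iff:
  "(\<forall>S\<in>hops V. \<forall>T\<in>hops V. S \<circ> T = T \<circ> S) \<longleftrightarrow> (\<forall>b\<in>fin_onb V. \<forall>c\<in>fin_onb V. b = c)"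
proof
  assume com: "\<forall>S\<in>hops V. \<forall>T\<in>hops V. S \<circ> T = T \<circ> S"
  show "\<forall>b\<in>fin_onb V. \<forall>c\<in>fin_onb V. b = c"
  proof (intro ballI, rule ccontr)
    fix b c assume b: "b \<in> fin_onb V" and c: "c \<in> fin_onb V" and ne: "b \<noteq> c"
    have "(rank_one b c \<circ> rank_one c b) b = (rank_one c b \<circ> rank_one b c) b"
      using com b c by simp
    then have "b = 0" using b c ne by (simp add: rank_one_def fin_onb_inner)
    then show False using b by simp
  qed
next
  assume eq: "\<forall>b\<in>fin_onb V. \<forall>c\<in>fin_onb V. b = c"
  have scalar: "\<exists>s. \<forall>x\<in>\<V>. S x = hscale V s x" if S: "S \<in> hops V" for S
  proof (cases "fin_onb V = {}")
    case True
    then have "x = 0" if "x \<in> \<V>" for x using fin_onb_expand[OF that] by simp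
    then show ?thesis using S by fastforce
  next
    case False
    then obtain b where b: "b \<in> fin_onb V" by blast
    have "fin_onb V = {b}" using eq b by blast
    then have x: "x = hscale V (hinner V b x) b" if "x \<in> \<V>" for x
      using fin_onb_expand[OF that] by simp
    define s where "s = hinner V b (S b)"
    have Sb: "S b = hscale V s b" unfolding s_def using x[of "S b"] S by simp
    have "S x = hscale V s x" if "x \<in> \<V>" for x
    proof -
      have "S x = S (hscale V (hinner V b x) b)" using x[OF that] by simp
      also have "\<dots> = hscale V s (hscale V (hinner V b x) b)"
        using b S by (simp add: hops_scale Sb mult.commute)
      finally show ?thesis using x[OF that] by simp
    qed
    then show ?thesis by blast
  qed
  show "\<forall>S\<in>hops V. \<forall>T\<in>hops V. S \<circ> T = T \<circ> S"
  proof (intro ballI)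
    fix S T assume ST: "S \<in> hops V" "T \<in> hops V"
    obtain s t where "\<forall>x\<in>\<V>. S x = hscale V s x" "\<forall>x\<in>\<V>. T x = hscale V t x"
      using scalar ST by meson
    then show "S \<circ> T = T \<circ> S"
      using ST by (intro hops_ext) (auto simp: mult.commute)
  qed
qed

end

section \<open>Hilbert sums\<close>

lemma sum_fun_apply: 
  fixes f :: "'p \<Rightarrow> 'i \<Rightarrow> 'v::comm_monoid_add"
  shows "(\<Sum>p\<in>P. f p) i = (\<Sum>p\<in>P. f p i)"
  by (induction P rule: infinite_finite_induct) auto

text \<open>The summands are arbitrary pre-Hilbert spaces, so that the locale serves both the
  quantum set and the constant family of complex lines behind \<open>l2\<close>.\<close>

locale hsum_family =
  fixes I :: "'i set" and X :: "'i \<Rightarrow> 'v::ab_group_add hilb"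
  assumes summand: "i \<in> I \<Longrightarrow> pre_hilbert (X i)"
begin

abbreviation \<H> where "\<H> \<equiv> hsum I X"

lemma hsum_carrier_iff:
  "x \<in> hcarrier \<H> \<longleftrightarrow> (\<forall>i\<in>I. x i \<in> hcarrier (X i)) \<and> (\<forall>i. i \<notin> I \<longrightarrow> x i = 0) \<and>
     (\<lambda>i. (hnorm (X i) (x i))\<^sup>2) summable_on I"
  unfolding hsum_def by simp

lemma hsum_component [simp]: "x \<in> hcarrier \<H> \<Longrightarrow> i \<in> I \<Longrightarrow> x i \<in> hcarrier (X i)"
  unfolding hsum_carrier_iff by simp

lemma hsum_outside: "x \<in> hcarrier \<H> \<Longrightarrow> i \<notin> I \<Longrightarrow> x i = 0"
  unfolding hsum_carrier_iff by simp

lemma hsum_summable: "x \<in> hcarrier \<H> \<Longrightarrow> (\<lambda>i. (hnorm (X i) (x i))\<^sup>2) summable_on I"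
  unfolding hsum_carrier_iff by simp

lemma hsum_scale: "hscale \<H> c x = (\<lambda>i. if i \<in> I then hscale (X i) c (x i) else 0)"
  unfolding hsum_def by simp

lemma hsum_inner: "hinner \<H> x y = (\<Sum>\<^sub>\<infinity>i\<in>I. hinner (X i) (x i) (y i))"
  unfolding hsum_def by simp

lemma summable_on_bounded:
  fixes f g :: "'i \<Rightarrow> real"
  assumes "g summable_on I" "\<And>i. i \<in> I \<Longrightarrow> 0 \<le> f i" "\<And>i. i \<in> I \<Longrightarrow> f i \<le> g i"
  shows "f summable_on I"
  by (rule summable_on_comparison_test[OF assms(1)]) (use assms in auto)

lemma hsum_inner_summable:
  assumes x: "x \<in> hcarrier \<H>" and y: "y \<in> hcarrier \<H>"
  shows "(\<lambda>i. hinner (X i) (x i) (y i)) summable_on I"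
proof (rule abs_summable_summable, rule summable_on_bounded)
  show "(\<lambda>i. (hnorm (X i) (x i))\<^sup>2 + (hnorm (X i) (y i))\<^sup>2) summable_on I"
    by (intro summable_on_add hsum_summable x y)
  fix i assume i: "i \<in> I"
  interpret Xi: pre_hilbert "X i" by (rule summand[OF i])
  define a where "a = hnorm (X i) (x i)"
  define b where "b = hnorm (X i) (y i)"
  have ab: "a \<ge> 0" "b \<ge> 0" using x y i by (auto simp: a_def b_def)
  have "cmod (hinner (X i) (x i) (y i)) \<le> a * b"
    unfolding a_def b_def using x y i by (intro Xi.Cauchy_Schwarz) auto
  also have "\<dots> \<le> a\<^sup>2 + b\<^sup>2"
    using sum_squares_bound[of a b] mult_nonneg_nonneg[OF ab] by simp
  finally show "norm (hinner (X i) (x i) (y i)) \<le> (hnorm (X i) (x i))\<^sup>2 + (hnorm (X i) (y i))\<^sup>2"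
    by (simp add: a_def b_def)
qed simp

lemma hsum_pre_hilbert: "pre_hilbert \<H>"
proof
  show "0 \<in> hcarrier \<H>"
  proof -
    have "(\<lambda>i. (hnorm (X i) 0)\<^sup>2) summable_on I \<longleftrightarrow> (\<lambda>i. 0::real) summable_on I"
      by (rule summable_on_cong) (use pre_hilbert.hnorm_zero[OF summand] in auto)
    then show ?thesis unfolding hsum_carrier_iff by (simp add: pre_hilbert.zero_closed[OF summand])
  qed
  show "x + y \<in> hcarrier \<H>" if x: "x \<in> hcarrier \<H>" and y: "y \<in> hcarrier \<H>" for x y
    unfolding hsum_carrier_iff
  proof (intro conjI ballI allI impI)
    show "(\<lambda>i. (hnorm (X i) ((x + y) i))\<^sup>2) summable_on I"
    proof (rule summable_on_bounded)
      show "(\<lambda>i. 2 * ((hnorm (X i) (x i))\<^sup>2 + (hnorm (X i) (y i))\<^sup>2)) summable_on I"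
        by (intro summable_on_cmult_right summable_on_add hsum_summable x y)
      fix i assume i: "i \<in> I"
      interpret Xi: pre_hilbert "X i" by (rule summand[OF i])
      define a where "a = hnorm (X i) (x i)"
      define b where "b = hnorm (X i) (y i)"
      have "(hnorm (X i) (x i + y i))\<^sup>2 \<le> (a + b)\<^sup>2"
        unfolding a_def b_def using x y i by (intro power_mono Xi.hnorm_triangle) auto
      also have "\<dots> \<le> 2 * (a\<^sup>2 + b\<^sup>2)"
        using sum_squares_bound[of a b] by (simp add: power2_sum)
      finally show "(hnorm (X i) ((x + y) i))\<^sup>2 \<le> 2 * ((hnorm (X i) (x i))\<^sup>2 + (hnorm (X i) (y i))\<^sup>2)"
        by (simp add: a_def b_def)
    qed simp
  qed (use x y in \<open>auto intro: pre_hilbert.add_closed[OF summand]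
         simp: hsum_outside[OF x] hsum_outside[OF y]\<close>)
  show "hscale \<H> c x \<in> hcarrier \<H>" if x: "x \<in> hcarrier \<H>" for c x
    unfolding hsum_carrier_iff
  proof (intro conjI ballI allI impI)
    have "(\<lambda>i. (hnorm (X i) (hscale \<H> c x i))\<^sup>2) summable_on I \<longleftrightarrow>
        (\<lambda>i. (cmod c)\<^sup>2 * (hnorm (X i) (x i))\<^sup>2) summable_on I"
      by (rule summable_on_cong)
        (use x in \<open>simp add: hsum_scale pre_hilbert.hnorm_scale[OF summand] power_mult_distrib\<close>)
    then show "(\<lambda>i. (hnorm (X i) (hscale \<H> c x i))\<^sup>2) summable_on I"
      using x by (simp add: summable_on_cmult_right hsum_summable)
  qed (use x in \<open>auto simp: hsum_scale pre_hilbert.scale_closed[OF summand]\<close>)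
  show "hscale \<H> c (x + y) = hscale \<H> c x + hscale \<H> c y"
    if "x \<in> hcarrier \<H>" "y \<in> hcarrier \<H>" for c x y
    using that by (auto simp: hsum_scale pre_hilbert.scale_add_right[OF summand])
  show "hscale \<H> (c + d) x = hscale \<H> c x + hscale \<H> d x"
    if "x \<in> hcarrier \<H>" for c d x
    using that by (auto simp: hsum_scale pre_hilbert.scale_add_left[OF summand])
  show "hscale \<H> c (hscale \<H> d x) = hscale \<H> (c * d) x"
    if "x \<in> hcarrier \<H>" for c d x
    using that by (auto simp: hsum_scale pre_hilbert.scale_scale[OF summand])
  show "hscale \<H> 1 x = x" if "x \<in> hcarrier \<H>" for x
    using hsum_outside[OF that] that by (auto simp: hsum_scale pre_hilbert.scale_one[OF summand])
  show "hinner \<H> y x = cnj (hinner \<H> x y)"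
    if "x \<in> hcarrier \<H>" "y \<in> hcarrier \<H>" for x y
    unfolding hsum_inner infsum_cnj[symmetric]
    by (rule infsum_cong, rule pre_hilbert.inner_cnj[OF summand]) (use that in auto)
  show "hinner \<H> x (y + z) = hinner \<H> x y + hinner \<H> x z"
    if "x \<in> hcarrier \<H>" "y \<in> hcarrier \<H>" "z \<in> hcarrier \<H>" for x y z
    unfolding hsum_inner
    by (subst infsum_add[symmetric])
      (use that in \<open>auto intro!: hsum_inner_summable infsum_cong simp: pre_hilbert.inner_add_right[OF summand]\<close>)
  show "hinner \<H> x (hscale \<H> c y) = c * hinner \<H> x y"
    if "x \<in> hcarrier \<H>" "y \<in> hcarrier \<H>" for c x y
    unfolding hsum_inner infsum_cmult_right'[symmetric]
    by (rule infsum_cong) (use that in \<open>simp add: hsum_scale pre_hilbert.inner_scale_right[OF summand]\<close>)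
  show "Re (hinner \<H> x x) > 0" if x: "x \<in> hcarrier \<H>" and "x \<noteq> 0" for x
  proof -
    obtain i where i: "x i \<noteq> 0" using \<open>x \<noteq> 0\<close> by (auto simp: fun_eq_iff)
    then have iI: "i \<in> I" using x by (metis hsum_outside)
    have "Re (hinner \<H> x x) = (\<Sum>\<^sub>\<infinity>i\<in>I. Re (hinner (X i) (x i) (x i)))"
      unfolding hsum_inner by (rule infsum_Re[symmetric]) (intro hsum_inner_summable x)
    also have "\<dots> \<ge> (\<Sum>i\<in>{i}. Re (hinner (X i) (x i) (x i)))"
      using x iI by (intro finite_sum_le_infsum summable_on_Re hsum_inner_summable)
        (auto simp: pre_hilbert.inner_self_nonneg[OF summand])
    finally show ?thesis
      using pre_hilbert.inner_pos[OF summand[OF iI], of "x i"] i iI x by simp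
  qed
qed

end

sublocale hsum_family \<subseteq> H: pre_hilbert "hsum I X"
  by (rule hsum_pre_hilbert)

context hsum_family
begin

lemma hsum_norm_sq:
  assumes "x \<in> hcarrier \<H>"
  shows "(hnorm \<H> x)\<^sup>2 = (\<Sum>\<^sub>\<infinity>i\<in>I. (hnorm (X i) (x i))\<^sup>2)"
proof -
  have "(hnorm \<H> x)\<^sup>2 = (\<Sum>\<^sub>\<infinity>i\<in>I. Re (hinner (X i) (x i) (x i)))"
    unfolding H.hnorm_sq[OF assms] hsum_inner
    by (rule infsum_Re[symmetric]) (intro hsum_inner_summable assms)
  also have "\<dots> = (\<Sum>\<^sub>\<infinity>i\<in>I. (hnorm (X i) (x i))\<^sup>2)"
    by (rule infsum_cong) (use assms in \<open>simp add: pre_hilbert.hnorm_sq[OF summand]\<close>)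
  finally show ?thesis .
qed

definition emb :: "'i \<Rightarrow> 'v \<Rightarrow> 'i \<Rightarrow> 'v" where
  "emb i v = (\<lambda>j. if j = i then v else 0)"

lemma emb_same [simp]: "emb i v i = v"
  by (simp add: emb_def)

lemma emb_zero [simp]: "emb i 0 = 0"
  by (auto simp: emb_def)

lemma emb_other [simp]: "j \<noteq> i \<Longrightarrow> emb i v j = 0"
  by (simp add: emb_def)

lemma emb_closed [simp]:
  assumes i: "i \<in> I" and v: "v \<in> hcarrier (X i)"
  shows "emb i v \<in> hcarrier \<H>"
proof -
  have "(\<lambda>j. (hnorm (X j) (emb i v j))\<^sup>2) summable_on {i}" by simp
  then have "(\<lambda>j. (hnorm (X j) (emb i v j))\<^sup>2) summable_on I"
    by (rule summable_on_cong_neutral[THEN iffD1, rotated -1])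
      (use i in \<open>auto simp: emb_def pre_hilbert.hnorm_zero[OF summand]\<close>)
  then show ?thesis
    using assms unfolding hsum_carrier_iff by (auto simp: emb_def pre_hilbert.zero_closed[OF summand])
qed

lemma inner_emb_left:
  assumes i: "i \<in> I" and v: "v \<in> hcarrier (X i)" and x: "x \<in> hcarrier \<H>"
  shows "hinner \<H> (emb i v) x = hinner (X i) v (x i)"
proof -
  have "hinner \<H> (emb i v) x = (\<Sum>\<^sub>\<infinity>j\<in>{i}. hinner (X j) (emb i v j) (x j))"
    unfolding hsum_inner
    by (rule infsum_cong_neutral)
      (use i x in \<open>auto simp: emb_def pre_hilbert.inner_zero_left[OF summand]\<close>)
  then show ?thesis by simp
qed

lemma hnorm_emb:
  assumes "i \<in> I" "v \<in> hcarrier (X i)"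
  shows "hnorm \<H> (emb i v) = hnorm (X i) v"
  using assms by (simp add: hnorm_def inner_emb_left)

lemma emb_add: "i \<in> I \<Longrightarrow> emb i (v + w) = emb i v + emb i w"
  by (auto simp: emb_def)

lemma emb_scale: "i \<in> I \<Longrightarrow> emb i (hscale (X i) c v) = hscale \<H> c (emb i v)"
  by (auto simp: emb_def hsum_scale pre_hilbert.scale_zero_right[OF summand])

section \<open>The algebra of block-diagonal operators\<close>

lemma diag_op_apply:
  "x \<in> hcarrier \<H> \<Longrightarrow> i \<in> I \<Longrightarrow> diag_op I X a x i = a i (x i)"
  by (simp add: diag_op_def)

lemma diag_op_hops:
  assumes a: "\<And>i. i \<in> I \<Longrightarrow> a i \<in> hops (X i)"
    and K: "\<And>i v. i \<in> I \<Longrightarrow> v \<in> hcarrier (X i) \<Longrightarrow> hnorm (X i) (a i v) \<le> K * hnorm (X i) v"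
  shows "diag_op I X a \<in> hops \<H>"
proof (rule H.hopsI[where K = "\<bar>K\<bar>"])
  have K': "(hnorm (X i) (diag_op I X a x i))\<^sup>2 \<le> K\<^sup>2 * (hnorm (X i) (x i))\<^sup>2"
    if x: "x \<in> hcarrier \<H>" and i: "i \<in> I" for x i
    using power_mono[OF K[OF i hsum_component[OF x i]], of 2] a[OF i] x i
    by (simp add: diag_op_apply power_mult_distrib pre_hilbert.hnorm_nonneg[OF summand]
        pre_hilbert.hops_closed[OF summand])
  show cl: "diag_op I X a x \<in> hcarrier \<H>" if x: "x \<in> hcarrier \<H>" for x
    unfolding hsum_carrier_iff
  proof (intro conjI ballI allI impI)
    show "(\<lambda>i. (hnorm (X i) (diag_op I X a x i))\<^sup>2) summable_on I"
      by (rule summable_on_bounded[OF summable_on_cmult_right[OF hsum_summable[OF x]]])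
        (use K'[OF x] in auto)
  qed (use x a in \<open>auto simp: diag_op_def pre_hilbert.hops_closed[OF summand]\<close>)
  show "hnorm \<H> (diag_op I X a x) \<le> \<bar>K\<bar> * hnorm \<H> x"
    if x: "x \<in> hcarrier \<H>" for x
  proof (rule power2_le_imp_le)
    have "(hnorm \<H> (diag_op I X a x))\<^sup>2 \<le> (\<Sum>\<^sub>\<infinity>i\<in>I. K\<^sup>2 * (hnorm (X i) (x i))\<^sup>2)"
      unfolding hsum_norm_sq[OF cl[OF x]]
      by (intro infsum_mono K' x hsum_summable cl summable_on_cmult_right)
    also have "\<dots> = K\<^sup>2 * (hnorm \<H> x)\<^sup>2"
      unfolding hsum_norm_sq[OF x] by (rule infsum_cmult_right')
    finally show "(hnorm \<H> (diag_op I X a x))\<^sup>2 \<le> (\<bar>K\<bar> * hnorm \<H> x)\<^sup>2"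
      by (simp add: power_mult_distrib)
  qed (use x in simp)
  show "diag_op I X a (hscale \<H> c x) = hscale \<H> c (diag_op I X a x)"
    if x: "x \<in> hcarrier \<H>" for c x
  proof
    fix i
    show "diag_op I X a (hscale \<H> c x) i = hscale \<H> c (diag_op I X a x) i"
      using a x H.scale_closed[OF x, of c]
      by (simp add: diag_op_def) (simp add: hsum_scale pre_hilbert.hops_scale[OF summand])
  qed
qed (use a in \<open>auto simp: diag_op_def fun_eq_iff pre_hilbert.hops_add[OF summand]\<close>)

lemma linf_bound:
  assumes a: "a \<in> linf I X"
  obtains K where "K \<ge> 0"
    "\<And>i v. i \<in> I \<Longrightarrow> v \<in> hcarrier (X i) \<Longrightarrow> hnorm (X i) (a i v) \<le> K * hnorm (X i) v"
proof -
  obtain K where K: "\<And>i. i \<in> I \<Longrightarrow> hopnorm (X i) (a i) \<le> K"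
    using a unfolding linf_def bdd_above_def by blast
  show ?thesis
  proof (rule that[of "\<bar>K\<bar>"])
    fix i v assume i: "i \<in> I" and v: "v \<in> hcarrier (X i)"
    interpret Xi: pre_hilbert "X i" by (rule summand[OF i])
    have "a i \<in> hops (X i)" using a i by (auto simp: linf_def)
    from Xi.hnorm_le_hopnorm[OF this v]
    have "hnorm (X i) (a i v) \<le> hopnorm (X i) (a i) * hnorm (X i) v" .
    also have "\<dots> \<le> \<bar>K\<bar> * hnorm (X i) v"
      using K[OF i] v by (intro mult_right_mono) auto
    finally show "hnorm (X i) (a i v) \<le> \<bar>K\<bar> * hnorm (X i) v" .
  qed simp
qed

lemma linfI:
  assumes a: "\<And>i. i \<in> I \<Longrightarrow> a i \<in> hops (X i)" and "a \<in> extensional I" and "K \<ge> 0"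
    and K: "\<And>i v. i \<in> I \<Longrightarrow> v \<in> hcarrier (X i) \<Longrightarrow> hnorm (X i) (a i v) \<le> K * hnorm (X i) v"
  shows "a \<in> linf I X"
proof -
  have "hopnorm (X i) (a i) \<le> K" if "i \<in> I" for i
    using K[OF that] \<open>K \<ge> 0\<close> by (intro pre_hilbert.hopnorm_le[OF summand[OF that]])
  then have "bdd_above ((\<lambda>i. hopnorm (X i) (a i)) ` I)" by (auto simp: bdd_above_def)
  then show ?thesis using assms by (auto simp: linf_def PiE_def)
qed

lemma diag_op_emb:
  assumes "i \<in> I" "v \<in> hcarrier (X i)" "\<And>i. i \<in> I \<Longrightarrow> a i \<in> hops (X i)"
  shows "diag_op I X a (emb i v) = emb i (a i v)"
proof
  fix j
  show "diag_op I X a (emb i v) j = emb i (a i v) j"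
    using assms by (cases "j = i") (auto simp: diag_op_def pre_hilbert.hops_zero[OF summand])
qed

text \<open>\<open>emb i (x i)\<close> is the projection of \<open>x\<close> to the \<open>i\<close>-th summand.\<close>

lemma linf_alg_iff:
  "T \<in> linf_alg I X \<longleftrightarrow> T \<in> hops \<H> \<and>
     (\<forall>i\<in>I. \<forall>x\<in>hcarrier \<H>. T (emb i (x i)) = emb i (T x i))"
proof
  assume "T \<in> linf_alg I X"
  then obtain a where a: "a \<in> linf I X" and T: "T = diag_op I X a" by (auto simp: linf_alg_def)
  obtain K where K: "\<And>i v. i \<in> I \<Longrightarrow> v \<in> hcarrier (X i) \<Longrightarrow> hnorm (X i) (a i v) \<le> K * hnorm (X i) v"
    using linf_bound[OF a] by metis
  have hops: "\<And>i. i \<in> I \<Longrightarrow> a i \<in> hops (X i)" using a by (auto simp: linf_def)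
  have "T \<in> hops \<H>" unfolding T using hops K by (rule diag_op_hops)
  then show "T \<in> hops \<H> \<and>
     (\<forall>i\<in>I. \<forall>x\<in>hcarrier \<H>. T (emb i (x i)) = emb i (T x i))"
    unfolding T using hops by (simp add: diag_op_emb diag_op_apply)
next
  assume T: "T \<in> hops \<H> \<and>
     (\<forall>i\<in>I. \<forall>x\<in>hcarrier \<H>. T (emb i (x i)) = emb i (T x i))"
  then have Th: "T \<in> hops \<H>" by blast
  have comm: "T (emb i (x i)) = emb i (T x i)" if "i \<in> I" "x \<in> hcarrier \<H>" for i x
    using T that by blast
  obtain K where K: "K \<ge> 0" "\<And>x. x \<in> hcarrier \<H> \<Longrightarrow> hnorm \<H> (T x) \<le> K * hnorm \<H> x"
    using H.hops_bounded[OF Th] by metis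
  \<comment> \<open>The component of \<open>T\<close> on the \<open>i\<close>-th summand. Tuples in
    \<open>linf\<close> are extensional, hence \<open>undefined\<close> outside \<open>I\<close>;
    operators vanish off the carrier, hence the inner case distinction.\<close>
  define a where "a i = (if i \<in> I then (\<lambda>v. if v \<in> hcarrier (X i) then T (emb i v) i else 0) else undefined)" for i
  have Kv: "hnorm (X i) (a i v) \<le> K * hnorm (X i) v" if i: "i \<in> I" and v: "v \<in> hcarrier (X i)" for i v
  proof -
    \<comment> \<open>\<open>T\<close> maps the \<open>i\<close>-th summand into itself, so no norm
      is lost in passing to the component, and the bound of \<open>T\<close> serves all
      components.\<close>
    have "T (emb i v) = emb i (T (emb i v) i)"
      using comm[OF i emb_closed[OF i v]] by simp
    then have "hnorm (X i) (a i v) = hnorm \<H> (T (emb i v))"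
      using i v Th hnorm_emb[OF i, of "T (emb i v) i"] by (simp add: a_def)
    then show ?thesis using K(2)[OF emb_closed[OF i v]] i v by (simp add: hnorm_emb)
  qed
  have ah: "a i \<in> hops (X i)" if i: "i \<in> I" for i
  proof -
    interpret Xi: pre_hilbert "X i" by (rule summand[OF i])
    have sc: "T (emb i (hscale (X i) c v)) i = hscale (X i) c (T (emb i v) i)"
      if "v \<in> hcarrier (X i)" for c v
      using i that by (subst emb_scale[OF i], subst H.hops_scale[OF Th]) (simp_all add: hsum_scale)
    show ?thesis
      by (rule Xi.hopsI[where K = K])
        (use i Th Kv[OF i] in \<open>simp_all add: a_def emb_add H.hops_add sc\<close>)
  qed
  have "a \<in> linf I X"
    by (rule linfI[OF ah _ K(1) Kv]) (auto simp: a_def extensional_def)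
  moreover have "T = diag_op I X a"
  proof (rule H.hops_ext[OF Th diag_op_hops[OF ah Kv]], assumption+)
    fix x assume x: "x \<in> hcarrier \<H>"
    show "T x = diag_op I X a x"
    proof
      fix i
      show "T x i = diag_op I X a x i"
        using comm[OF _ x, of i] x Th hsum_outside[OF H.hops_closed[OF Th], of i] by (cases "i \<in> I") (simp_all add: a_def diag_op_def)
    qed
  qed
  ultimately show "T \<in> linf_alg I X" by (auto simp: linf_alg_def)
qed

lemma linf_alg_hops: "linf_alg I X \<subseteq> hops \<H>"
  using linf_alg_iff by blast

text \<open>Commuting with the summand projections is preserved by linear combinations, so no bound
  on the tuples has to be computed.\<close>

lemma linf_alg_sum:
  assumes T: "\<And>p. p \<in> P \<Longrightarrow> T p \<in> linf_alg I X"
  shows "(\<lambda>x. \<Sum>p\<in>P. hscale \<H> (c p) (T p x)) \<in> linf_alg I X"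
  unfolding linf_alg_iff
proof (intro conjI ballI)
  have Th: "T p \<in> hops \<H>" if "p \<in> P" for p using T[OF that] linf_alg_hops by blast
  then show "(\<lambda>x. \<Sum>p\<in>P. hscale \<H> (c p) (T p x)) \<in> hops \<H>"
    by (intro H.sum_hops H.scale_hops)
  fix i x assume i: "i \<in> I" and x: "x \<in> hcarrier \<H>"
  have "T p (emb i (x i)) = emb i (T p x i)" if "p \<in> P" for p
    using T[OF that] i x unfolding linf_alg_iff by blast
  moreover have "emb i (\<Sum>p\<in>P. f p) = (\<Sum>p\<in>P. emb i (f p))" for f
    by (induction P rule: infinite_finite_induct) (use i in \<open>auto simp: emb_add\<close>)
  ultimately show "(\<Sum>p\<in>P. hscale \<H> (c p) (T p (emb i (x i)))) =
     emb i ((\<Sum>p\<in>P. hscale \<H> (c p) (T p x)) i)"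
    using i by (simp add: sum_fun_apply emb_scale[OF i, symmetric]) (simp add: hsum_scale)
qed

lemma linf_alg_comp:
  assumes "S \<in> linf_alg I X" "T \<in> linf_alg I X"
  shows "S \<circ> T \<in> linf_alg I X"
  using assms unfolding linf_alg_iff by (auto simp: H.hops_closed)

lemma diag_op_linf_alg: "a \<in> linf I X \<Longrightarrow> diag_op I X a \<in> linf_alg I X"
  by (auto simp: linf_alg_def)

lemma diag_op_adj_pair:
  assumes "diag_op I X a \<in> hops \<H>" "diag_op I X b \<in> hops \<H>"
    and "\<And>i. i \<in> I \<Longrightarrow> pre_hilbert.adj_pair (X i) (a i) (b i)"
  shows "H.adj_pair (diag_op I X a) (diag_op I X b)"
  unfolding H.adj_pair_def using assms(1,2)
  by (auto simp: hsum_inner diag_op_apply pre_hilbert.adj_pairD(3)[OF summand assms(3)] intro!: infsum_cong)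

end

section \<open>Conjugation by unitaries\<close>

context pre_hilbert
begin

lemma adj_pair_comp: "adj_pair S' S \<Longrightarrow> adj_pair T' T \<Longrightarrow> adj_pair (T' \<circ> S') (S \<circ> T)"
  by (simp add: adj_pair_def)

lemma adj_pair_sum:
  assumes "\<And>t. t \<in> A \<Longrightarrow> adj_pair (E' t) (E t)"
  shows "adj_pair (\<lambda>x. \<Sum>t\<in>A. hscale V (cnj (c t)) (E' t x)) (\<lambda>x. \<Sum>t\<in>A. hscale V (c t) (E t x))"
proof -
  note hops = adj_pairD(1,2)[OF assms]
  show ?thesis
    unfolding adj_pair_def
  proof (intro conjI ballI sum_hops scale_hops hops)
    fix x y assume "x \<in> \<V>" "y \<in> \<V>"
    then show "hinner V (\<Sum>t\<in>A. hscale V (cnj (c t)) (E' t x)) y =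
       hinner V x (\<Sum>t\<in>A. hscale V (c t) (E t y))"
      using hops by (simp add: inner_sum_left inner_sum_right inner_scale_left inner_scale_right
          adj_pairD(3)[OF assms])
  qed
qed

text \<open>Write \<open>W g\<close> as \<open>U\<close> after \<open>D g\<close>, with
  \<open>U\<close> a finite combination of the \<open>E t\<close>. \<open>DM\<close> says that
  \<open>D g\<close> drops out of the conjugation of \<open>T\<close>; expanding \<open>U\<close> on
  the left and its adjoint on the right gives a double sum, whence the index set
  \<open>Q \<times> Q\<close>.\<close>

lemma conj_jointly_continuousI:
  assumes M: "M \<subseteq> hops V" and Q: "finite Q"
    and c: "\<And>t. t \<in> Q \<Longrightarrow> continuous_map G euclidean (\<lambda>g. c g t)"
    and E: "\<And>t. t \<in> Q \<Longrightarrow> adj_pair (E' t) (E t)"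
    and D: "\<And>g. g \<in> topspace G \<Longrightarrow> adj_pair (D' g) (D g)"
    and W: "\<And>g. g \<in> topspace G \<Longrightarrow> W g = (\<lambda>x. \<Sum>t\<in>Q. hscale V (c g t) (E t (D g x)))"
    and DM: "\<And>g T x. g \<in> topspace G \<Longrightarrow> T \<in> M \<Longrightarrow> x \<in> \<V> \<Longrightarrow> D g (T (D' g x)) = T x"
    and WM: "\<And>g T. g \<in> topspace G \<Longrightarrow> T \<in> M \<Longrightarrow> conj_by V (W g) T \<in> M"
  shows "jointly_continuous G (sigma_weak V M) (\<lambda>g. conj_by V (W g))"
proof (rule jointly_continuousI[where P = "Q \<times> Q" and c = "\<lambda>g (t, s). c g t * cnj (c g s)"
      and L = "\<lambda>(t, s). E t" and L' = "\<lambda>(t, s). E' t" and R = "\<lambda>(t, s). E' s"])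
  show "finite (Q \<times> Q)" using Q by simp
  show "continuous_map G euclidean (\<lambda>g. case p of (t, s) \<Rightarrow> c g t * cnj (c g s))" if "p \<in> Q \<times> Q" for p
    using that c by (auto intro!: continuous_map_complex_mult continuous_map_complex_cnj)
  show "adj_pair (case p of (t, s) \<Rightarrow> E' t) (case p of (t, s) \<Rightarrow> E t)" if "p \<in> Q \<times> Q" for p
    using that E by auto
  show "(case p of (t, s) \<Rightarrow> E' s) \<in> hops V" if "p \<in> Q \<times> Q" for p
    using that adj_pairD(1)[OF E] by auto
  fix g T assume g: "g \<in> topspace G" and T: "T \<in> M"
  note hops = adj_pairD(1,2)[OF E]
  have Th: "T \<in> hops V" using T M by blast
  define U where "U = (\<lambda>x. \<Sum>t\<in>Q. hscale V (c g t) (E t x))"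
  define U' where "U' = (\<lambda>x. \<Sum>t\<in>Q. hscale V (cnj (c g t)) (E' t x))"
  have UU: "adj_pair U' U" unfolding U_def U'_def by (rule adj_pair_sum[OF E])
  have "W g = U \<circ> D g" using W[OF g] by (simp add: U_def o_def)
  then have hadjW: "hadj V (W g) = D' g \<circ> U'"
    using hadj_eq[OF adj_pair_comp[OF UU D[OF g]]] by simp
  show "conj_by V (W g) T = (\<lambda>x. \<Sum>p\<in>Q \<times> Q. hscale V (case p of (t, s) \<Rightarrow> c g t * cnj (c g s))
       ((case p of (t, s) \<Rightarrow> E t) (T ((case p of (t, s) \<Rightarrow> E' s) x))))"
    (is "_ = ?rhs")
  proof
    fix x
    have U'x: "U' x \<in> \<V>" by (rule hops_closed[OF adj_pairD(1)[OF UU]])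
    have "conj_by V (W g) T x = W g (T (D' g (U' x)))" by (simp add: conj_by_def hadjW)
    also have "\<dots> = (\<Sum>t\<in>Q. hscale V (c g t) (E t (T (U' x))))"
      unfolding W[OF g] using DM[OF g T U'x] by simp
    also have "\<dots> = (\<Sum>t\<in>Q. \<Sum>s\<in>Q. hscale V (c g t * cnj (c g s)) (E t (T (E' s x))))"
    proof (rule sum.cong)
      fix t assume t: "t \<in> Q"
      have "T (U' x) = (\<Sum>s\<in>Q. hscale V (cnj (c g s)) (T (E' s x)))"
        unfolding U'_def using hops(1) Th by (simp add: hops_sum hops_scale)
      then have "E t (T (U' x)) = (\<Sum>s\<in>Q. hscale V (cnj (c g s)) (E t (T (E' s x))))"
        using hops(2)[OF t] Th by (simp add: hops_sum hops_scale)
      then show "hscale V (c g t) (E t (T (U' x))) =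
          (\<Sum>s\<in>Q. hscale V (c g t * cnj (c g s)) (E t (T (E' s x))))"
        using hops(2)[OF t] by (simp add: scale_sum_right scale_scale)
    qed simp
    also have "\<dots> = ?rhs x"
      unfolding sum.cartesian_product by (rule sum.cong) auto
    finally show "conj_by V (W g) T x = ?rhs x" .
  qed
qed (use M WM in auto)

text \<open>Conjugation by a unitary \<open>w\<close> sends \<open>|a l><b l|\<close> to
  \<open>|w a l><w b l|\<close>. For \<open>w = W (g k)\<close> the given eigenvalues negate the
  \<open>k\<close>-th matrix unit and fix the others.\<close>

lemma not_conj_jointly_continuousI:
  fixes a b :: "nat \<Rightarrow> 'v"
  assumes a: "\<And>k. a k \<in> \<V>" and b: "\<And>k. b k \<in> \<V>"
    and aa: "\<And>k l. hinner V (a k) (a l) = (if k = l then 1 else 0)"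
    and bb: "\<And>k l. hinner V (b k) (b l) = (if k = l then 1 else 0)"
    and M: "\<And>S t. finite S \<Longrightarrow> (\<lambda>x. \<Sum>l\<in>S. hscale V (t l) (rank_one (a l) (b l) x)) \<in> M"
    and g0: "g0 \<in> topspace G" "W g0 = hid V"
    and lim: "\<And>N. openin G N \<Longrightarrow> g0 \<in> N \<Longrightarrow> \<exists>K. \<forall>k\<ge>K. g k \<in> N"
    and W: "\<And>k. adj_pair (W' k) (W (g k))"
    and Wa: "\<And>k l. W (g k) (a l) = (if k = l then - a l else a l)"
    and Wb: "\<And>k l. W (g k) (b l) = b l"
  shows "\<not> jointly_continuous G (sigma_weak V M) (\<lambda>g. conj_by V (W g))"
proof -
  \<comment> \<open>Weights \<open>2^-k\<close> make the vectors of \<open>\<phi>\<close>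
    square-summable, while \<open>\<phi>\<close> still takes the nonzero value \<open>4^-l\<close>
    on the \<open>l\<close>-th matrix unit.\<close>
  define r where "r k = complex_of_real ((1/2) ^ k)" for k :: nat
  define \<phi> :: "('v \<Rightarrow> 'v) \<Rightarrow> complex" where
    "\<phi> = (\<lambda>T. \<Sum>k. hinner V (hscale V (r k) (a k)) (T (hscale V (r k) (b k))))"
  have hadj_hid: "hadj V (hid V) = hid V" by (rule hadj_eq) (simp add: adj_pair_def)
  have norm: "hnorm V (a k) = 1" "hnorm V (b k) = 1" for k
    by (simp_all add: hnorm_def aa bb)
  have "summable (\<lambda>k. ((1/2) ^ k)\<^sup>2 :: real)"
    using summable_geometric[of "1/4 :: real"]
    by (simp add: power2_eq_square flip: power_mult_distrib)
  then have \<phi>: "\<phi> \<in> normal_functionals V"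
    unfolding \<phi>_def using a b
    by (intro normal_functionalI) (simp_all add: hnorm_scale norm r_def norm_power norm_divide)
  have \<phi>_rank_one: "\<phi> (rank_one (a l) (b l)) = r l * r l" for l
  proof -
    have "\<phi> (rank_one (a l) (b l)) = (\<Sum>k. if k = l then r l * r l else 0)"
      unfolding \<phi>_def using a b
      by (intro suminf_cong)
        (simp add: rank_one_def inner_scale_left inner_scale_right aa bb, simp add: r_def)
    also have "\<dots> = r l * r l" using sums_single[of l "\<lambda>_. r l * r l"] by (simp add: sums_iff)
    finally show ?thesis .
  qed
  define comb where "comb S t x = (\<Sum>l\<in>S. hscale V (t l) (rank_one (a l) (b l) x))"
    for S :: "nat set" and t x
  have comb_hops: "comb S t \<in> hops V" for S t
    unfolding comb_def using a b by (intro sum_hops scale_hops) auto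
  have act: "conj_by V (W (g k)) (comb S t) = comb S (t(k := - t k))" for k S t
  proof (rule hops_ext)
    show "conj_by V (W (g k)) (comb S t) \<in> hops V"
      unfolding conj_by_def hadj_eq[OF W] using adj_pairD(1,2)[OF W] comb_hops by simp
    fix x assume x: "x \<in> \<V>"
    have Wx: "W' k x \<in> \<V>" using adj_pairD(1)[OF W] by simp
    \<comment> \<open>Moving the adjoint \<open>W' k\<close> across the inner product leaves
      \<open>W (g k)\<close> acting on \<open>b l\<close>, which it fixes.\<close>
    have bW: "hinner V (b l) (W' k x) = hinner V (b l) x" for l
      using adj_pairD(3)[OF adj_pair_sym[OF W] b x, of k l] by (simp add: Wb)
    have "conj_by V (W (g k)) (comb S t) x =
        (\<Sum>l\<in>S. hscale V (t l) (hscale V (hinner V (b l) x) (W (g k) (a l))))"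
      unfolding conj_by_def hadj_eq[OF W] comb_def using Wx a b adj_pairD(2)[OF W]
      by (simp add: rank_one_def hops_sum hops_scale bW)
    also have "\<dots> = comb S (t(k := - t k)) x"
      unfolding comb_def using x a by (intro sum.cong) (simp_all add: Wa rank_one_def
          uminus_eq_scale scale_scale)
    finally show "conj_by V (W (g k)) (comb S t) x = comb S (t(k := - t k)) x" .
  qed (rule comb_hops)
  show ?thesis
  proof (rule not_jointly_continuousI[where T = "\<lambda>l. rank_one (a l) (b l)" and \<phi> = \<phi>])
    show "conj_by V (W g0) (\<lambda>x. \<Sum>l\<in>S. hscale V (t l) (rank_one (a l) (b l) x)) =
       (\<lambda>x. \<Sum>l\<in>S. hscale V (t l) (rank_one (a l) (b l) x))" for S t
    proof (rule hops_ext)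
      show "conj_by V (W g0) (\<lambda>x. \<Sum>l\<in>S. hscale V (t l) (rank_one (a l) (b l) x)) \<in> hops V"
        unfolding conj_by_def g0(2) hadj_hid using comb_hops[of S t] by (simp add: comb_def[abs_def])
      show "(\<lambda>x. \<Sum>l\<in>S. hscale V (t l) (rank_one (a l) (b l) x)) \<in> hops V"
        using comb_hops[of S t] by (simp add: comb_def[abs_def])
    qed (use a b in \<open>simp add: conj_by_def g0 hadj_hid rank_one_def\<close>)
    show "conj_by V (W (g k)) (\<lambda>x. \<Sum>l\<in>S. hscale V (t l) (rank_one (a l) (b l) x)) =
       (\<lambda>x. \<Sum>l\<in>S. hscale V ((t(k := - t k)) l) (rank_one (a l) (b l) x))" for S t k
      using act[of k S t] unfolding comb_def[abs_def] .
    show "\<phi> (rank_one (a l) (b l)) \<noteq> 0" for l by (simp add: \<phi>_rank_one r_def)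
  qed (use M a b \<phi> lim g0 in auto)
qed

end

section \<open>Quantum sets\<close>

locale q_set =
  fixes I :: "'i set" and X :: "'i \<Rightarrow> 'v::ab_group_add hilb"
  assumes quantum_set: "quantum_set I X"
begin

lemma summand_fin: "i \<in> I \<Longrightarrow> fin_hilbert (X i)"
  using quantum_set by (simp add: quantum_set_def fin_hilbert_def)

end

sublocale q_set \<subseteq> hsum_family I X
proof (rule hsum_family.intro)
  fix i assume "i \<in> I"
  then interpret fin_hilbert "X i" by (rule summand_fin)
  show "pre_hilbert (X i)" by unfold_locales
qed

context q_set
begin

abbreviation \<U> where "\<U> \<equiv> linf_unitary_topology I X"
abbreviation Op where "Op u \<equiv> diag_op I X u"

lemma topspace_linf_unitary: "topspace \<U> = (\<Pi>\<^sub>E i\<in>I. unitaries (X i))"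
  unfolding linf_unitary_topology_def topspace_product_topology
  by (rule PiE_cong) (rule pre_hilbert.topspace_unitary_topology[OF summand])

lemma linf_unitaryD: "u \<in> topspace \<U> \<Longrightarrow> i \<in> I \<Longrightarrow> u i \<in> unitaries (X i)"
  by (auto simp: topspace_linf_unitary)

lemma linf_unitary_hops: "u \<in> topspace \<U> \<Longrightarrow> i \<in> I \<Longrightarrow> u i \<in> hops (X i)"
  using linf_unitaryD pre_hilbert.unitary_hops[OF summand] by blast

lemma linf_unitary_in_linf:
  assumes "u \<in> topspace \<U>"
  shows "u \<in> linf I X"
  by (rule linfI[where K = 1, OF linf_unitary_hops[OF assms]])
    (use assms in \<open>simp_all add: topspace_linf_unitary PiE_def Pi_iff
        fin_hilbert.unitary_isometry[OF summand_fin]\<close>)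

definition adj :: "('i \<Rightarrow> 'v \<Rightarrow> 'v) \<Rightarrow> 'i \<Rightarrow> 'v \<Rightarrow> 'v" where
  "adj u = (\<lambda>i\<in>I. hadj (X i) (u i))"

lemma adj_topspace: "u \<in> topspace \<U> \<Longrightarrow> adj u \<in> topspace \<U>"
  using fin_hilbert.hadj_unitary[OF summand_fin]
  by (auto simp: topspace_linf_unitary adj_def)

lemma Op_linf_alg: "u \<in> topspace \<U> \<Longrightarrow> Op u \<in> linf_alg I X"
  by (rule diag_op_linf_alg[OF linf_unitary_in_linf])

lemma Op_hops: "u \<in> topspace \<U> \<Longrightarrow> Op u \<in> hops \<H>"
  using Op_linf_alg linf_alg_hops by blast

lemma Op_adj_pair:
  assumes u: "u \<in> topspace \<U>"
  shows "H.adj_pair (Op (adj u)) (Op u)"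
  using fin_hilbert.hadj_pair[OF summand_fin] linf_unitary_hops[OF u]
  by (intro diag_op_adj_pair Op_hops u adj_topspace) (simp add: adj_def)

lemma adj_apply:
  assumes u: "u \<in> topspace \<U>" and x: "x \<in> hcarrier \<H>" and i: "i \<in> I"
  shows "u i (adj u i (x i)) = x i" "adj u i (u i (x i)) = x i"
  using fin_hilbert.unitary_hadj_right[OF summand_fin[OF i] linf_unitaryD[OF u i]]
    fin_hilbert.unitary_hadj_left[OF summand_fin[OF i] linf_unitaryD[OF u i]] x i
  by (simp_all add: adj_def)

text \<open>Every unitary tuple \<open>u\<close> is the product of its components in \<open>F\<close> and of \<open>outside F u\<close>.\<close>

definition outside :: "'i set \<Rightarrow> ('i \<Rightarrow> 'v \<Rightarrow> 'v) \<Rightarrow> 'i \<Rightarrow> 'v \<Rightarrow> 'v" where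
  "outside F u = (\<lambda>i\<in>I. if i \<in> F then hid (X i) else u i)"

lemma hid_unitary:
  assumes "i \<in> I"
  shows "hid (X i) \<in> unitaries (X i)"
proof -
  interpret pre_hilbert "X i" by (rule summand[OF assms])
  have "adj_pair (hid (X i)) (hid (X i))" by (simp add: adj_pair_def)
  then show ?thesis by (rule unitariesI) simp_all
qed

lemma outside_topspace: "u \<in> topspace \<U> \<Longrightarrow> outside F u \<in> topspace \<U>"
  by (auto simp: topspace_linf_unitary outside_def hid_unitary)

definition one_tuple :: "'i \<Rightarrow> 'v \<Rightarrow> 'v" where
  "one_tuple = (\<lambda>i\<in>I. hid (X i))"

definition reflection_at :: "'i \<Rightarrow> 'v \<Rightarrow> 'i \<Rightarrow> 'v \<Rightarrow> 'v" where
  "reflection_at i e = one_tuple(i := (\<lambda>x. hid (X i) x - hscale (X i) 2 (pre_hilbert.rank_one (X i) e e x)))"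

lemma one_tuple_topspace: "one_tuple \<in> topspace \<U>"
  by (auto simp: topspace_linf_unitary one_tuple_def hid_unitary)

lemma reflection_at_topspace:
  assumes "i \<in> I" "e \<in> fin_onb (X i)"
  shows "reflection_at i e \<in> topspace \<U>"
  using assms fin_hilbert.fin_onb_inner[OF summand_fin[OF assms(1)] assms(2) assms(2)]
    fin_hilbert.fin_onb_carrier[OF summand_fin]
  by (auto simp: topspace_linf_unitary reflection_at_def one_tuple_def hid_unitary PiE_def extensional_def
      intro!: pre_hilbert.reflection_unitary[OF summand])

text \<open>A basic neighbourhood in the product restricts finitely many coordinates, and by
  injectivity of \<open>\<iota>\<close> only finitely many \<open>k\<close> move one of them. The
  moving coordinate itself may stay far from the identity.\<close>

lemma reflections_tendsto_one:
  assumes \<iota>: "inj \<iota>" and N: "openin \<U> N" "one_tuple \<in> N"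
    and g: "\<And>k. g k \<in> topspace \<U>" "\<And>k i. i \<noteq> \<iota> k \<Longrightarrow> g k i = one_tuple i"
  shows "\<exists>K::nat. \<forall>k\<ge>K. g k \<in> N"
proof -
  obtain Z where Z: "one_tuple \<in> (\<Pi>\<^sub>E i\<in>I. Z i)" "finite {i. Z i \<noteq> topspace (unitary_topology (X i))}"
    "(\<Pi>\<^sub>E i\<in>I. Z i) \<subseteq> N"
    using product_topology_open_contains_basis[OF N(1)[unfolded linf_unitary_topology_def] N(2)] by blast
  have "finite (\<iota> -` {i. Z i \<noteq> topspace (unitary_topology (X i))})"
    by (rule finite_vimageI[OF Z(2) \<iota>])
  then obtain K where K: "\<iota> -` {i. Z i \<noteq> topspace (unitary_topology (X i))} \<subseteq> {..<K}"
    using finite_nat_iff_bounded by blast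
  have "g k \<in> N" if "k \<ge> K" for k
  proof -
    have eq: "Z (\<iota> k) = topspace (unitary_topology (X (\<iota> k)))" using K that by force
    have "g k i \<in> Z i" if i: "i \<in> I" for i
    proof (cases "i = \<iota> k")
      case True
      then show ?thesis
        using g(1)[of k] i eq unfolding linf_unitary_topology_def topspace_product_topology by blast
    qed (use g(2)[of i k] Z(1) i in auto)
    moreover have "g k \<in> extensional I"
      using g(1)[of k] by (auto simp: topspace_linf_unitary PiE_def)
    ultimately show ?thesis using Z(3) by (auto simp: PiE_def)
  qed
  then show ?thesis by blast
qed

lemma virtually_classical_iff:
  "virtually_classical I X \<longleftrightarrow> finite {i \<in> I. \<not> (\<forall>b\<in>fin_onb (X i). \<forall>c\<in>fin_onb (X i). b = c)}"
  unfolding virtually_classical_def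
  by (intro arg_cong[where f = finite] Collect_cong conj_cong refl arg_cong[where f = Not]
      fin_hilbert.hops_commute_iff summand_fin)

lemma not_virtually_classicalE:
  assumes "\<not> virtually_classical I X"
  obtains \<iota> :: "nat \<Rightarrow> 'i" and e f :: "nat \<Rightarrow> 'v" where "inj \<iota>" "\<And>k. \<iota> k \<in> I"
    "\<And>k. e k \<in> fin_onb (X (\<iota> k))" "\<And>k. f k \<in> fin_onb (X (\<iota> k))" "\<And>k. e k \<noteq> f k"
proof -
  obtain \<iota> :: "nat \<Rightarrow> 'i" where \<iota>: "inj \<iota>"
    "range \<iota> \<subseteq> {i \<in> I. \<not> (\<forall>b\<in>fin_onb (X i). \<forall>c\<in>fin_onb (X i). b = c)}"
    using infinite_countable_subset[OF assms[unfolded virtually_classical_iff]]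
    by (elim exE conjE) (rule that)
  then have "\<forall>k. \<exists>b c. b \<in> fin_onb (X (\<iota> k)) \<and> c \<in> fin_onb (X (\<iota> k)) \<and> b \<noteq> c" by blast
  then obtain e f where "\<And>k. e k \<in> fin_onb (X (\<iota> k)) \<and> f k \<in> fin_onb (X (\<iota> k)) \<and> e k \<noteq> f k"
    by metis
  then show ?thesis using that[of \<iota> e f] \<iota> by blast
qed

section \<open>Joint continuity on the algebra itself\<close>

lemma continuous_map_coefficient:
  assumes "i \<in> I" "b \<in> hcarrier (X i)" "c \<in> hcarrier (X i)"
  shows "continuous_map \<U> euclidean (\<lambda>u. hinner (X i) b (u i c))"
proof -
  have "continuous_map \<U> (unitary_topology (X i)) (\<lambda>u. u i)"
    unfolding linf_unitary_topology_def using assms(1) by (rule continuous_map_product_projection)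
  from continuous_map_compose[OF this pre_hilbert.continuous_map_unitary_coefficient[OF summand[OF assms(1)] assms(2,3)]]
  show ?thesis by (simp add: o_def)
qed

text \<open>\<open>Op u\<close> is the product of \<open>Op (outside F u)\<close> and the operator
  that agrees with \<open>u\<close> on the summands in \<open>F\<close> and with the identity
  elsewhere. The latter is a finite combination of fixed operators.\<close>

lemma conj_jointly_continuous_if:
  assumes "virtually_classical I X"
  shows "conj_jointly_continuous I X"
proof -
  define F where "F = {i \<in> I. \<not> (\<forall>S\<in>hops (X i). \<forall>T\<in>hops (X i). S \<circ> T = T \<circ> S)}"
  have F: "finite F" "F \<subseteq> I" using assms by (auto simp: F_def virtually_classical_def)
  have comm: "S (T x) = T (S x)" if "i \<in> I - F" "S \<in> hops (X i)" "T \<in> hops (X i)" for i S T x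
  proof -
    have "S \<circ> T = T \<circ> S" using that unfolding F_def by blast
    from fun_cong[OF this, of x] show ?thesis by simp
  qed
  \<comment> \<open>\<open>None\<close> labels the projection \<open>R\<close> onto the summands
    outside \<open>F\<close>, with coefficient 1; \<open>Some (i, b, d)\<close> labels the matrix
    unit \<open>|b><d|\<close> in summand \<open>i\<close>, with a matrix entry of
    \<open>u i\<close> as coefficient.\<close>
  define Q :: "('i \<times> 'v \<times> 'v) option set"
    where "Q = insert None (Some ` (SIGMA i:F. fin_onb (X i) \<times> fin_onb (X i)))"
  define c where "c u t = (case t of None \<Rightarrow> 1 | Some (i, b, d) \<Rightarrow> hinner (X i) b (u i d))"
    for u :: "'i \<Rightarrow> 'v \<Rightarrow> 'v" and t
  define R where "R = Op (\<lambda>i. if i \<in> F then (\<lambda>x. 0) else hid (X i))"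
  define E where "E t = (case t of None \<Rightarrow> R
     | Some (i, b, d) \<Rightarrow> H.rank_one (emb i b) (emb i d))" for t
  define E' where "E' t = (case t of None \<Rightarrow> R
     | Some (i, b, d) \<Rightarrow> H.rank_one (emb i d) (emb i b))" for t
  have R: "R \<in> hops \<H>"
    unfolding R_def
    by (rule diag_op_hops[where K = 1])
      (auto simp: pre_hilbert.zero_hops[OF summand] pre_hilbert.hid_hops[OF summand]
        pre_hilbert.hnorm_zero[OF summand] pre_hilbert.hnorm_nonneg[OF summand]
        pre_hilbert.hid_apply[OF summand])
  have finB: "finite (fin_onb (X i))" if "i \<in> F" for i
    using that F fin_hilbert.finite_fin_onb[OF summand_fin] by blast
  have onb: "b \<in> hcarrier (X i)" if "i \<in> F" "b \<in> fin_onb (X i)" for i b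
    using that F fin_hilbert.fin_onb_carrier[OF summand_fin] by blast
  show ?thesis
    unfolding conj_jointly_continuous_def
  proof (rule H.conj_jointly_continuousI[where Q = Q and c = c and E = E and E' = E'
        and D = "\<lambda>u. Op (outside F u)" and D' = "\<lambda>u. Op (adj (outside F u))"])
    show "linf_alg I X \<subseteq> hops \<H>" by (rule linf_alg_hops)
    show "finite Q" unfolding Q_def using F finB by auto
    show "continuous_map \<U> euclidean (\<lambda>u. c u t)" if "t \<in> Q" for t
      using that F onb by (auto simp: Q_def c_def intro!: continuous_map_coefficient)
    show "H.adj_pair (E' t) (E t)" if "t \<in> Q" for t
    proof (cases t)
      case None
      have "H.adj_pair R R"
        unfolding R_def
        by (rule diag_op_adj_pair[OF R[unfolded R_def] R[unfolded R_def]])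
          (auto simp: pre_hilbert.adj_pair_def[OF summand] pre_hilbert.hid_hops[OF summand]
            pre_hilbert.zero_hops[OF summand] pre_hilbert.hid_apply[OF summand]
            pre_hilbert.inner_zero_left[OF summand] pre_hilbert.inner_zero_right[OF summand])
      then show ?thesis by (simp add: E_def E'_def None)
    next
      case (Some ibd)
      then show ?thesis
        using that F onb by (auto simp: E_def E'_def Q_def intro!: H.rank_one_adj)
    qed
    fix u assume u: "u \<in> topspace \<U>"
    note ou = outside_topspace[OF u, of F]
    show "H.adj_pair (Op (adj (outside F u))) (Op (outside F u))" by (rule Op_adj_pair[OF ou])
    show "Op u = (\<lambda>x. \<Sum>t\<in>Q. hscale \<H> (c u t) (E t (Op (outside F u) x)))"
    proof (rule H.hops_ext[OF Op_hops[OF u]])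
      have Eh: "E t \<in> hops \<H>" if "t \<in> Q" for t
        using that F onb R by (auto simp: E_def Q_def intro!: H.rank_one_hops)
      show "(\<lambda>x. \<Sum>t\<in>Q. hscale \<H> (c u t) (E t (Op (outside F u) x))) \<in> hops \<H>"
        using H.hops_comp[OF H.sum_hops[OF H.scale_hops[OF Eh]] Op_hops[OF ou]] by (simp add: o_def)
      fix x assume x: "x \<in> hcarrier \<H>"
      define y where "y = Op (outside F u) x"
      have y: "y \<in> hcarrier \<H>" using H.hops_closed[OF Op_hops[OF ou]] by (simp add: y_def)
      have yi: "y i = (if i \<in> F then x i else u i (x i))" if "i \<in> I" for i
        using that x unfolding y_def
        by (auto simp: diag_op_apply outside_def pre_hilbert.hid_apply[OF summand])
      have "(\<Sum>t\<in>Q. hscale \<H> (c u t) (E t y)) i = Op u x i" for i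
      proof (cases "i \<in> I")
        case i: True
        interpret Xi: fin_hilbert "X i" by (rule summand_fin[OF i])
        \<comment> \<open>In component \<open>i\<close> the term \<open>None\<close> contributes
          only if \<open>i \<notin> F\<close>, and among the matrix units only those of summand
          \<open>i\<close> contribute. For \<open>i \<in> F\<close> they add up to the expansion of
          \<open>u i (x i)\<close> in the basis.\<close>
        have 1: "hscale \<H> (c u t) (E t y) i = (if i \<in> F then 0 else u i (x i))" if "t = None" for t
          using that i y Xi.hops_closed[OF linf_unitary_hops[OF u i]] x
          by (simp add: c_def E_def R_def hsum_scale diag_op_apply yi)
        have 2: "hscale \<H> (c u (Some (j, b, d))) (E (Some (j, b, d)) y) i =
           (if j = i then hscale (X i) (hinner (X i) b (u i d) * hinner (X i) d (x i)) b else 0)"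
          if "j \<in> F" "b \<in> fin_onb (X j)" "d \<in> fin_onb (X j)" for j b d
          using that F onb i y x
          by (cases "j = i") (auto simp: c_def E_def H.rank_one_def hsum_scale inner_emb_left yi Xi.scale_scale
              pre_hilbert.scale_zero_right[OF summand])
        have "(\<Sum>t\<in>Q. hscale \<H> (c u t) (E t y)) i =
           (if i \<in> F then 0 else u i (x i)) +
           (\<Sum>(j, b, d)\<in>(SIGMA i:F. fin_onb (X i) \<times> fin_onb (X i)).
              if j = i then hscale (X i) (hinner (X i) b (u i d) * hinner (X i) d (x i)) b else 0)"
          unfolding sum_fun_apply Q_def using F finB
          by (subst sum.insert) (auto simp: 1 sum.reindex 2 intro!: sum.cong)
        also have "(\<Sum>(j, b, d)\<in>(SIGMA i:F. fin_onb (X i) \<times> fin_onb (X i)).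
              if j = i then hscale (X i) (hinner (X i) b (u i d) * hinner (X i) d (x i)) b else 0) =
            (\<Sum>j\<in>F. \<Sum>(b, d)\<in>fin_onb (X j) \<times> fin_onb (X j).
              if j = i then hscale (X i) (hinner (X i) b (u i d) * hinner (X i) d (x i)) b else 0)"
          by (rule sum.Sigma[symmetric]) (use F finB in auto)
        also have "\<dots> = (\<Sum>j\<in>F. if j = i then \<Sum>(b, d)\<in>fin_onb (X i) \<times> fin_onb (X i).
              hscale (X i) (hinner (X i) b (u i d) * hinner (X i) d (x i)) b else 0)"
          by (rule sum.cong) auto
        also have "\<dots> = (if i \<in> F then u i (x i) else 0)"
        proof -
          note uh = linf_unitary_hops[OF u i]
          have "(\<Sum>(b, d)\<in>fin_onb (X i) \<times> fin_onb (X i).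
              hscale (X i) (hinner (X i) b (u i d) * hinner (X i) d (x i)) b) =
             (\<Sum>b\<in>fin_onb (X i). hscale (X i) (hinner (X i) b (u i (x i))) b)"
            unfolding sum.cartesian_product[symmetric]
          proof (rule sum.cong)
            fix b assume b: "b \<in> fin_onb (X i)"
            have "(\<Sum>d\<in>fin_onb (X i). hinner (X i) b (u i d) * hinner (X i) d (x i)) =
               hinner (X i) b (u i (\<Sum>d\<in>fin_onb (X i). hscale (X i) (hinner (X i) d (x i)) d))"
              using b uh by (simp add: Xi.hops_sum Xi.hops_scale Xi.inner_sum_right Xi.inner_scale_right
                  mult.commute)
            also have "\<dots> = hinner (X i) b (u i (x i))"
              using Xi.fin_onb_expand[OF hsum_component[OF x i]] by simp
            finally show "(\<Sum>d\<in>fin_onb (X i). hscale (X i) (hinner (X i) b (u i d) * hinner (X i) d (x i)) b) =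
               hscale (X i) (hinner (X i) b (u i (x i))) b"
              by (simp add: Xi.vs.scale_sum_left[symmetric])
          qed simp
          also have "\<dots> = u i (x i)" using Xi.fin_onb_expand[OF Xi.hops_closed[OF uh]] by simp
          finally show ?thesis using F by simp
        qed
        finally show ?thesis using i x by (simp add: diag_op_apply)
      next
        case False
        have "(\<Sum>t\<in>Q. hscale \<H> (c u t) (E t y)) i = 0"
          using False by (simp add: sum_fun_apply hsum_scale)
        then show ?thesis using False x by (simp add: diag_op_def)
      qed
      then show "Op u x = (\<Sum>t\<in>Q. hscale \<H> (c u t) (E t (Op (outside F u) x)))"
        by (auto simp: y_def)
    qed
    fix T assume T: "T \<in> linf_alg I X"
    then obtain a where a: "a \<in> linf I X" "T = Op a" by (auto simp: linf_alg_def)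
    have Th: "T \<in> hops \<H>" using T linf_alg_hops by blast
    show "Op (outside F u) (T (Op (adj (outside F u)) x)) = T x" if x: "x \<in> hcarrier \<H>" for x
    proof
      fix i
      define z where "z = Op (adj (outside F u)) x"
      have z: "z \<in> hcarrier \<H>" unfolding z_def by (rule H.hops_closed[OF Op_hops[OF adj_topspace[OF ou]]])
      show "Op (outside F u) (T z) i = T x i"
      proof (cases "i \<in> I")
        case i: True
        have ai: "a i \<in> hops (X i)" using a i by (auto simp: linf_def)
        \<comment> \<open>In \<open>F\<close> the tuple \<open>outside F u\<close> is the identity,
          and outside \<open>F\<close> the operators on the summand commute; so it commutes with the
          components of \<open>T\<close>.\<close>
        have "outside F u i (a i (z i)) = a i (outside F u i (z i))"
        proof (cases "i \<in> F")
          case True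
          then show ?thesis using i z ai pre_hilbert.hops_closed[OF summand[OF i] ai]
            by (simp add: outside_def pre_hilbert.hid_apply[OF summand])
        next
          case False
          then show ?thesis using i by (intro comm[of i] linf_unitary_hops[OF ou] ai) auto
        qed
        also have "outside F u i (z i) = x i"
          unfolding z_def using adj_apply(1)[OF ou x i] x i by (simp add: diag_op_apply)
        finally show ?thesis
          using i x z Th H.hops_closed[OF Th] by (simp add: a(2) diag_op_apply)
      next
        case False
        then show ?thesis
          using hsum_outside[OF H.hops_closed[OF Th] False] by (simp add: diag_op_def)
      qed
    qed
    show "conj_by \<H> (Op u) T \<in> linf_alg I X"
      unfolding conj_by_def H.hadj_eq[OF Op_adj_pair[OF u]]
      by (intro linf_alg_comp Op_linf_alg u adj_topspace T)
  qed
qed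

lemma one_tuple_Op: "Op one_tuple = hid \<H>"
  by (rule H.hops_ext[OF Op_hops[OF one_tuple_topspace] H.hid_hops])
    (auto simp: diag_op_def one_tuple_def fun_eq_iff pre_hilbert.hid_apply[OF summand] hsum_outside)

lemma reflection_at_emb:
  assumes i: "i \<in> I" and e: "e \<in> fin_onb (X i)" and j: "j \<in> I" and b: "b \<in> fin_onb (X j)"
  shows "Op (reflection_at i e) (emb j b) = (if i = j \<and> e = b then - emb j b else emb j b)"
proof -
  interpret Xi: fin_hilbert "X i" by (rule summand_fin[OF i])
  interpret Xj: fin_hilbert "X j" by (rule summand_fin[OF j])
  have "reflection_at i e j b = (if i = j \<and> e = b then - b else b)"
  proof (cases "j = i")
    case True
    then show ?thesis
      using assms Xi.scale_add_left[of b 1 1]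
      by (auto simp: reflection_at_def one_tuple_def Xi.rank_one_def Xi.fin_onb_inner)
  next
    case False
    then show ?thesis using j b by (auto simp: reflection_at_def one_tuple_def)
  qed
  then have "Op (reflection_at i e) (emb j b) = emb j (if i = j \<and> e = b then - b else b)"
    using assms linf_unitary_hops[OF reflection_at_topspace[OF i e]]
    by (subst diag_op_emb) auto
  then show ?thesis by (auto simp: emb_def)
qed

lemma rank_one_emb_linf_alg:
  assumes i: "i \<in> I" and "b \<in> hcarrier (X i)" "c \<in> hcarrier (X i)"
  shows "H.rank_one (emb i b) (emb i c) \<in> linf_alg I X"
  unfolding linf_alg_iff
proof (intro conjI ballI)
  show "H.rank_one (emb i b) (emb i c) \<in> hops \<H>" using assms by (intro H.rank_one_hops) auto
  fix j x assume j: "j \<in> I" and x: "x \<in> hcarrier \<H>"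
  interpret Xi: pre_hilbert "X i" by (rule summand[OF i])
  have eq: "H.rank_one (emb i b) (emb i c) y = emb i (hscale (X i) (hinner (X i) c (y i)) b)"
    if "y \<in> hcarrier \<H>" for y
    using that assms by (simp add: H.rank_one_def inner_emb_left emb_scale)
  show "H.rank_one (emb i b) (emb i c) (emb j (x j)) = emb j (H.rank_one (emb i b) (emb i c) x j)"
    using x j assms by (cases "j = i") (simp_all add: eq)
qed

lemma emb_onb_inner:
  assumes "i \<in> I" "b \<in> fin_onb (X i)" "j \<in> I" "c \<in> fin_onb (X j)"
  shows "hinner \<H> (emb i b) (emb j c) = (if i = j \<and> b = c then 1 else 0)"
proof -
  interpret Xi: fin_hilbert "X i" by (rule summand_fin[OF assms(1)])
  have "hinner \<H> (emb i b) (emb j c) = hinner (X i) b (emb j c i)"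
    using assms fin_hilbert.fin_onb_carrier[OF summand_fin] by (intro inner_emb_left) auto
  then show ?thesis using assms by (cases "j = i") (auto simp: Xi.fin_onb_inner)
qed

text \<open>Both vectors of \<open>|e k><f k|\<close> lie in one summand, which makes it
  block-diagonal. The reflection at \<open>e k\<close> fixes every \<open>f l\<close>: for
  \<open>l \<noteq> k\<close> the summands differ, and \<open>e k \<noteq> f k\<close>.\<close>

lemma conj_jointly_continuous_only_if:
  assumes "\<not> virtually_classical I X"
  shows "\<not> conj_jointly_continuous I X"
proof -
  obtain \<iota> :: "nat \<Rightarrow> 'i" and e f where \<iota>: "inj \<iota>" "\<And>k. \<iota> k \<in> I"
    and ef: "\<And>k. e k \<in> fin_onb (X (\<iota> k))" "\<And>k. f k \<in> fin_onb (X (\<iota> k))" "\<And>k. e k \<noteq> f k"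
    by (rule not_virtually_classicalE[OF assms]) (rule that)
  have ef': "e k \<in> hcarrier (X (\<iota> k))" "f k \<in> hcarrier (X (\<iota> k))" for k
    using ef fin_hilbert.fin_onb_carrier[OF summand_fin[OF \<iota>(2)]] by auto
  note top = reflection_at_topspace[OF \<iota>(2) ef(1)]
  show ?thesis
    unfolding conj_jointly_continuous_def
  proof (rule H.not_conj_jointly_continuousI[where a = "\<lambda>k. emb (\<iota> k) (e k)" and b = "\<lambda>k. emb (\<iota> k) (f k)"
        and ?g0.0 = one_tuple and g = "\<lambda>k. reflection_at (\<iota> k) (e k)"
        and W' = "\<lambda>k. Op (adj (reflection_at (\<iota> k) (e k)))"])
    show "\<exists>K. \<forall>k\<ge>K. reflection_at (\<iota> k) (e k) \<in> N" if "openin \<U> N" "one_tuple \<in> N" for N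
      by (rule reflections_tendsto_one[OF \<iota>(1) that top]) (simp add: reflection_at_def)
    show "(\<lambda>x. \<Sum>l\<in>S. hscale \<H> (t l) (H.rank_one (emb (\<iota> l) (e l)) (emb (\<iota> l) (f l)) x)) \<in> linf_alg I X"
      for S t by (rule linf_alg_sum) (intro rank_one_emb_linf_alg \<iota> ef')
    show "H.adj_pair (Op (adj (reflection_at (\<iota> k) (e k)))) (Op (reflection_at (\<iota> k) (e k)))" for k
      by (rule Op_adj_pair[OF top])
  qed (use \<iota> ef ef' in \<open>auto simp: emb_onb_inner reflection_at_emb one_tuple_topspace one_tuple_Op inj_eq\<close>)
qed

end

section \<open>Kernel operators on square-summable families\<close>

context pre_hilbert
begin

lemma Bessel_inequality:
  assumes A: "finite A" and r: "\<And>w. w \<in> A \<Longrightarrow> r w \<in> \<V>" and f: "f \<in> \<V>"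
    and orth: "\<And>w w'. w \<in> A \<Longrightarrow> w' \<in> A \<Longrightarrow> w \<noteq> w' \<Longrightarrow> hinner V (r w) (r w') = 0"
    and norm: "\<And>w. w \<in> A \<Longrightarrow> (hnorm V (r w))\<^sup>2 \<le> 1"
  shows "(\<Sum>w\<in>A. (cmod (hinner V (r w) f))\<^sup>2) \<le> (hnorm V f)\<^sup>2"
proof -
  define y where "y w = hinner V (r w) f" for w
  define p where "p = (\<Sum>w\<in>A. hscale V (y w) (r w))"
  define s where "s = (\<Sum>w\<in>A. (cmod (y w))\<^sup>2)"
  have p: "p \<in> \<V>" using r by (simp add: p_def)
  have yf: "y w * cnj (y w) = complex_of_real ((cmod (y w))\<^sup>2)" for w
    by (simp add: complex_norm_square del: of_real_power)
  have "hinner V f p = (\<Sum>w\<in>A. y w * cnj (y w))"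
    unfolding p_def using r f inner_cnj[OF r f]
    by (subst inner_sum_right) (auto simp: inner_scale_right y_def intro!: sum.cong)
  then have fp: "hinner V f p = complex_of_real s" by (simp add: yf s_def)
  then have pf: "hinner V p f = complex_of_real s" using inner_cnj[OF f p] by simp
  have rp: "hinner V (r w) p = y w * complex_of_real ((hnorm V (r w))\<^sup>2)" if w: "w \<in> A" for w
  proof -
    have "hinner V (r w) p = (\<Sum>w'\<in>A. y w' * hinner V (r w) (r w'))"
      unfolding p_def using r w by (simp add: inner_sum_right inner_scale_right)
    also have "\<dots> = (\<Sum>w'\<in>A. if w' = w then y w * complex_of_real ((hnorm V (r w))\<^sup>2) else 0)"
      by (rule sum.cong) (auto simp: orth[OF w] inner_self[OF r[OF w]])
    finally show ?thesis using w A by simp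
  qed
  have "hinner V p p = (\<Sum>w\<in>A. cnj (y w) * hinner V (r w) p)"
    by (subst (1) p_def, subst inner_sum_left) (use r p in \<open>auto simp: inner_scale_left\<close>)
  also have "\<dots> = (\<Sum>w\<in>A. complex_of_real ((cmod (y w))\<^sup>2 * (hnorm V (r w))\<^sup>2))"
    by (intro sum.cong refl) (simp add: rp yf[symmetric] del: of_real_power)
  finally have "(hnorm V p)\<^sup>2 = (\<Sum>w\<in>A. (cmod (y w))\<^sup>2 * (hnorm V (r w))\<^sup>2)"
    by (simp add: hnorm_sq p)
  also have "\<dots> \<le> s"
    unfolding s_def by (intro sum_mono) (use norm in \<open>simp add: mult_left_le\<close>)
  finally have "(hnorm V p)\<^sup>2 \<le> s" .
  moreover have "0 \<le> (hnorm V f)\<^sup>2 - 2 * s + (hnorm V p)\<^sup>2"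
    using inner_self_nonneg[of "f - p"] f p
    by (simp add: inner_diff_left inner_diff_right fp pf flip: hnorm_sq)
  ultimately show ?thesis by (simp add: s_def y_def)
qed

end

section \<open>Square-summable families as a Hilbert sum of complex lines\<close>

definition complex_hilb :: "complex hilb" where
  "complex_hilb = \<lparr>hcarrier = UNIV, hscale = (*), hinner = (\<lambda>x y. cnj x * y)\<rparr>"

lemma complex_hilb_simps:
  "hcarrier complex_hilb = UNIV" "hscale complex_hilb c x = c * x" "hinner complex_hilb x y = cnj x * y"
  by (simp_all add: complex_hilb_def)

lemma hnorm_complex_hilb: "hnorm complex_hilb x = cmod x"
  by (simp add: hnorm_def complex_hilb_simps cmod_def power2_eq_square)

interpretation complex_hsum: hsum_family \<Omega> "\<lambda>_. complex_hilb" for \<Omega> :: "'w set"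
proof (rule hsum_family.intro)
  show "pre_hilbert complex_hilb"
  proof
    show "Re (hinner complex_hilb x x) > 0" if "x \<noteq> 0" for x
      using that by (auto simp: complex_hilb_simps complex_neq_0 power2_eq_square)
  qed (simp_all add: complex_hilb_simps algebra_simps)
qed

lemma l2_carrier_eq: "hcarrier (l2 \<Omega>) = hcarrier (hsum \<Omega> (\<lambda>_. complex_hilb))"
  by (auto simp: l2_def hsum_def hnorm_complex_hilb complex_hilb_simps)

lemma l2_inner_eq: "hinner (l2 \<Omega>) = hinner (hsum \<Omega> (\<lambda>_. complex_hilb))"
  by (simp add: l2_def hsum_def complex_hilb_simps fun_eq_iff)

lemma l2_scale: "hscale (l2 \<Omega>) c f w = c * f w"
  by (simp add: l2_def)

lemma l2_outside: "f \<in> hcarrier (l2 \<Omega>) \<Longrightarrow> w \<notin> \<Omega> \<Longrightarrow> f w = 0"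
  by (simp add: l2_def)

text \<open>As functions the two scalings differ: that of \<open>hsum\<close> cuts off outside
  \<open>\<Omega>\<close>, that of \<open>l2\<close> does not. They meet on the carrier, whose
  elements vanish outside \<open>\<Omega>\<close>.\<close>

lemma l2_scale_eq:
  "f \<in> hcarrier (l2 \<Omega>) \<Longrightarrow> hscale (l2 \<Omega>) c f = hscale (hsum \<Omega> (\<lambda>_. complex_hilb)) c f"
  by (auto simp: l2_scale l2_outside complex_hsum.hsum_scale complex_hilb_simps)

interpretation l2: pre_hilbert "l2 \<Omega>" for \<Omega> :: "'w set"
proof
  fix c d and x y z :: "'w \<Rightarrow> complex"
  note [simp] = l2_scale_eq
  show "0 \<in> hcarrier (l2 \<Omega>)" by (simp add: l2_carrier_eq)
  assume x: "x \<in> hcarrier (l2 \<Omega>)"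
  then have x': "x \<in> hcarrier (hsum \<Omega> (\<lambda>_. complex_hilb))" by (simp add: l2_carrier_eq)
  show sx: "hscale (l2 \<Omega>) c x \<in> hcarrier (l2 \<Omega>)" for c
    using x' x by (simp add: l2_carrier_eq)
  show "hscale (l2 \<Omega>) (c + d) x = hscale (l2 \<Omega>) c x + hscale (l2 \<Omega>) d x"
    "hscale (l2 \<Omega>) c (hscale (l2 \<Omega>) d x) = hscale (l2 \<Omega>) (c * d) x" "hscale (l2 \<Omega>) 1 x = x"
    by (simp_all add: fun_eq_iff l2_scale algebra_simps del: l2_scale_eq)
  show "Re (hinner (l2 \<Omega>) x x) > 0" if "x \<noteq> 0"
    using complex_hsum.H.inner_pos[OF x' that] by (simp add: l2_inner_eq)
  assume y: "y \<in> hcarrier (l2 \<Omega>)"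
  then have y': "y \<in> hcarrier (hsum \<Omega> (\<lambda>_. complex_hilb))" by (simp add: l2_carrier_eq)
  show "x + y \<in> hcarrier (l2 \<Omega>)" using x' y' by (simp add: l2_carrier_eq)
  show "hscale (l2 \<Omega>) c (x + y) = hscale (l2 \<Omega>) c x + hscale (l2 \<Omega>) c y"
    by (simp add: fun_eq_iff l2_scale algebra_simps del: l2_scale_eq)
  show "hinner (l2 \<Omega>) y x = cnj (hinner (l2 \<Omega>) x y)"
    unfolding l2_inner_eq by (rule complex_hsum.H.inner_cnj[OF x' y'])
  show "hinner (l2 \<Omega>) x (hscale (l2 \<Omega>) c y) = c * hinner (l2 \<Omega>) x y"
    unfolding l2_inner_eq l2_scale_eq[OF y] by (rule complex_hsum.H.inner_scale_right[OF x' y'])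
  assume z: "z \<in> hcarrier (l2 \<Omega>)"
  then have z': "z \<in> hcarrier (hsum \<Omega> (\<lambda>_. complex_hilb))" by (simp add: l2_carrier_eq)
  show "hinner (l2 \<Omega>) x (y + z) = hinner (l2 \<Omega>) x y + hinner (l2 \<Omega>) x z"
    unfolding l2_inner_eq by (rule complex_hsum.H.inner_add_right[OF x' y' z'])
qed

lemma l2_norm_sq: "f \<in> hcarrier (l2 \<Omega>) \<Longrightarrow> (hnorm (l2 \<Omega>) f)\<^sup>2 = (\<Sum>\<^sub>\<infinity>w\<in>\<Omega>. (cmod (f w))\<^sup>2)"
  using complex_hsum.hsum_norm_sq[of f \<Omega>]
  by (simp add: l2_carrier_eq hnorm_complex_hilb) (simp add: hnorm_def l2_inner_eq)

lemma l2_summable: "f \<in> hcarrier (l2 \<Omega>) \<Longrightarrow> (\<lambda>w. (cmod (f w))\<^sup>2) summable_on \<Omega>"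
  by (simp add: l2_def)

lemma l2I:
  assumes "\<And>w. w \<notin> \<Omega> \<Longrightarrow> f w = 0"
    and K: "\<And>A. finite A \<Longrightarrow> A \<subseteq> \<Omega> \<Longrightarrow> (\<Sum>w\<in>A. (cmod (f w))\<^sup>2) \<le> K"
  shows "f \<in> hcarrier (l2 \<Omega>)" "(hnorm (l2 \<Omega>) f)\<^sup>2 \<le> K"
proof -
  have "(\<lambda>w. (cmod (f w))\<^sup>2) summable_on \<Omega>"
    by (rule nonneg_bdd_above_summable_on) (use K in \<open>auto intro!: bdd_aboveI2\<close>)
  then show f: "f \<in> hcarrier (l2 \<Omega>)" using assms(1) by (simp add: l2_def)
  show "(hnorm (l2 \<Omega>) f)\<^sup>2 \<le> K"
    unfolding l2_norm_sq[OF f] by (rule infsum_le_finite_sums[OF l2_summable[OF f] K])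
qed

definition delta :: "'w \<Rightarrow> 'w \<Rightarrow> complex" where
  "delta w = (\<lambda>v. if v = w then 1 else 0)"

lemma delta_eq_emb: "delta w = complex_hsum.emb w 1"
  by (auto simp: delta_def complex_hsum.emb_def)

lemma delta_closed [simp]: "w \<in> \<Omega> \<Longrightarrow> delta w \<in> hcarrier (l2 \<Omega>)"
  by (simp add: delta_eq_emb l2_carrier_eq complex_hilb_simps)

lemma inner_delta: "w \<in> \<Omega> \<Longrightarrow> f \<in> hcarrier (l2 \<Omega>) \<Longrightarrow> hinner (l2 \<Omega>) (delta w) f = f w"
  by (simp add: delta_eq_emb l2_carrier_eq l2_inner_eq complex_hsum.inner_emb_left complex_hilb_simps)

text \<open>Density of the finite combinations, without a limit: \<open>R = S - T\<close> kills each
  finite truncation \<open>p\<close> of \<open>f\<close>, so \<open>R f = R (f - p)\<close> is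
  controlled by the tail. All finite partial sums of the square norm of \<open>f\<close> then stay
  below it by the fixed gap \<open>q\<close>, which forces \<open>q \<le> 0\<close>.\<close>

lemma l2_hops_ext:
  assumes S: "S \<in> hops (l2 \<Omega>)" and T: "T \<in> hops (l2 \<Omega>)"
    and eq: "\<And>w. w \<in> \<Omega> \<Longrightarrow> S (delta w) = T (delta w)"
  shows "S = T"
proof (rule l2.hops_ext[OF S T])
  fix f assume f: "f \<in> hcarrier (l2 \<Omega>)"
  define R where "R = (\<lambda>x. S x - T x)"
  have R: "R \<in> hops (l2 \<Omega>)" unfolding R_def by (rule l2.diff_hops[OF S T])
  obtain K0 where K0: "K0 \<ge> 0" "\<And>x. x \<in> hcarrier (l2 \<Omega>) \<Longrightarrow> hnorm (l2 \<Omega>) (R x) \<le> K0 * hnorm (l2 \<Omega>) x"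
    by (rule l2.hops_bounded[OF R]) (rule that)
  \<comment> \<open>A strictly positive bound, so that dividing by its square is possible.\<close>
  define K where "K = K0 + 1"
  have K: "K > 0" using K0 by (simp add: K_def)
  define q where "q = (hnorm (l2 \<Omega>) (R f))\<^sup>2 / K\<^sup>2"
  have "(\<Sum>w\<in>A. (cmod (f w))\<^sup>2) \<le> (hnorm (l2 \<Omega>) f)\<^sup>2 - q" if A: "finite A" "A \<subseteq> \<Omega>" for A
  proof -
    define p where "p = (\<Sum>w\<in>A. hscale (l2 \<Omega>) (f w) (delta w))"
    have d: "delta w \<in> hcarrier (l2 \<Omega>)" if "w \<in> A" for w using that A by auto
    have p: "p \<in> hcarrier (l2 \<Omega>)" unfolding p_def using d by simp
    define s where "s = (\<Sum>w\<in>A. (cmod (f w))\<^sup>2)"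
    have pw: "p w = f w" if "w \<in> A" for w
    proof -
      have "p w = (\<Sum>v\<in>A. if v = w then f w else 0)"
        unfolding p_def sum_fun_apply by (rule sum.cong) (auto simp: l2_scale delta_def)
      then show ?thesis using that A by simp
    qed
    have "hinner (l2 \<Omega>) p g = (\<Sum>w\<in>A. cnj (f w) * g w)" if g: "g \<in> hcarrier (l2 \<Omega>)" for g
      unfolding p_def using d A g
      by (subst l2.inner_sum_left) (auto simp: l2.inner_scale_left inner_delta subset_iff intro!: sum.cong)
    then have "hinner (l2 \<Omega>) p f = of_real s" "hinner (l2 \<Omega>) p p = of_real s"
      using f p by (simp_all add: s_def pw complex_norm_square mult.commute del: of_real_power)
    moreover from this have "hinner (l2 \<Omega>) f p = of_real s" using l2.inner_cnj[OF p f] by simp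
    ultimately have fp: "(hnorm (l2 \<Omega>) (f - p))\<^sup>2 = (hnorm (l2 \<Omega>) f)\<^sup>2 - s"
      using f p by (simp add: l2.hnorm_sq l2.inner_diff_left l2.inner_diff_right)
    have "R (delta w) = 0" if "w \<in> A" for w using eq that A by (auto simp: R_def)
    then have "R p = 0" unfolding p_def using d R by (simp add: l2.hops_sum l2.hops_scale zero_fun_def[symmetric])
    then have "R f = R (f - p)" using f p R by (simp add: l2.hops_diff)
    then have "hnorm (l2 \<Omega>) (R f) \<le> K0 * hnorm (l2 \<Omega>) (f - p)" using K0(2)[of "f - p"] f p by simp
    also have "\<dots> \<le> K * hnorm (l2 \<Omega>) (f - p)"
      using f p by (intro mult_right_mono) (simp_all add: K_def)
    finally have "(hnorm (l2 \<Omega>) (R f))\<^sup>2 \<le> (K * hnorm (l2 \<Omega>) (f - p))\<^sup>2"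
      using R by (intro power_mono) simp_all
    then have "(hnorm (l2 \<Omega>) (R f))\<^sup>2 \<le> K\<^sup>2 * ((hnorm (l2 \<Omega>) f)\<^sup>2 - s)"
      by (simp add: power_mult_distrib fp)
    then show ?thesis using K by (simp add: q_def s_def field_simps)
  qed
  then have "(hnorm (l2 \<Omega>) f)\<^sup>2 \<le> (hnorm (l2 \<Omega>) f)\<^sup>2 - q"
    by (subst (1) l2_norm_sq[OF f]) (rule infsum_le_finite_sums[OF l2_summable[OF f]])
  then have "q \<le> 0" by simp
  then have "hnorm (l2 \<Omega>) (R f) = 0"
    using K by (simp add: q_def divide_le_0_iff)
  then have "R f = 0" using l2.hnorm_eq_0_iff[of "R f"] R by simp
  then show "S f = T f" by (simp add: R_def)
qed

text \<open>
  Row \<open>w\<close> of the kernel is supported in the finite set \<open>N w\<close>. Pairwise orthogonal rows of norm at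
  most one make the kernel operator a contraction, by Bessel's inequality.
\<close>

definition orthogonal_rows :: "'w set \<Rightarrow> ('w \<Rightarrow> 'w set) \<Rightarrow> ('w \<Rightarrow> 'w \<Rightarrow> complex) \<Rightarrow> bool" where
  "orthogonal_rows \<Omega> N k \<longleftrightarrow>
     (\<forall>w\<in>\<Omega>. finite (N w) \<and> N w \<subseteq> \<Omega>) \<and> (\<forall>w\<in>\<Omega>. \<forall>v\<in>\<Omega>. v \<notin> N w \<longrightarrow> k w v = 0) \<and>
     (\<forall>w\<in>\<Omega>. \<forall>w'\<in>\<Omega>. w \<noteq> w' \<longrightarrow> (\<Sum>v\<in>N w. k w v * cnj (k w' v)) = 0) \<and>
     (\<forall>w\<in>\<Omega>. (\<Sum>v\<in>N w. (cmod (k w v))\<^sup>2) \<le> 1)"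

definition kernel_op :: "'w set \<Rightarrow> ('w \<Rightarrow> 'w set) \<Rightarrow> ('w \<Rightarrow> 'w \<Rightarrow> complex) \<Rightarrow>
    ('w \<Rightarrow> complex) \<Rightarrow> 'w \<Rightarrow> complex" where
  "kernel_op \<Omega> N k f = (\<lambda>w. if f \<in> hcarrier (l2 \<Omega>) \<and> w \<in> \<Omega> then \<Sum>v\<in>N w. k w v * f v else 0)"

lemma kernel_op_apply:
  "f \<in> hcarrier (l2 \<Omega>) \<Longrightarrow> w \<in> \<Omega> \<Longrightarrow> kernel_op \<Omega> N k f w = (\<Sum>v\<in>N w. k w v * f v)"
  by (simp add: kernel_op_def)

lemma kernel_op_hops:
  assumes k: "orthogonal_rows \<Omega> N k"
  shows "kernel_op \<Omega> N k \<in> hops (l2 \<Omega>)"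
proof -
  have fin: "finite (N w)" "N w \<subseteq> \<Omega>" if "w \<in> \<Omega>" for w
    using k that by (auto simp: orthogonal_rows_def)
  \<comment> \<open>The conjugated row as a vector: the value of the kernel operator at
    \<open>w\<close> is the inner product with \<open>r w\<close>, and Bessel's inequality applies
    to these vectors.\<close>
  define r where "r w = (\<Sum>v\<in>N w. hscale (l2 \<Omega>) (cnj (k w v)) (delta v))" for w
  have r: "r w \<in> hcarrier (l2 \<Omega>)" if "w \<in> \<Omega>" for w
    unfolding r_def using fin[OF that] by (intro l2.sum_closed l2.scale_closed) auto
  have r_inner: "hinner (l2 \<Omega>) (r w) f = (\<Sum>v\<in>N w. k w v * f v)"
    if w: "w \<in> \<Omega>" and f: "f \<in> hcarrier (l2 \<Omega>)" for w f
    unfolding r_def using fin[OF w] f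
    by (subst l2.inner_sum_left) (auto simp: l2.inner_scale_left inner_delta subset_iff intro!: sum.cong)
  have r_apply: "r w v = cnj (k w v)" if "w \<in> \<Omega>" "v \<in> \<Omega>" for w v
  proof -
    have "r w v = (\<Sum>x\<in>N w. if x = v then cnj (k w v) else 0)"
      unfolding r_def sum_fun_apply by (rule sum.cong) (auto simp: l2_scale delta_def)
    then show ?thesis using k that fin[OF that(1)] by (auto simp: orthogonal_rows_def)
  qed
  have rr: "hinner (l2 \<Omega>) (r w) (r w') = (\<Sum>v\<in>N w. k w v * cnj (k w' v))"
    if "w \<in> \<Omega>" "w' \<in> \<Omega>" for w w'
    unfolding r_inner[OF that(1) r[OF that(2)]]
    using fin[OF that(1)] that by (intro sum.cong refl) (auto simp: r_apply)
  have rn: "(hnorm (l2 \<Omega>) (r w))\<^sup>2 \<le> 1" if w: "w \<in> \<Omega>" for w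
  proof -
    have "(hnorm (l2 \<Omega>) (r w))\<^sup>2 = Re (\<Sum>v\<in>N w. k w v * cnj (k w v))"
      unfolding l2.hnorm_sq[OF r[OF w]] rr[OF w w] ..
    also have "\<dots> = (\<Sum>v\<in>N w. (cmod (k w v))\<^sup>2)"
      by (simp add: complex_norm_square[symmetric] del: of_real_power)
    finally show ?thesis using k w by (simp add: orthogonal_rows_def)
  qed
  have bessel: "(\<Sum>w\<in>A. (cmod (kernel_op \<Omega> N k f w))\<^sup>2) \<le> (hnorm (l2 \<Omega>) f)\<^sup>2"
    if f: "f \<in> hcarrier (l2 \<Omega>)" and A: "finite A" "A \<subseteq> \<Omega>" for f A
  proof -
    have "(\<Sum>w\<in>A. (cmod (kernel_op \<Omega> N k f w))\<^sup>2) = (\<Sum>w\<in>A. (cmod (hinner (l2 \<Omega>) (r w) f))\<^sup>2)"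
      using A f by (intro sum.cong refl) (auto simp: kernel_op_apply r_inner subset_iff)
    also have "\<dots> \<le> (hnorm (l2 \<Omega>) f)\<^sup>2"
    proof (rule l2.Bessel_inequality[OF A(1) _ f])
      show "hinner (l2 \<Omega>) (r w) (r w') = 0" if "w \<in> A" "w' \<in> A" "w \<noteq> w'" for w w'
        using that A k rr[of w w'] by (auto simp: orthogonal_rows_def subset_iff)
    qed (use A r rn in auto)
    finally show ?thesis .
  qed
  have out: "kernel_op \<Omega> N k f w = 0" if "w \<notin> \<Omega>" for f w using that by (simp add: kernel_op_def)
  show ?thesis
  proof (rule l2.hopsI[where K = 1])
    fix f assume f: "f \<in> hcarrier (l2 \<Omega>)"
    show cl: "kernel_op \<Omega> N k f \<in> hcarrier (l2 \<Omega>)" by (rule l2I(1)[OF out bessel[OF f]])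
    show "hnorm (l2 \<Omega>) (kernel_op \<Omega> N k f) \<le> 1 * hnorm (l2 \<Omega>) f"
      using power2_le_imp_le[OF l2I(2)[OF out bessel[OF f]] l2.hnorm_nonneg[OF f]] by simp
    show "kernel_op \<Omega> N k (hscale (l2 \<Omega>) c f) = hscale (l2 \<Omega>) c (kernel_op \<Omega> N k f)" for c
      using f l2.scale_closed[OF f, of c]
      by (auto simp: kernel_op_def l2_scale sum_distrib_left mult_ac fun_eq_iff)
    fix g assume g: "g \<in> hcarrier (l2 \<Omega>)"
    show "kernel_op \<Omega> N k (f + g) = kernel_op \<Omega> N k f + kernel_op \<Omega> N k g"
      using f g l2.add_closed[OF f g]
      by (auto simp: kernel_op_def fun_eq_iff algebra_simps sum.distrib)
  qed (auto simp: kernel_op_def)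
qed

lemma kernel_op_delta:
  assumes k: "orthogonal_rows \<Omega> N k" and "v \<in> \<Omega>" "w \<in> \<Omega>"
  shows "kernel_op \<Omega> N k (delta v) w = k w v"
proof -
  have "kernel_op \<Omega> N k (delta v) w = (\<Sum>x\<in>N w. if x = v then k w v else 0)"
    unfolding kernel_op_apply[OF delta_closed[OF assms(2)] assms(3)]
    by (rule sum.cong) (auto simp: delta_def)
  then show ?thesis using assms by (auto simp: orthogonal_rows_def)
qed

text \<open>Orthogonal rows of both kernels, that is, orthogonal rows and columns of
  \<open>k\<close>, make both operators bounded. The adjoint relation is then a finite computation
  on each \<open>delta v\<close> and extends by boundedness.\<close>

lemma kernel_op_adj_pair:
  assumes k: "orthogonal_rows \<Omega> N k" and k': "orthogonal_rows \<Omega> N k'"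
    and adj: "\<And>v w. v \<in> \<Omega> \<Longrightarrow> w \<in> \<Omega> \<Longrightarrow> k' v w = cnj (k w v)"
  shows "l2.adj_pair \<Omega> (kernel_op \<Omega> N k') (kernel_op \<Omega> N k)"
  unfolding l2.adj_pair_def
proof (intro conjI ballI kernel_op_hops k k')
  fix f g assume f: "f \<in> hcarrier (l2 \<Omega>)" and g: "g \<in> hcarrier (l2 \<Omega>)"
  let ?K = "kernel_op \<Omega> N k" and ?K' = "kernel_op \<Omega> N k'"
  note hops = kernel_op_hops[OF k] kernel_op_hops[OF k']
  note cl = l2.hops_closed[OF hops(1)] l2.hops_closed[OF hops(2)]
  have delta: "hinner (l2 \<Omega>) (?K' f) (delta v) = hinner (l2 \<Omega>) f (?K (delta v))" if v: "v \<in> \<Omega>" for v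
  proof -
    have Nv: "finite (N v)" "N v \<subseteq> \<Omega>" using k v by (auto simp: orthogonal_rows_def)
    have "?K (delta v) = (\<Sum>w\<in>N v. hscale (l2 \<Omega>) (k w v) (delta w))" (is "_ = ?s")
    proof
      fix w
      have s: "?s w = (\<Sum>x\<in>N v. if x = w then k w v else 0)"
        unfolding sum_fun_apply by (rule sum.cong) (auto simp: l2_scale delta_def)
      show "?K (delta v) w = ?s w"
      proof (cases "w \<in> \<Omega>")
        case True
        \<comment> \<open>The support condition concerns rows; for column \<open>v\<close> of
          \<open>k\<close> it comes from row \<open>v\<close> of \<open>k'\<close>.\<close>
        have "w \<notin> N v \<Longrightarrow> k w v = 0"
          using k' v True adj[OF v True] by (auto simp: orthogonal_rows_def)
        then show ?thesis using Nv v True k by (auto simp: s kernel_op_delta)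
      next
        case False
        then show ?thesis using Nv by (auto simp: s kernel_op_def)
      qed
    qed
    then have "hinner (l2 \<Omega>) f (?K (delta v)) = (\<Sum>w\<in>N v. k w v * hinner (l2 \<Omega>) f (delta w))"
      using Nv f by (simp add: l2.inner_sum_right l2.inner_scale_right subset_iff)
    also have "\<dots> = (\<Sum>w\<in>N v. cnj (k' v w * f w))"
    proof (intro sum.cong refl)
      fix w assume "w \<in> N v"
      then have w: "w \<in> \<Omega>" using Nv by auto
      show "k w v * hinner (l2 \<Omega>) f (delta w) = cnj (k' v w * f w)"
        using l2.inner_cnj[OF delta_closed[OF w] f] f w by (simp add: inner_delta adj[OF v w])
    qed
    also have "\<dots> = cnj (?K' f v)" using f v by (simp add: kernel_op_apply)
    also have "\<dots> = hinner (l2 \<Omega>) (?K' f) (delta v)"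
      using l2.inner_cnj[OF delta_closed[OF v] cl(2)[of f]] v cl(2) by (simp add: inner_delta)
    finally show ?thesis by simp
  qed
  show "hinner (l2 \<Omega>) (?K' f) g = hinner (l2 \<Omega>) f (?K g)"
  proof (cases "\<Omega> = {}")
    case True
    then show ?thesis by (simp add: l2_def)
  next
    case False
    then obtain u where u: "u \<in> \<Omega>" by blast
    \<comment> \<open>\<open>l2_hops_ext\<close> compares operators. The two functionals of
      \<open>g\<close> are therefore made into operators with values on the line through
      \<open>delta u\<close>, which takes some \<open>u \<in> \<Omega>\<close> and sets the empty
      case apart.\<close>
    have "l2.rank_one \<Omega> (delta u) (?K' f) = l2.rank_one \<Omega> (delta u) f \<circ> ?K"
    proof (rule l2_hops_ext)
      show "l2.rank_one \<Omega> (delta u) (?K' f) \<in> hops (l2 \<Omega>)" using u cl by simp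
      show "l2.rank_one \<Omega> (delta u) f \<circ> ?K \<in> hops (l2 \<Omega>)" using u f hops by simp
    qed (use cl in \<open>simp add: l2.rank_one_def delta\<close>)
    from fun_cong[OF this, of g]
    have "hscale (l2 \<Omega>) (hinner (l2 \<Omega>) (?K' f) g) (delta u) u =
      hscale (l2 \<Omega>) (hinner (l2 \<Omega>) f (?K g)) (delta u) u"
      using g cl by (simp add: l2.rank_one_def)
    then show ?thesis by (simp add: l2_scale delta_def)
  qed
qed

section \<open>Tensor products of kernels\<close>

definition list_nbhd :: "('a \<Rightarrow> 'b set) \<Rightarrow> 'a list \<Rightarrow> 'b list set" where
  "list_nbhd N es = {fs. length fs = length es \<and> (\<forall>j<length es. fs ! j \<in> N (es ! j))}"

lemma list_nbhd_Nil: "list_nbhd N [] = {[]}"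
  by (auto simp: list_nbhd_def)

lemma list_nbhd_Cons: "list_nbhd N (e # es) = (\<lambda>(x, fs). x # fs) ` (N e \<times> list_nbhd N es)"
proof (intro set_eqI iffI)
  fix fs assume "fs \<in> list_nbhd N (e # es)"
  then show "fs \<in> (\<lambda>(x, fs). x # fs) ` (N e \<times> list_nbhd N es)"
    by (cases fs) (force simp: list_nbhd_def)+
next
  fix fs assume "fs \<in> (\<lambda>(x, fs). x # fs) ` (N e \<times> list_nbhd N es)"
  then show "fs \<in> list_nbhd N (e # es)"
    by (auto simp: list_nbhd_def nth_Cons split: nat.split)
qed

lemma finite_list_nbhd: "(\<And>e. e \<in> set es \<Longrightarrow> finite (N e)) \<Longrightarrow> finite (list_nbhd N es)"
  by (induction es) (auto simp: list_nbhd_Nil list_nbhd_Cons)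

text \<open>The distributive law for a product of finite sums. It reduces identities between rows of
  a tensor kernel to identities in each factor.\<close>

lemma sum_list_nbhd_prod:
  fixes g :: "nat \<Rightarrow> 'b \<Rightarrow> 'c::comm_semiring_1"
  assumes "\<And>e. e \<in> set es \<Longrightarrow> finite (N e)"
  shows "(\<Sum>fs\<in>list_nbhd N es. \<Prod>j<length es. g j (fs ! j)) = (\<Prod>j<length es. \<Sum>x\<in>N (es ! j). g j x)"
  using assms
proof (induction es arbitrary: g)
  case Nil
  then show ?case by (simp add: list_nbhd_Nil)
next
  case (Cons e es)
  have "(\<Sum>fs\<in>list_nbhd N (e # es). \<Prod>j<length (e # es). g j (fs ! j)) =
     (\<Sum>(x, fs)\<in>N e \<times> list_nbhd N es. g 0 x * (\<Prod>j<length es. g (Suc j) (fs ! j)))"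
    unfolding list_nbhd_Cons
    by (subst sum.reindex) (auto simp: inj_on_def prod.lessThan_Suc_shift simp del: prod.lessThan_Suc
        intro!: sum.cong)
  also have "\<dots> = (\<Sum>x\<in>N e. g 0 x) * (\<Sum>fs\<in>list_nbhd N es. \<Prod>j<length es. g (Suc j) (fs ! j))"
    by (simp add: sum_product sum.cartesian_product)
  also have "\<dots> = (\<Sum>x\<in>N e. g 0 x) * (\<Prod>j<length es. \<Sum>x\<in>N (es ! j). g (Suc j) x)"
    using Cons.prems by (subst Cons.IH) auto
  also have "\<dots> = (\<Prod>j<length (e # es). \<Sum>x\<in>N ((e # es) ! j). g j x)"
    by (simp add: prod.lessThan_Suc_shift del: prod.lessThan_Suc)
  finally show ?case .
qed

definition tuples :: "'a set \<Rightarrow> nat \<Rightarrow> 'a list set" where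
  "tuples E n = {es. length es = n \<and> set es \<subseteq> E}"

lemma tuples_nth: "es \<in> tuples E n \<Longrightarrow> j < n \<Longrightarrow> es ! j \<in> E"
  by (auto simp: tuples_def)

lemma tuples_length: "es \<in> tuples E n \<Longrightarrow> length es = n"
  by (simp add: tuples_def)

text \<open>Only the length of \<open>es\<close> matters on the right; this form lets
  \<open>sum_list_nbhd_prod\<close> expand over all tuples.\<close>

lemma tuples_eq_list_nbhd: "length es = n \<Longrightarrow> tuples E n = list_nbhd (\<lambda>_. E) es"
  by (fastforce simp: tuples_def list_nbhd_def in_set_conv_nth)

definition tensor_kernel :: "(nat \<Rightarrow> 'a \<Rightarrow> 'a \<Rightarrow> complex) \<Rightarrow> 'a list \<Rightarrow> 'a list \<Rightarrow> complex" where
  "tensor_kernel m es fs = (\<Prod>j<length es. m j (es ! j) (fs ! j))"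

text \<open>Inner products of rows are products over the factors. Distinct lists differ in some
  position, and the factor there is 0; the square norms multiply to at most 1.\<close>

lemma orthogonal_rows_tensor:
  assumes m: "\<And>j. j < n \<Longrightarrow> orthogonal_rows E N (m j)"
    and N: "\<And>e. e \<in> E \<Longrightarrow> finite (N e) \<and> N e \<subseteq> E"
  shows "orthogonal_rows (tuples E n) (list_nbhd N) (tensor_kernel m)"
  unfolding orthogonal_rows_def
proof (intro conjI ballI impI)
  fix es assume es: "es \<in> tuples E n"
  note len = tuples_length[OF es]
  have finN: "finite (N e)" if "e \<in> set es" for e using that es N by (auto simp: tuples_def)
  show "finite (list_nbhd N es)" using finN by (rule finite_list_nbhd)
  show "list_nbhd N es \<subseteq> tuples E n"
  proof
    fix fs assume fs: "fs \<in> list_nbhd N es"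
    then have "fs ! j \<in> E" if "j < n" for j
      using that N[OF tuples_nth[OF es that]] len by (auto simp: list_nbhd_def)
    then show "fs \<in> tuples E n" using fs len by (auto simp: list_nbhd_def tuples_def in_set_conv_nth)
  qed
  have "(\<Sum>fs\<in>list_nbhd N es. (cmod (tensor_kernel m es fs))\<^sup>2) =
     (\<Prod>j<length es. \<Sum>x\<in>N (es ! j). (cmod (m j (es ! j) x))\<^sup>2)"
    by (subst sum_list_nbhd_prod[symmetric, OF finN])
      (auto simp: tensor_kernel_def prod_norm[symmetric] prod_power_distrib)
  also have "\<dots> \<le> 1"
    using m tuples_nth[OF es] len by (intro prod_le_1) (auto simp: orthogonal_rows_def intro: sum_nonneg)
  finally show "(\<Sum>fs\<in>list_nbhd N es. (cmod (tensor_kernel m es fs))\<^sup>2) \<le> 1" .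
  fix fs assume fs: "fs \<in> tuples E n"
  show "tensor_kernel m es fs = 0" if "fs \<notin> list_nbhd N es"
  proof -
    have "\<not> (\<forall>j<n. fs ! j \<in> N (es ! j))"
      using that len tuples_length[OF fs] by (simp add: list_nbhd_def)
    then obtain j where j: "j < n" "fs ! j \<notin> N (es ! j)" by blast
    then have "m j (es ! j) (fs ! j) = 0"
      using m[OF j(1)] tuples_nth[OF es j(1)] tuples_nth[OF fs j(1)] by (auto simp: orthogonal_rows_def)
    then show ?thesis using j len by (auto simp: tensor_kernel_def)
  qed
  show "(\<Sum>v\<in>list_nbhd N es. tensor_kernel m es v * cnj (tensor_kernel m fs v)) = 0" if ne: "es \<noteq> fs"
  proof -
    obtain j where j: "j < n" "es ! j \<noteq> fs ! j"
      using ne len tuples_length[OF fs] by (metis nth_equalityI)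
    have "(\<Sum>v\<in>list_nbhd N es. tensor_kernel m es v * cnj (tensor_kernel m fs v)) =
       (\<Prod>j<length es. \<Sum>x\<in>N (es ! j). m j (es ! j) x * cnj (m j (fs ! j) x))"
      using len tuples_length[OF fs]
      by (subst sum_list_nbhd_prod[symmetric, OF finN]) (auto simp: tensor_kernel_def prod.distrib)
    also have "\<dots> = 0"
      using m[OF j(1)] tuples_nth[OF es j(1)] tuples_nth[OF fs j(1)] j len
      by (intro prod_zero bexI[of _ j]) (auto simp: orthogonal_rows_def)
    finally show ?thesis .
  qed
qed

lemma tensor_kernel_adj:
  assumes "es \<in> tuples E n" "fs \<in> tuples E n"
    and "\<And>j e f. j < n \<Longrightarrow> e \<in> E \<Longrightarrow> f \<in> E \<Longrightarrow> m' j e f = cnj (m j f e)"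
  shows "tensor_kernel m' es fs = cnj (tensor_kernel m fs es)"
  using assms by (auto simp: tensor_kernel_def tuples_length tuples_nth intro!: prod.cong)

lemma kernel_op_diagonal:
  assumes N: "\<And>e. e \<in> E \<Longrightarrow> finite (N e) \<and> N e \<subseteq> E \<and> e \<in> N e"
    and diag: "\<And>j e f. j < n \<Longrightarrow> e \<in> E \<Longrightarrow> f \<in> E \<Longrightarrow> e \<noteq> f \<Longrightarrow> m j e f = 0"
    and f: "f \<in> hcarrier (l2 (tuples E n))" and es: "es \<in> tuples E n"
  shows "kernel_op (tuples E n) (list_nbhd N) (tensor_kernel m) f es = tensor_kernel m es es * f es"
proof -
  note len = tuples_length[OF es]
  have finN: "finite (N e)" if "e \<in> set es" for e using that es N by (auto simp: tuples_def)
  have "kernel_op (tuples E n) (list_nbhd N) (tensor_kernel m) f es =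
      (\<Sum>fs\<in>list_nbhd N es. if fs = es then tensor_kernel m es es * f es else 0)"
    unfolding kernel_op_apply[OF f es]
  proof (intro sum.cong refl)
    fix fs assume fs: "fs \<in> list_nbhd N es"
    show "tensor_kernel m es fs * f fs = (if fs = es then tensor_kernel m es es * f es else 0)"
    proof (cases "fs = es")
      case False
      then obtain j where j: "j < n" "es ! j \<noteq> fs ! j"
        using fs len by (metis (mono_tags, lifting) list_nbhd_def mem_Collect_eq nth_equalityI)
      then have "fs ! j \<in> E" using fs N[OF tuples_nth[OF es j(1)]] len by (auto simp: list_nbhd_def)
      then have "m j (es ! j) (fs ! j) = 0" using diag j tuples_nth[OF es j(1)] by blast
      then have "tensor_kernel m es fs = 0" using j len by (auto simp: tensor_kernel_def)
      then show ?thesis using False by simp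
    qed simp
  qed
  also have "\<dots> = tensor_kernel m es es * f es"
  proof -
    have "es \<in> list_nbhd N es" using N tuples_nth[OF es] len by (auto simp: list_nbhd_def)
    then show ?thesis using finite_list_nbhd[of es N] finN by simp
  qed
  finally show ?thesis .
qed

text \<open>With at most one nonzero entry in each row and column, products of distinct rows vanish
  and a row norm is a single entry. This covers matrix units and coordinate projections, including
  their zero rows.\<close>

lemma orthogonal_rows_monomial:
  assumes N: "\<And>e. e \<in> E \<Longrightarrow> finite (N e) \<and> N e \<subseteq> E"
    and supp: "\<And>e v. e \<in> E \<Longrightarrow> v \<in> E \<Longrightarrow> k e v \<noteq> 0 \<Longrightarrow> v \<in> N e"
    and le: "\<And>e v. cmod (k e v) \<le> 1"
    and row: "\<And>e v v'. k e v \<noteq> 0 \<Longrightarrow> k e v' \<noteq> 0 \<Longrightarrow> v = v'"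
    and col: "\<And>e e' v. k e v \<noteq> 0 \<Longrightarrow> k e' v \<noteq> 0 \<Longrightarrow> e = e'"
  shows "orthogonal_rows E N k"
  unfolding orthogonal_rows_def
proof (intro conjI ballI impI)
  fix e assume e: "e \<in> E"
  show "finite (N e)" "N e \<subseteq> E" using N[OF e] by auto
  show "k e v = 0" if "v \<in> E" "v \<notin> N e" for v using supp[OF e that(1)] that(2) by blast
  show "(\<Sum>v\<in>N e. k e v * cnj (k e' v)) = 0" if "e \<noteq> e'" for e'
    using col that by (intro sum.neutral) auto
  show "(\<Sum>v\<in>N e. (cmod (k e v))\<^sup>2) \<le> 1"
  proof (cases "\<exists>v\<in>N e. k e v \<noteq> 0")
    case True
    then obtain v where v: "v \<in> N e" "k e v \<noteq> 0" by blast
    have "(\<Sum>x\<in>N e. (cmod (k e x))\<^sup>2) = (\<Sum>x\<in>N e. if x = v then (cmod (k e v))\<^sup>2 else 0)"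
      using row[OF v(2)] by (intro sum.cong) auto
    also have "\<dots> = (cmod (k e v))\<^sup>2" using v N[OF e] by simp
    also have "\<dots> \<le> 1" using le[of e v] by (simp add: abs_square_le_1)
    finally show ?thesis .
  qed simp
qed

context q_set
begin

section \<open>Tensor powers\<close>

abbreviation \<E> where "\<E> \<equiv> hsum_onb I X"

lemma onb_eq: "\<E> = {emb i b | i b. i \<in> I \<and> b \<in> fin_onb (X i)}"
  unfolding hsum_onb_def emb_def ..

lemma emb_onb: "i \<in> I \<Longrightarrow> b \<in> fin_onb (X i) \<Longrightarrow> emb i b \<in> \<E>"
  by (auto simp: onb_eq)

lemma onb_carrier: "b \<in> fin_onb (X i) \<Longrightarrow> i \<in> I \<Longrightarrow> b \<in> hcarrier (X i)"
  using fin_hilbert.fin_onb_carrier[OF summand_fin] by blast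

lemma onb_nonzero: "b \<in> fin_onb (X i) \<Longrightarrow> i \<in> I \<Longrightarrow> b \<noteq> 0"
  using fin_hilbert.zero_notin_fin_onb[OF summand_fin] by blast

lemma onb_closed: "e \<in> \<E> \<Longrightarrow> e \<in> hcarrier \<H>"
  by (auto simp: onb_eq onb_carrier)

lemma emb_eq_iff: "b \<noteq> 0 \<Longrightarrow> emb i b = emb j c \<longleftrightarrow> i = j \<and> b = c"
  by (metis emb_other emb_same)

lemma onb_inner:
  assumes "e \<in> \<E>" "f \<in> \<E>"
  shows "hinner \<H> e f = (if e = f then 1 else 0)"
  using assms by (auto simp: onb_eq emb_onb_inner emb_eq_iff onb_nonzero)

text \<open>For a basis vector \<open>e\<close>, the basis vectors of the same summand; a common
  nonzero coordinate detects this without naming the index.\<close>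

definition block :: "('i \<Rightarrow> 'v) \<Rightarrow> ('i \<Rightarrow> 'v) set" where
  "block e = {f \<in> \<E>. \<exists>i. e i \<noteq> 0 \<and> f i \<noteq> 0}"

lemma block_emb:
  assumes "i \<in> I" "b \<in> fin_onb (X i)"
  shows "block (emb i b) = emb i ` fin_onb (X i)"
proof (intro set_eqI iffI)
  fix f assume "f \<in> block (emb i b)"
  then obtain k j c where k: "emb i b k \<noteq> 0" "f k \<noteq> 0"
    and j: "f = emb j c" "j \<in> I" "c \<in> fin_onb (X j)"
    unfolding block_def onb_eq by blast
  have "k = i" using k(1) emb_other by metis
  moreover have "k = j" using k(2) j(1) emb_other by metis
  ultimately show "f \<in> emb i ` fin_onb (X i)" using j by blast
next
  fix f assume "f \<in> emb i ` fin_onb (X i)"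
  then show "f \<in> block (emb i b)"
    using assms by (auto simp: block_def onb_eq onb_nonzero intro!: exI[of _ i])
qed

lemma block_finite_subset: "e \<in> \<E> \<Longrightarrow> finite (block e) \<and> block e \<subseteq> \<E> \<and> e \<in> block e"
  using fin_hilbert.finite_fin_onb[OF summand_fin] by (auto simp: onb_eq block_emb) blast

lemma block_sym: "e \<in> \<E> \<Longrightarrow> f \<in> block e \<Longrightarrow> e \<in> block f"
  by (auto simp: block_def)

definition mat :: "(('i \<Rightarrow> 'v) \<Rightarrow> 'i \<Rightarrow> 'v) \<Rightarrow> ('i \<Rightarrow> 'v) \<Rightarrow> ('i \<Rightarrow> 'v) \<Rightarrow> complex" where
  "mat T e f = hinner \<H> e (T f)"

lemma mat_diag_op:
  assumes a: "\<And>i. i \<in> I \<Longrightarrow> a i \<in> hops (X i)"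
    and "i \<in> I" "b \<in> fin_onb (X i)" "j \<in> I" "c \<in> fin_onb (X j)"
  shows "mat (Op a) (emb i b) (emb j c) = (if i = j then hinner (X i) b (a i c) else 0)"
proof -
  interpret Xi: fin_hilbert "X i" by (rule summand_fin[OF assms(2)])
  have "a j c \<in> hcarrier (X j)" using pre_hilbert.hops_closed[OF summand[OF assms(4)] a[OF assms(4)]] .
  then have "mat (Op a) (emb i b) (emb j c) = hinner (X i) b (emb j (a j c) i)"
    using assms by (simp add: mat_def diag_op_emb onb_carrier inner_emb_left)
  then show ?thesis using assms by (cases "i = j") auto
qed

lemma mat_outside_block:
  assumes T: "T \<in> linf_alg I X" and "e \<in> \<E>" "f \<in> \<E>" "f \<notin> block e"
  shows "mat T e f = 0"
proof -
  obtain a where "a \<in> linf I X" "T = Op a" using T by (auto simp: linf_alg_def)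
  moreover from this have "a i \<in> hops (X i)" if "i \<in> I" for i using that by (auto simp: linf_def)
  ultimately show ?thesis using assms by (auto simp: onb_eq block_emb mat_diag_op)
qed

text \<open>The operator preserves each summand, so its rows are supported in finite blocks and no
  question of convergence arises.\<close>

lemma mat_expand:
  assumes T: "T \<in> linf_alg I X" and e: "e \<in> \<E>" and x: "x \<in> hcarrier \<H>"
  shows "hinner \<H> e (T x) = (\<Sum>f\<in>block e. mat T e f * hinner \<H> f x)"
proof -
  obtain a where a: "a \<in> linf I X" "T = Op a" using T by (auto simp: linf_alg_def)
  have ah: "a i \<in> hops (X i)" if "i \<in> I" for i using a that by (auto simp: linf_def)
  obtain i b where ib: "e = emb i b" "i \<in> I" "b \<in> fin_onb (X i)" using e by (auto simp: onb_eq)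
  interpret Xi: fin_hilbert "X i" by (rule summand_fin[OF ib(2)])
  have xi: "x i \<in> hcarrier (X i)" using x ib by simp
  have "T x \<in> hcarrier \<H>" using T linf_alg_hops H.hops_closed by blast
  then have "hinner \<H> e (T x) = hinner (X i) b (a i (x i))"
    using ib a x by (simp add: inner_emb_left diag_op_apply)
  also have "\<dots> = hinner (X i) b (a i (\<Sum>c\<in>fin_onb (X i). hscale (X i) (hinner (X i) c (x i)) c))"
    using Xi.fin_onb_expand[OF xi] by simp
  also have "\<dots> = (\<Sum>c\<in>fin_onb (X i). hinner (X i) b (a i c) * hinner (X i) c (x i))"
    using ib ah[OF ib(2)] by (simp add: Xi.hops_sum Xi.hops_scale Xi.inner_sum_right Xi.inner_scale_right
        mult.commute)
  also have "\<dots> = (\<Sum>c\<in>fin_onb (X i). mat T e (emb i c) * hinner \<H> (emb i c) x)"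
    using ib ah x by (intro sum.cong refl) (simp add: a(2) mat_diag_op inner_emb_left)
  also have "\<dots> = (\<Sum>f\<in>block e. mat T e f * hinner \<H> f x)"
    unfolding ib(1) block_emb[OF ib(2,3)]
    by (subst sum.reindex) (auto simp: inj_on_def emb_eq_iff onb_nonzero ib)
  finally show ?thesis .
qed

lemma mat_unitary_rows:
  assumes u: "u \<in> topspace \<U>" and "e \<in> \<E>" "e' \<in> \<E>"
  shows "(\<Sum>f\<in>block e. mat (Op u) e f * cnj (mat (Op u) e' f)) = (if e = e' then 1 else 0)"
proof -
  obtain i b where ib: "e = emb i b" "i \<in> I" "b \<in> fin_onb (X i)" using assms by (auto simp: onb_eq)
  obtain j b' where jb: "e' = emb j b'" "j \<in> I" "b' \<in> fin_onb (X j)" using assms by (auto simp: onb_eq)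
  interpret Xi: fin_hilbert "X i" by (rule summand_fin[OF ib(2)])
  note uh = linf_unitary_hops[OF u]
  have "(\<Sum>f\<in>block e. mat (Op u) e f * cnj (mat (Op u) e' f)) =
     (\<Sum>c\<in>fin_onb (X i). mat (Op u) e (emb i c) * cnj (mat (Op u) e' (emb i c)))"
    unfolding ib(1) block_emb[OF ib(2,3)]
    by (subst sum.reindex) (auto simp: inj_on_def emb_eq_iff onb_nonzero ib)
  also have "\<dots> = (if e = e' then 1 else 0)"
  proof (cases "i = j")
    case True
    have "(\<Sum>c\<in>fin_onb (X i). mat (Op u) e (emb i c) * cnj (mat (Op u) e' (emb i c))) =
       (\<Sum>c\<in>fin_onb (X i). hinner (X i) b (u i c) * cnj (hinner (X i) b' (u i c)))"
      using ib jb True uh by (intro sum.cong refl) (simp add: mat_diag_op)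
    then show ?thesis
      using Xi.unitary_rows[OF linf_unitaryD[OF u ib(2)] ib(3), of b'] ib jb True
      by (simp add: emb_eq_iff onb_nonzero)
  next
    case False
    then show ?thesis using ib jb uh by (simp add: mat_diag_op emb_eq_iff onb_nonzero)
  qed
  finally show ?thesis .
qed

lemma orthogonal_rows_mat:
  assumes u: "u \<in> topspace \<U>"
  shows "orthogonal_rows \<E> block (mat (Op u))"
  unfolding orthogonal_rows_def
proof (intro conjI ballI impI)
  fix e assume e: "e \<in> \<E>"
  show "finite (block e)" "block e \<subseteq> \<E>" using block_finite_subset[OF e] by auto
  show "mat (Op u) e f = 0" if "f \<in> \<E>" "f \<notin> block e" for f
    using mat_outside_block[OF Op_linf_alg[OF u] e that] .
  show "(\<Sum>f\<in>block e. mat (Op u) e f * cnj (mat (Op u) e' f)) = 0" if "e' \<in> \<E>" "e \<noteq> e'" for e'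
    using mat_unitary_rows[OF u e that(1)] that(2) by simp
  have "complex_of_real (\<Sum>f\<in>block e. (cmod (mat (Op u) e f))\<^sup>2) = 1"
    using mat_unitary_rows[OF u e e] by (simp add: complex_norm_square del: of_real_power)
  then have "(\<Sum>f\<in>block e. (cmod (mat (Op u) e f))\<^sup>2) = 1" by (simp only: of_real_eq_1_iff)
  then show "(\<Sum>f\<in>block e. (cmod (mat (Op u) e f))\<^sup>2) \<le> 1" by simp
qed

lemma mat_adj:
  assumes u: "u \<in> topspace \<U>" and "e \<in> \<E>" "f \<in> \<E>"
  shows "mat (Op (adj u)) e f = cnj (mat (Op u) f e)"
  unfolding mat_def
  using H.adj_pairD(3)[OF H.adj_pair_sym[OF Op_adj_pair[OF u]], of e f]
    H.inner_cnj[of f "Op u e"] assms onb_closed H.hops_closed[OF Op_hops[OF u]] by simp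

section \<open>Tensor operators in coordinates\<close>

abbreviation Tup where "Tup n \<equiv> tuples \<E> n"
abbreviation L where "L n \<equiv> l2 (Tup n)"

lemma tensor_power_eq: "tensor_power \<E> n = L n"
  by (simp add: tensor_power_def tuples_def)

lemma elem_tensor_apply:
  "length xs = n \<Longrightarrow> es \<in> Tup n \<Longrightarrow> elem_tensor \<H> \<E> xs es = (\<Prod>j<n. hinner \<H> (es ! j) (xs ! j))"
  by (simp add: elem_tensor_def tuples_def)

lemma elem_tensor_outside: "length xs = n \<Longrightarrow> es \<notin> Tup n \<Longrightarrow> elem_tensor \<H> \<E> xs es = 0"
  by (auto simp: elem_tensor_def tuples_def)

lemma prod_delta_tuples:
  assumes "es \<in> tuples E n" "fs \<in> tuples E n"
  shows "(\<Prod>j<n. if es ! j = fs ! j then 1 else 0 :: complex) = (if es = fs then 1 else 0)"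
proof (cases "es = fs")
  case False
  then have "\<exists>j<n. es ! j \<noteq> fs ! j" using assms by (metis nth_equalityI tuples_length)
  then show ?thesis using False by auto
qed simp

lemma elem_tensor_onb:
  assumes fs: "fs \<in> Tup n"
  shows "elem_tensor \<H> \<E> fs = delta fs"
proof
  fix es
  show "elem_tensor \<H> \<E> fs es = delta fs es"
  proof (cases "es \<in> Tup n")
    case True
    have "elem_tensor \<H> \<E> fs es = (\<Prod>j<n. if es ! j = fs ! j then 1 else 0)"
      unfolding elem_tensor_apply[OF tuples_length[OF fs] True]
      using tuples_nth[OF fs] tuples_nth[OF True] by (intro prod.cong refl) (auto simp: onb_inner)
    then show ?thesis using prod_delta_tuples[OF True fs] by (simp add: delta_def)
  next
    case False
    then show ?thesis using fs elem_tensor_outside[OF tuples_length[OF fs] False] by (auto simp: delta_def)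
  qed
qed

text \<open>A finite set of tuples is enlarged to all tuples over the finite set \<open>B\<close> of
  its entries. There the sum factors, and Bessel's inequality bounds each factor by the square norm
  of one entry of \<open>xs\<close>.\<close>

lemma elem_tensor_closed:
  assumes xs: "length xs = n" "set xs \<subseteq> hcarrier \<H>"
  shows "elem_tensor \<H> \<E> xs \<in> hcarrier (L n)"
proof (rule l2I(1))
  show "elem_tensor \<H> \<E> xs es = 0" if "es \<notin> Tup n" for es using elem_tensor_outside[OF xs(1) that] .
  fix A assume A: "finite A" "A \<subseteq> Tup n"
  define B where "B = (\<Union>es\<in>A. set es)"
  have B: "finite B" "B \<subseteq> \<E>" using A by (auto simp: B_def tuples_def)
  have xj: "xs ! j \<in> hcarrier \<H>" if "j < n" for j using xs that by auto
  have "es \<in> list_nbhd (\<lambda>_. B) xs" if es: "es \<in> A" for es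
  proof -
    have "length es = length xs" using A xs es by (auto simp: tuples_def)
    moreover have "es ! j \<in> B" if "j < length es" for j
      using nth_mem[OF that] es by (auto simp: B_def)
    ultimately show ?thesis by (simp add: list_nbhd_def)
  qed
  then have AB: "A \<subseteq> list_nbhd (\<lambda>_. B) xs" by blast
  have "(\<Sum>es\<in>A. (cmod (elem_tensor \<H> \<E> xs es))\<^sup>2) =
      (\<Sum>es\<in>A. \<Prod>j<length xs. (cmod (hinner \<H> (es ! j) (xs ! j)))\<^sup>2)"
    using A xs by (intro sum.cong refl)
      (auto simp: elem_tensor_apply subset_iff prod_norm[symmetric] prod_power_distrib)
  also have "\<dots> \<le> (\<Sum>es\<in>list_nbhd (\<lambda>_. B) xs. \<Prod>j<length xs. (cmod (hinner \<H> (es ! j) (xs ! j)))\<^sup>2)"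
    using AB finite_list_nbhd[of xs "\<lambda>_. B"] B by (intro sum_mono2) (auto intro: prod_nonneg)
  also have "\<dots> = (\<Prod>j<length xs. \<Sum>e\<in>B. (cmod (hinner \<H> e (xs ! j)))\<^sup>2)"
    using B by (intro sum_list_nbhd_prod) auto
  also have "\<dots> \<le> (\<Prod>j<length xs. (hnorm \<H> (xs ! j))\<^sup>2)"
  proof (intro prod_mono conjI sum_nonneg zero_le_power2)
    fix j assume "j \<in> {..<length xs}"
    then have "xs ! j \<in> hcarrier \<H>" using xs xj by auto
    then show "(\<Sum>e\<in>B. (cmod (hinner \<H> e (xs ! j)))\<^sup>2) \<le> (hnorm \<H> (xs ! j))\<^sup>2"
      using B by (intro H.Bessel_inequality) (auto simp: onb_closed onb_inner subset_iff H.hnorm_sq)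
  qed
  finally show "(\<Sum>es\<in>A. (cmod (elem_tensor \<H> \<E> xs es))\<^sup>2) \<le> (\<Prod>j<length xs. (hnorm \<H> (xs ! j))\<^sup>2)" .
qed

text \<open>The elementary tensors of basis vectors are the \<open>delta\<close> functions, which
  determine a bounded operator. The \<open>THE\<close> in \<open>op_tensor_power_def\<close> is then
  settled by exhibiting one operator.\<close>

lemma is_tensor_op_unique:
  assumes "is_tensor_op \<H> \<E> as R" "is_tensor_op \<H> \<E> as R'"
  shows "R = R'"
proof (rule l2_hops_ext)
  show "R \<in> hops (l2 (Tup (length as)))" "R' \<in> hops (l2 (Tup (length as)))"
    using assms by (simp_all add: is_tensor_op_def tensor_power_eq)
  fix fs assume fs: "fs \<in> Tup (length as)"
  then have "length fs = length as \<and> set fs \<subseteq> hcarrier \<H>"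
    using onb_closed by (auto simp: tuples_def)
  then have "R (elem_tensor \<H> \<E> fs) = R' (elem_tensor \<H> \<E> fs)"
    using assms by (simp add: is_tensor_op_def)
  then show "R (delta fs) = R' (delta fs)" by (simp add: elem_tensor_onb[OF fs])
qed

lemma is_tensor_op_coefficient:
  assumes R: "is_tensor_op \<H> \<E> as R" and es: "es \<in> Tup (length as)" and fs: "fs \<in> Tup (length as)"
  shows "R (delta fs) es = (\<Prod>j<length as. mat (as ! j) (es ! j) (fs ! j))"
proof -
  have len: "length fs = length as" "set fs \<subseteq> hcarrier \<H>"
    using fs onb_closed by (auto simp: tuples_def)
  then have "R (delta fs) = elem_tensor \<H> \<E> (map2 (\<lambda>a x. a x) as fs)"
    using R by (simp add: is_tensor_op_def flip: elem_tensor_onb[OF fs])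
  then show ?thesis using es len by (simp add: elem_tensor_apply mat_def)
qed

text \<open>The tensor power of \<open>Op u\<close>, given by its matrix; boundedness is then
  available at once, since unitarity of \<open>u\<close> makes the rows orthogonal.\<close>

definition tens :: "nat \<Rightarrow> ('i \<Rightarrow> 'v \<Rightarrow> 'v) \<Rightarrow> (('i \<Rightarrow> 'v) list \<Rightarrow> complex) \<Rightarrow> ('i \<Rightarrow> 'v) list \<Rightarrow> complex" where
  "tens n u = kernel_op (Tup n) (list_nbhd block) (tensor_kernel (\<lambda>_. mat (Op u)))"

lemma orthogonal_rows_tens:
  assumes "u \<in> topspace \<U>"
  shows "orthogonal_rows (Tup n) (list_nbhd block) (tensor_kernel (\<lambda>_. mat (Op u)))"
  using orthogonal_rows_mat[OF assms] block_finite_subset by (intro orthogonal_rows_tensor) auto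

lemma tens_hops: "u \<in> topspace \<U> \<Longrightarrow> tens n u \<in> hops (L n)"
  unfolding tens_def by (rule kernel_op_hops[OF orthogonal_rows_tens])

lemma tens_adj_pair:
  assumes u: "u \<in> topspace \<U>"
  shows "l2.adj_pair (Tup n) (tens n (adj u)) (tens n u)"
  unfolding tens_def
proof (rule kernel_op_adj_pair[OF orthogonal_rows_tens[OF u] orthogonal_rows_tens[OF adj_topspace[OF u]]])
  fix es fs assume "es \<in> Tup n" "fs \<in> Tup n"
  then show "tensor_kernel (\<lambda>_. mat (Op (adj u))) es fs = cnj (tensor_kernel (\<lambda>_. mat (Op u)) fs es)"
    by (rule tensor_kernel_adj) (rule mat_adj[OF u])
qed

text \<open>On an elementary tensor the sum over tuples factors into row sums, and by
  \<open>mat_expand\<close> each of them is a coordinate of \<open>Op u\<close> applied to one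
  entry.\<close>

lemma tens_is_tensor_op:
  assumes u: "u \<in> topspace \<U>"
  shows "is_tensor_op \<H> \<E> (replicate n (Op u)) (tens n u)"
  unfolding is_tensor_op_def length_replicate tensor_power_eq
proof (intro conjI allI impI tens_hops[OF u] ext)
  fix xs es assume xs: "length xs = n \<and> set xs \<subseteq> hcarrier \<H>"
  then have xs_len: "length xs = n" and xs_cl: "elem_tensor \<H> \<E> xs \<in> hcarrier (L n)"
    by (auto intro: elem_tensor_closed)
  have len: "length (map2 (\<lambda>a x. a x) (replicate n (Op u)) xs) = n" using xs by simp
  show "tens n u (elem_tensor \<H> \<E> xs) es = elem_tensor \<H> \<E> (map2 (\<lambda>a x. a x) (replicate n (Op u)) xs) es"
  proof (cases "es \<in> Tup n")
    case es: True
    have finN: "finite (block e)" if "e \<in> set es" for e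
      using that es block_finite_subset by (auto simp: tuples_def)
    have blk: "fs \<in> Tup n" if "fs \<in> list_nbhd block es" for fs
      using that orthogonal_rows_tens[OF u, of n] es unfolding orthogonal_rows_def by blast
    have "tens n u (elem_tensor \<H> \<E> xs) es =
       (\<Sum>fs\<in>list_nbhd block es. \<Prod>j<length es. mat (Op u) (es ! j) (fs ! j) * hinner \<H> (fs ! j) (xs ! j))"
      unfolding tens_def kernel_op_apply[OF xs_cl es]
      using tuples_length[OF es] xs_len
      by (intro sum.cong refl) (simp add: tensor_kernel_def elem_tensor_apply[OF xs_len blk] prod.distrib)
    also have "\<dots> = (\<Prod>j<length es. \<Sum>f\<in>block (es ! j). mat (Op u) (es ! j) f * hinner \<H> f (xs ! j))"
      by (rule sum_list_nbhd_prod[OF finN])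
    also have "\<dots> = (\<Prod>j<n. hinner \<H> (es ! j) (Op u (xs ! j)))"
      using tuples_length[OF es] tuples_nth[OF es] xs
      by (intro prod.cong) (auto simp: mat_expand[OF Op_linf_alg[OF u]] subset_iff)
    also have "\<dots> = elem_tensor \<H> \<E> (map2 (\<lambda>a x. a x) (replicate n (Op u)) xs) es"
      unfolding elem_tensor_apply[OF len es] using xs by (intro prod.cong) auto
    finally show ?thesis .
  next
    case False
    then show ?thesis using elem_tensor_outside[OF len False] by (simp add: tens_def kernel_op_def)
  qed
qed

lemma op_tensor_power_eq:
  assumes u: "u \<in> topspace \<U>"
  shows "op_tensor_power \<H> \<E> n (Op u) = tens n u"
  unfolding op_tensor_power_def
proof (rule the_equality)
  show "is_tensor_op \<H> \<E> (replicate n (Op u)) (tens n u)" by (rule tens_is_tensor_op[OF u])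
  show "R = tens n u" if "is_tensor_op \<H> \<E> (replicate n (Op u)) R" for R
    using that tens_is_tensor_op[OF u] by (rule is_tensor_op_unique)
qed

definition elementary :: "nat \<Rightarrow> ((('i \<Rightarrow> 'v) list \<Rightarrow> complex) \<Rightarrow> ('i \<Rightarrow> 'v) list \<Rightarrow> complex) set" where
  "elementary n = {R. \<exists>as. length as = n \<and> set as \<subseteq> linf_alg I X \<and> is_tensor_op \<H> \<E> as R}"

lemma elementary_hops: "elementary n \<subseteq> hops (L n)"
  by (auto simp: elementary_def is_tensor_op_def tensor_power_eq)

lemma linf_tensor_power_eq:
  "linf_tensor_power I X n = commutant (L n) (commutant (L n) (elementary n))"
  by (simp add: linf_tensor_power_def vn_tensor_power_def tensor_power_eq elementary_def)

lemma elementary_subset: "elementary n \<subseteq> linf_tensor_power I X n"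
  unfolding linf_tensor_power_eq by (rule l2.subset_bicommutant[OF elementary_hops])

lemma tens_elementary: "u \<in> topspace \<U> \<Longrightarrow> tens n u \<in> elementary n"
  using tens_is_tensor_op[of u n] Op_linf_alg[of u]
  by (auto simp: elementary_def intro!: exI[of _ "replicate n (Op u)"])

lemma linf_tensor_power_hops: "linf_tensor_power I X n \<subseteq> hops (L n)"
  unfolding linf_tensor_power_eq by (rule l2.commutant_hops)

lemma linf_tensor_power_comp:
  assumes "S \<in> linf_tensor_power I X n" "T \<in> linf_tensor_power I X n"
  shows "S \<circ> T \<in> linf_tensor_power I X n"
  using assms unfolding linf_tensor_power_eq by (rule l2.commutant_comp) (rule l2.commutant_hops)

section \<open>Joint continuity on tensor powers\<close>

lemma tensor_conj_jointly_continuous_iff: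
  "tensor_conj_jointly_continuous I X n \<longleftrightarrow>
     jointly_continuous \<U> (sigma_weak (L n) (linf_tensor_power I X n))
       (\<lambda>u. conj_by (L n) (tens n u))"
  unfolding tensor_conj_jointly_continuous_def tensor_power_eq jointly_continuous_def
  by (rule iffI; erule continuous_map_eq) (auto simp: op_tensor_power_eq)

text \<open>In one factor the matrix of \<open>u\<close> is a finite combination of fixed matrices
  \<open>\<mu> t\<close> times the diagonal matrix of \<open>outside F u\<close>. The tensor power
  expands this product over lists \<open>ts\<close> of indices, with coefficients
  \<open>C u ts\<close> and fixed operators \<open>E ts\<close>.\<close>

lemma tensor_conj_jointly_continuous_if:
  assumes "virtually_classical I X"
  shows "tensor_conj_jointly_continuous I X n"
proof -
  define F where "F = {i \<in> I. \<not> (\<forall>b\<in>fin_onb (X i). \<forall>c\<in>fin_onb (X i). b = c)}"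
  have F: "finite F" "F \<subseteq> I" using assms by (auto simp: F_def virtually_classical_iff)
  \<comment> \<open>The basis vectors inside the non-abelian summands, a finite set; every other
    summand has at most one basis vector.\<close>
  define EF where "EF = {e \<in> \<E>. \<exists>i\<in>F. e i \<noteq> 0}"
  have "EF \<subseteq> (\<Union>i\<in>F. emb i ` fin_onb (X i))"
  proof
    fix e assume "e \<in> EF"
    then obtain k i b where k: "k \<in> F" "e k \<noteq> 0" and e: "e = emb i b" "i \<in> I" "b \<in> fin_onb (X i)"
      unfolding EF_def onb_eq by blast
    have "k = i" using k(2) e(1) emb_other by metis
    then show "e \<in> (\<Union>i\<in>F. emb i ` fin_onb (X i))" using k e by blast
  qed
  moreover have "finite (\<Union>i\<in>F. emb i ` fin_onb (X i))"
    using F fin_hilbert.finite_fin_onb[OF summand_fin] by blast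
  ultimately have EF: "finite EF" "EF \<subseteq> \<E>" by (auto simp: EF_def intro: finite_subset)
  have emb_EF: "emb i b \<in> EF \<longleftrightarrow> i \<in> F" if "i \<in> I" "b \<in> fin_onb (X i)" for i b
  proof
    assume "emb i b \<in> EF"
    then obtain k where k: "k \<in> F" "emb i b k \<noteq> 0" unfolding EF_def by blast
    have "k = i" using k(2) emb_other by metis
    then show "i \<in> F" using k by simp
  next
    assume "i \<in> F"
    moreover have "emb i b \<in> \<E>" using that by (rule emb_onb)
    ultimately show "emb i b \<in> EF"
      using onb_nonzero[OF that(2,1)] by (auto simp: EF_def intro!: bexI[of _ i])
  qed
  \<comment> \<open>\<open>None\<close> stands for the projection onto the basis vectors outside
    \<open>EF\<close>, \<open>Some (b, d)\<close> for the matrix unit \<open>|b><d|\<close> within a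
    block.\<close>
  define Q :: "(('i \<Rightarrow> 'v) \<times> ('i \<Rightarrow> 'v)) option set" where "Q = insert None (Some ` (SIGMA b:EF. block b))"
  have Q: "finite Q" using EF block_finite_subset by (auto simp: Q_def subset_iff)
  define \<mu> :: "(('i \<Rightarrow> 'v) \<times> ('i \<Rightarrow> 'v)) option \<Rightarrow> ('i \<Rightarrow> 'v) \<Rightarrow> ('i \<Rightarrow> 'v) \<Rightarrow> complex" where
    "\<mu> t e f = (case t of None \<Rightarrow> if e = f \<and> e \<notin> EF then 1 else 0
       | Some (b, d) \<Rightarrow> if e = b \<and> f = d then 1 else 0)" for t e f
  have \<mu>: "orthogonal_rows \<E> block (\<mu> t)" "orthogonal_rows \<E> block (\<lambda>e f. \<mu> t f e)" if t: "t \<in> Q" for t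
  proof -
    have "d \<in> block b" "b \<in> block d" if "t = Some (b, d)" for b d
      using that t EF block_sym by (auto simp: Q_def)
    then show "orthogonal_rows \<E> block (\<mu> t)" "orthogonal_rows \<E> block (\<lambda>e f. \<mu> t f e)"
      using block_finite_subset subsetD[OF block_finite_subset[THEN conjunct2, THEN conjunct1]]
      by (auto intro!: orthogonal_rows_monomial simp: \<mu>_def split: option.splits if_splits)
  qed
  define c where "c u t = (case t of None \<Rightarrow> 1 | Some (b, d) \<Rightarrow> mat (Op u) b d)"
    for u :: "'i \<Rightarrow> 'v \<Rightarrow> 'v" and t
  have c_cont: "continuous_map \<U> euclidean (\<lambda>u. c u t)" if t: "t \<in> Q" for t
  proof (cases t)
    case None
    then show ?thesis by (simp add: c_def)
  next
    case (Some bd)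
    then obtain b d where bd: "t = Some (b, d)" "b \<in> \<E>" "d \<in> block b" using t EF by (auto simp: Q_def)
    then obtain i b' where ib: "b = emb i b'" "i \<in> I" "b' \<in> fin_onb (X i)" by (auto simp: onb_eq)
    then obtain d' where d: "d = emb i d'" "d' \<in> fin_onb (X i)" using bd block_emb by auto
    have "continuous_map \<U> euclidean (\<lambda>u. hinner (X i) b' (u i d'))"
      using ib d by (intro continuous_map_coefficient) (auto simp: onb_carrier)
    then show ?thesis
      by (rule continuous_map_eq) (use ib d in \<open>auto simp: c_def bd mat_diag_op linf_unitary_hops\<close>)
  qed
  \<comment> \<open>The matrix is diagonal: it is the identity on the summands in \<open>F\<close>,
    and the others have at most one basis vector.\<close>
  have mat_outside: "mat (Op (outside F u)) e f =
      (if e \<noteq> f then 0 else if e \<in> EF then 1 else mat (Op u) e f)"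
    if u: "u \<in> topspace \<U>" and e: "e \<in> \<E>" and f: "f \<in> \<E>" for u e f
  proof -
    obtain i b where ib: "e = emb i b" "i \<in> I" "b \<in> fin_onb (X i)" using e by (auto simp: onb_eq)
    obtain j d where jd: "f = emb j d" "j \<in> I" "d \<in> fin_onb (X j)" using f by (auto simp: onb_eq)
    interpret Xj: fin_hilbert "X j" by (rule summand_fin[OF jd(2)])
    have "i \<notin> F \<Longrightarrow> i = j \<Longrightarrow> b = d" using ib jd by (auto simp: F_def)
    moreover have "outside F u i = (if i \<in> F then hid (X i) else u i)"
      using ib by (simp add: outside_def)
    ultimately show ?thesis
      using ib jd
        mat_diag_op[OF linf_unitary_hops[OF outside_topspace[OF u, of F]] ib(2,3) jd(2,3)]
        mat_diag_op[OF linf_unitary_hops[OF u] ib(2,3) jd(2,3)]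
      by (auto simp: emb_eq_iff onb_nonzero emb_EF Xj.fin_onb_inner)
  qed
  \<comment> \<open>The second factor is diagonal, so only its entry at the column \<open>f\<close>
    occurs. For \<open>e\<close> outside \<open>EF\<close> the block is \<open>{e}\<close> and the
    entry of \<open>u\<close> comes from the second factor; for \<open>e\<close> in
    \<open>EF\<close> it comes from the first, the second being 1 on the block.\<close>
  have mat_decomp: "mat (Op u) e f = (\<Sum>t\<in>Q. c u t * \<mu> t e f) * mat (Op (outside F u)) f f"
    if u: "u \<in> topspace \<U>" and e: "e \<in> \<E>" and f: "f \<in> \<E>" for u e f
  proof -
    have fin: "finite (SIGMA b:EF. block b)" using EF block_finite_subset by blast
    have "(\<Sum>t\<in>Q. c u t * \<mu> t e f) = c u None * \<mu> None e f +
       (\<Sum>p\<in>(SIGMA b:EF. block b). c u (Some p) * \<mu> (Some p) e f)"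
      unfolding Q_def using fin by (subst sum.insert) (auto simp: sum.reindex)
    also have "(\<Sum>p\<in>(SIGMA b:EF. block b). c u (Some p) * \<mu> (Some p) e f) =
       (\<Sum>p\<in>(SIGMA b:EF. block b). if p = (e, f) then mat (Op u) e f else 0)"
      by (rule sum.cong) (auto simp: c_def \<mu>_def split: if_splits)
    also have "\<dots> = (if e \<in> EF \<and> f \<in> block e then mat (Op u) e f else 0)"
      using fin by (simp add: sum.delta')
    also have "c u None * \<mu> None e f = (if e = f \<and> e \<notin> EF then 1 else 0)"
      by (simp add: c_def \<mu>_def)
    finally have eq: "(\<Sum>t\<in>Q. c u t * \<mu> t e f) = (if e = f \<and> e \<notin> EF then 1 else 0) +
       (if e \<in> EF \<and> f \<in> block e then mat (Op u) e f else 0)" .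
    obtain i b where ib: "e = emb i b" "i \<in> I" "b \<in> fin_onb (X i)" using e by (auto simp: onb_eq)
    show ?thesis
    proof (cases "f \<in> block e")
      case True
      then obtain d where d: "f = emb i d" "d \<in> fin_onb (X i)" using ib block_emb by auto
      have "i \<notin> F \<Longrightarrow> b = d" using ib d by (auto simp: F_def)
      then show ?thesis
        unfolding eq mat_outside[OF u f f] using ib d True
        by (cases "i \<in> F") (auto simp: emb_EF)
    next
      case False
      then have "e \<noteq> f" using block_finite_subset[OF e] by auto
      then show ?thesis
        unfolding eq using False mat_outside_block[OF Op_linf_alg[OF u] e f False] by simp
    qed
  qed
  define E where "E ts = kernel_op (Tup n) (list_nbhd block) (tensor_kernel (\<lambda>j. \<mu> (ts ! j)))" for ts
  define E' where "E' ts = kernel_op (Tup n) (list_nbhd block) (tensor_kernel (\<lambda>j e f. \<mu> (ts ! j) f e))" for ts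
  define C where "C u ts = (\<Prod>j<n. c u (ts ! j))" for u ts
  have E_rows: "orthogonal_rows (Tup n) (list_nbhd block) (tensor_kernel (\<lambda>j. \<mu> (ts ! j)))"
    "orthogonal_rows (Tup n) (list_nbhd block) (tensor_kernel (\<lambda>j e f. \<mu> (ts ! j) f e))"
    if "ts \<in> tuples Q n" for ts
    using \<mu>[OF tuples_nth[OF that]] block_finite_subset by (auto intro!: orthogonal_rows_tensor)
  have E: "l2.adj_pair (Tup n) (E' ts) (E ts)" if ts: "ts \<in> tuples Q n" for ts
    unfolding E_def E'_def
    by (rule kernel_op_adj_pair[OF E_rows[OF ts]], rule tensor_kernel_adj)
      (auto simp: \<mu>_def split: option.splits)
  have tens_outside: "tens n (outside F u) x es = tensor_kernel (\<lambda>_. mat (Op (outside F u))) es es * x es"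
    if "u \<in> topspace \<U>" "x \<in> hcarrier (L n)" "es \<in> Tup n" for u x es
    unfolding tens_def
    by (rule kernel_op_diagonal[OF block_finite_subset]) (use that mat_outside in auto)
  show ?thesis
    unfolding tensor_conj_jointly_continuous_iff
  proof (rule l2.conj_jointly_continuousI[where Q = "tuples Q n" and c = C and E = E and E' = E'
        and D = "\<lambda>u. tens n (outside F u)" and D' = "\<lambda>u. tens n (adj (outside F u))"])
    show "linf_tensor_power I X n \<subseteq> hops (L n)" by (rule linf_tensor_power_hops)
    show finQ: "finite (tuples Q n)"
      using finite_lists_length_eq[OF Q, of n] by (simp add: tuples_def conj_commute)
    show "continuous_map \<U> euclidean (\<lambda>u. C u ts)" if "ts \<in> tuples Q n" for ts
      unfolding C_def using tuples_nth[OF that] by (intro continuous_map_complex_prod c_cont) auto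
    show "l2.adj_pair (Tup n) (E' ts) (E ts)" if "ts \<in> tuples Q n" for ts by (rule E[OF that])
    fix u assume u: "u \<in> topspace \<U>"
    note ou = outside_topspace[OF u, of F]
    let ?D = "tens n (outside F u)" and ?D' = "tens n (adj (outside F u))"
    let ?O = "Op (outside F u)"
    show "l2.adj_pair (Tup n) (?D') (?D)"
      by (rule tens_adj_pair[OF ou])
    show "tens n u = (\<lambda>x. \<Sum>ts\<in>tuples Q n. hscale (L n) (C u ts) (E ts (?D x)))"
    proof (rule l2.hops_ext[OF tens_hops[OF u]])
      have "(\<lambda>x. \<Sum>ts\<in>tuples Q n. hscale (L n) (C u ts) (E ts x)) \<circ> ?D
          \<in> hops (L n)"
        by (intro l2.hops_comp l2.sum_hops l2.scale_hops tens_hops ou l2.adj_pairD(2)[OF E])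
      then show rhs: "(\<lambda>x. \<Sum>ts\<in>tuples Q n. hscale (L n) (C u ts) (E ts (?D x)))
          \<in> hops (L n)" by (simp add: o_def)
      fix x assume x: "x \<in> hcarrier (L n)"
      define y where "y = ?D x"
      have y: "y \<in> hcarrier (L n)" unfolding y_def by (rule l2.hops_closed[OF tens_hops[OF ou]])
      show "tens n u x = (\<Sum>ts\<in>tuples Q n. hscale (L n) (C u ts) (E ts (?D x)))"
      proof
        fix es
        show "tens n u x es =
          (\<Sum>ts\<in>tuples Q n. hscale (L n) (C u ts) (E ts (?D x))) es"
        proof (cases "es \<in> Tup n")
          case es: True
          \<comment> \<open>The product of sums over \<open>Q\<close> is expanded into a sum over
            lists of indices; the diagonal entries are absorbed into \<open>y\<close>.\<close>
          have summand: "tensor_kernel (\<lambda>_. mat (Op u)) es fs * x fs =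
             (\<Sum>ts\<in>tuples Q n. C u ts * (tensor_kernel (\<lambda>j. \<mu> (ts ! j)) es fs * y fs))"
            if "fs \<in> list_nbhd block es" for fs
          proof -
            have fs: "fs \<in> Tup n"
              using that orthogonal_rows_tens[OF u, of n] es unfolding orthogonal_rows_def by blast
            note len = tuples_length[OF es] tuples_length[OF fs]
            have "tensor_kernel (\<lambda>_. mat (Op u)) es fs =
               (\<Prod>j<n. \<Sum>t\<in>Q. c u t * \<mu> t (es ! j) (fs ! j)) *
               tensor_kernel (\<lambda>_. mat (?O)) fs fs"
              unfolding tensor_kernel_def len prod.distrib[symmetric]
              using tuples_nth[OF es] tuples_nth[OF fs]
              by (intro prod.cong refl mat_decomp[OF u]) auto
            also have "(\<Prod>j<n. \<Sum>t\<in>Q. c u t * \<mu> t (es ! j) (fs ! j)) =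
               (\<Sum>ts\<in>tuples Q n. \<Prod>j<n. c u (ts ! j) * \<mu> (ts ! j) (es ! j) (fs ! j))"
              using sum_list_nbhd_prod[of es "\<lambda>_. Q" "\<lambda>j t. c u t * \<mu> t (es ! j) (fs ! j)"] Q len
              by (simp add: tuples_eq_list_nbhd[OF len(1), of Q])
            also have "\<dots> = (\<Sum>ts\<in>tuples Q n. C u ts * tensor_kernel (\<lambda>j. \<mu> (ts ! j)) es fs)"
              using len by (simp add: C_def tensor_kernel_def prod.distrib)
            finally show ?thesis
              by (simp add: y_def tens_outside[OF u x fs] sum_distrib_left mult_ac)
          qed
          have "tens n u x es = (\<Sum>fs\<in>list_nbhd block es. \<Sum>ts\<in>tuples Q n.
              C u ts * (tensor_kernel (\<lambda>j. \<mu> (ts ! j)) es fs * y fs))"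
            unfolding tens_def kernel_op_apply[OF x es] by (intro sum.cong refl summand)
          also have "\<dots> = (\<Sum>ts\<in>tuples Q n. C u ts *
              (\<Sum>fs\<in>list_nbhd block es. tensor_kernel (\<lambda>j. \<mu> (ts ! j)) es fs * y fs))"
            by (subst sum.swap) (simp add: sum_distrib_left)
          also have "\<dots> = (\<Sum>ts\<in>tuples Q n. hscale (L n) (C u ts) (E ts y)) es"
            by (simp add: sum_fun_apply l2_scale E_def kernel_op_apply[OF y es])
          finally show ?thesis by (simp add: y_def)
        next
          case False
          then show ?thesis
            using l2_outside[OF l2.hops_closed[OF rhs, of x] False]
              l2_outside[OF l2.hops_closed[OF tens_hops[OF u], where x = x] False] by simp
        qed
      qed
    qed
    \<comment> \<open>The eigenvalue of \<open>?D\<close> at a tuple depends only on the summands of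
      its entries, and a tensor of block-diagonal operators connects only tuples whose entries lie
      in the same summands. So \<open>?D\<close> lies in the commutant, with which every element of
      the tensor power commutes.\<close>
    have central: "?D \<in> commutant (L n) (elementary n)"
    proof (rule l2.commutantI[OF tens_hops[OF ou] elementary_hops])
      fix R x assume R: "R \<in> elementary n"
      then obtain as where as: "length as = n" "set as \<subseteq> linf_alg I X" "is_tensor_op \<H> \<E> as R"
        by (auto simp: elementary_def)
      have Rh: "R \<in> hops (L n)" using R elementary_hops by blast
      define ev where "ev es = tensor_kernel (\<lambda>_. mat (?O)) es es" for es
      have "?D \<circ> R = R \<circ> ?D"
      proof (rule l2_hops_ext[OF l2.hops_comp[OF tens_hops[OF ou] Rh] l2.hops_comp[OF Rh tens_hops[OF ou]]])
        fix fs assume fs: "fs \<in> Tup n"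
        have Rfs: "R (delta fs) \<in> hcarrier (L n)" by (rule l2.hops_closed[OF Rh])
        have "?D (delta fs) = hscale (L n) (ev fs) (delta fs)"
        proof
          fix es
          show "?D (delta fs) es = hscale (L n) (ev fs) (delta fs) es"
            using tens_outside[OF u delta_closed[OF fs], of es] fs
              l2_outside[OF l2.hops_closed[OF tens_hops[OF ou], where x = "delta fs"], of es]
            by (cases "es \<in> Tup n") (auto simp: l2_scale delta_def ev_def)
        qed
        then have R1: "R (?D (delta fs)) = hscale (L n) (ev fs) (R (delta fs))"
          using Rh fs by (simp add: l2.hops_scale)
        have "?D (R (delta fs)) es = ev fs * R (delta fs) es" for es
        proof (cases "es \<in> Tup n")
          case es: True
          have "ev es * R (delta fs) es = ev fs * R (delta fs) es"
          proof (cases "R (delta fs) es = 0")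
            case False
            have "mat (?O) (es ! j) (es ! j) = mat (?O) (fs ! j) (fs ! j)"
              if j: "j < n" for j
            proof -
              note esj = tuples_nth[OF es j] and fsj = tuples_nth[OF fs j]
              have "mat (as ! j) (es ! j) (fs ! j) \<noteq> 0"
                using False is_tensor_op_coefficient[OF as(3), of es fs] es fs as(1) j by auto
              moreover have "as ! j \<in> linf_alg I X" using as(1,2) j by auto
              ultimately have blk: "fs ! j \<in> block (es ! j)"
                using mat_outside_block[OF _ esj fsj, of "as ! j"] by blast
              obtain i b where ib: "es ! j = emb i b" "i \<in> I" "b \<in> fin_onb (X i)"
                using esj by (auto simp: onb_eq)
              then obtain d where d: "fs ! j = emb i d" "d \<in> fin_onb (X i)" using blk block_emb by auto
              \<comment> \<open>Both entries lie in summand \<open>i\<close>: for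
                \<open>i \<in> F\<close> the two diagonal entries are 1, otherwise the basis vectors
                coincide.\<close>
              have "i \<notin> F \<Longrightarrow> b = d" using ib d by (auto simp: F_def)
              then show ?thesis using ib d
                unfolding mat_outside[OF u esj esj] mat_outside[OF u fsj fsj] by (auto simp: emb_EF)
            qed
            then show ?thesis
              using tuples_length[OF es] tuples_length[OF fs] by (simp add: ev_def tensor_kernel_def)
          qed simp
          then show ?thesis using tens_outside[OF u Rfs es] by (simp add: ev_def)
        next
          case False
          then show ?thesis
            using l2_outside[OF Rfs False] l2_outside[OF l2.hops_closed[OF tens_hops[OF ou]] False] by simp
        qed
        then show "(?D \<circ> R) (delta fs) = (R \<circ> ?D) (delta fs)"
          by (simp add: R1 fun_eq_iff l2_scale)
      qed
      from fun_cong[OF this, of x] show "?D (R x) = R (?D x)" by simp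
    qed
    fix T assume T: "T \<in> linf_tensor_power I X n"
    show "?D (T (?D' x)) = T x"
      if x: "x \<in> hcarrier (L n)" for x
    proof -
      note aou = adj_topspace[OF ou]
      define y where "y = ?D' x"
      have y: "y \<in> hcarrier (L n)" unfolding y_def by (rule l2.hops_closed[OF tens_hops[OF aou]])
      have "?D (T y) = T (?D y)"
        using l2.commutantD[OF T[unfolded linf_tensor_power_eq] central] by simp
      also have "?D y = x"
      proof
        fix es
        show "?D y es = x es"
        proof (cases "es \<in> Tup n")
          case es: True
          have yes: "y es = tensor_kernel (\<lambda>_. mat (Op (adj (outside F u)))) es es * x es"
            unfolding y_def tens_def
            by (rule kernel_op_diagonal[OF block_finite_subset])
              (use x es mat_adj[OF ou] mat_outside[OF u] in auto)
          \<comment> \<open>A row of a unitary has norm 1 and here consists of its diagonal entry,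
            so that entry has modulus 1 and its conjugate is its inverse.\<close>
          have unit: "mat (?O) e e * mat (Op (adj (outside F u))) e e = 1" if e: "e \<in> \<E>" for e
          proof -
            have "1 = (\<Sum>f\<in>block e. mat (?O) e f * cnj (mat (?O) e f))"
              using mat_unitary_rows[OF ou e e] by simp
            also have "\<dots> = (\<Sum>f\<in>block e. if f = e then mat (?O) e e *
                cnj (mat (?O) e e) else 0)"
              using block_finite_subset[OF e] e
              by (intro sum.cong refl) (auto simp: mat_outside[OF u e] subset_iff)
            also have "\<dots> = mat (?O) e e * cnj (mat (?O) e e)"
              using block_finite_subset[OF e] by simp
            finally show ?thesis by (simp add: mat_adj[OF ou e e])
          qed
          have "tensor_kernel (\<lambda>_. mat (?O)) es es *
              tensor_kernel (\<lambda>_. mat (Op (adj (outside F u)))) es es = 1"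
            unfolding tensor_kernel_def prod.distrib[symmetric]
            using tuples_nth[OF es] tuples_length[OF es] by (intro prod.neutral) (auto simp: unit)
          then show ?thesis
            by (simp add: tens_outside[OF u y es] yes flip: mult.assoc)
        next
          case False
          then show ?thesis
            using l2_outside[OF x False] l2_outside[OF l2.hops_closed[OF tens_hops[OF ou]] False] by simp
        qed
      qed
      finally show ?thesis by (simp add: y_def)
    qed
    show "conj_by (L n) (tens n u) T \<in> linf_tensor_power I X n"
      unfolding conj_by_def l2.hadj_eq[OF tens_adj_pair[OF u]]
      using elementary_subset tens_elementary u adj_topspace
      by (intro linf_tensor_power_comp T) blast+
  qed
qed

text \<open>A matrix unit of the tensor power is the tensor of matrix units of the factors, which
  places it among the elementary tensors.\<close>

lemma rank_one_delta_tensor_op: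
  assumes es: "es \<in> Tup n" and fs: "fs \<in> Tup n"
  shows "is_tensor_op \<H> \<E> (map2 H.rank_one es fs) (l2.rank_one (Tup n) (delta es) (delta fs))"
proof -
  note len = tuples_length[OF es] tuples_length[OF fs]
  have len2: "length (map2 H.rank_one es fs) = n" using len by simp
  show ?thesis
    unfolding is_tensor_op_def len2 tensor_power_eq
  proof (intro conjI allI impI ext)
    show "l2.rank_one (Tup n) (delta es) (delta fs) \<in> hops (L n)"
      using es fs by simp
    fix xs gs assume xs: "length xs = n \<and> set xs \<subseteq> hcarrier \<H>"
    then have xs_cl: "elem_tensor \<H> \<E> xs \<in> hcarrier (L n)" by (auto intro: elem_tensor_closed)
    have xs_len: "length xs = n" using xs by simp
    have len3: "length (map2 (\<lambda>a x. a x) (map2 H.rank_one es fs) xs) = n" using len xs_len by simp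
    have lhs: "l2.rank_one (Tup n) (delta es) (delta fs) (elem_tensor \<H> \<E> xs) gs =
        elem_tensor \<H> \<E> xs fs * delta es gs"
      using fs xs_cl by (simp add: l2.rank_one_def l2_scale inner_delta)
    show "l2.rank_one (Tup n) (delta es) (delta fs) (elem_tensor \<H> \<E> xs) gs =
        elem_tensor \<H> \<E> (map2 (\<lambda>a x. a x) (map2 H.rank_one es fs) xs) gs"
    proof (cases "gs \<in> Tup n")
      case gs: True
      have "elem_tensor \<H> \<E> (map2 (\<lambda>a x. a x) (map2 H.rank_one es fs) xs) gs =
          (\<Prod>j<n. hinner \<H> (fs ! j) (xs ! j) * (if gs ! j = es ! j then 1 else 0))"
        unfolding elem_tensor_apply[OF len3 gs]
      proof (intro prod.cong refl)
        fix j assume "j \<in> {..<n}"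
        then have j: "j < n" by simp
        then have "xs ! j \<in> hcarrier \<H>" using xs by auto
        then show "hinner \<H> (gs ! j) (map2 (\<lambda>a x. a x) (map2 H.rank_one es fs) xs ! j) =
            hinner \<H> (fs ! j) (xs ! j) * (if gs ! j = es ! j then 1 else 0)"
          using j len xs_len tuples_nth[OF es j] tuples_nth[OF gs j]
          by (simp add: H.rank_one_def H.inner_scale_right onb_closed onb_inner)
      qed
      also have "\<dots> = elem_tensor \<H> \<E> xs fs * delta es gs"
        unfolding prod.distrib prod_delta_tuples[OF gs es] elem_tensor_apply[OF xs_len fs]
        by (simp add: delta_def)
      finally show ?thesis using lhs by simp
    next
      case False
      then show ?thesis using lhs elem_tensor_outside[OF len3 False] es by (auto simp: delta_def)
    qed
  qed
qed

lemma tens_fixing_onb: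
  assumes u: "u \<in> topspace \<U>" and eig: "\<And>e. e \<in> \<E> \<Longrightarrow> Op u e = hscale \<H> (s e) e"
    and es: "es \<in> Tup n"
  shows "tens n u (delta es) = hscale (L n) (\<Prod>j<n. s (es ! j)) (delta es)"
proof
  fix gs
  have mat: "mat (Op u) e f = (if e = f then s e else 0)" if "e \<in> \<E>" "f \<in> \<E>" for e f
    using that by (simp add: mat_def eig H.inner_scale_right onb_closed onb_inner)
  show "tens n u (delta es) gs = hscale (L n) (\<Prod>j<n. s (es ! j)) (delta es) gs"
  proof (cases "gs \<in> Tup n")
    case gs: True
    have "tens n u (delta es) gs = tensor_kernel (\<lambda>_. mat (Op u)) gs gs * delta es gs"
      unfolding tens_def
      by (rule kernel_op_diagonal[OF block_finite_subset _ delta_closed[OF es] gs]) (auto simp: mat)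
    moreover have "tensor_kernel (\<lambda>_. mat (Op u)) gs gs = (\<Prod>j<n. s (gs ! j))"
      using tuples_nth[OF gs] tuples_length[OF gs] by (simp add: tensor_kernel_def mat)
    ultimately show ?thesis by (simp add: l2_scale delta_def)
  next
    case False
    then show ?thesis using es by (auto simp: tens_def kernel_op_def l2_scale delta_def)
  qed
qed

lemma tensor_conj_jointly_continuous_only_if:
  assumes "\<not> virtually_classical I X" and n: "n \<ge> 1"
  shows "\<not> tensor_conj_jointly_continuous I X n"
proof -
  obtain \<iota> :: "nat \<Rightarrow> 'i" and e f where \<iota>: "inj \<iota>" "\<And>k. \<iota> k \<in> I"
    and ef: "\<And>k. e k \<in> fin_onb (X (\<iota> k))" "\<And>k. f k \<in> fin_onb (X (\<iota> k))" "\<And>k. e k \<noteq> f k"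
    by (rule not_virtually_classicalE[OF assms(1)]) (rule that)
  obtain m where m: "n = Suc m" using n by (cases n) auto
  define a where "a k = emb (\<iota> k) (e k)" for k
  define b where "b k = emb (\<iota> k) (f k)" for k
  have ab: "a k \<in> \<E>" "b k \<in> \<E>" for k using \<iota> ef by (simp_all add: a_def b_def emb_onb)
  have ab_ne: "b l \<noteq> a k" "a k = a l \<longleftrightarrow> k = l" "b k = b l \<longleftrightarrow> k = l" for k l
    using \<iota> ef ef(3)[symmetric] onb_nonzero[OF ef(1) \<iota>(2)] onb_nonzero[OF ef(2) \<iota>(2)]
    by (auto simp: a_def b_def emb_eq_iff inj_eq)
  \<comment> \<open>\<open>a k\<close> stands in the first position only, which exists because
    \<open>n \<ge> 1\<close>, so the reflection acts on \<open>A k\<close> by a single sign; in all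
    positions the sign would be \<open>(-1)^n\<close>, which is lost for even \<open>n\<close>.
    \<open>b k\<close> fills the rest because the reflection fixes it.\<close>
  define A where "A k = a k # replicate m (b k)" for k
  define B where "B k = b k # replicate m (b k)" for k
  have AB: "A k \<in> Tup n" "B k \<in> Tup n" for k using ab by (auto simp: A_def B_def tuples_def m)
  define g where "g k = reflection_at (\<iota> k) (e k)" for k
  have top: "g k \<in> topspace \<U>" for k unfolding g_def by (rule reflection_at_topspace[OF \<iota>(2) ef(1)])
  define s where "s k x = (if x = a k then -1 else 1 :: complex)" for k x
  have eig: "Op (g k) x = hscale \<H> (s k x) x" if x: "x \<in> \<E>" for k x
  proof -
    obtain i c where c: "x = emb i c" "i \<in> I" "c \<in> fin_onb (X i)" using x by (auto simp: onb_eq)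
    show ?thesis
      using reflection_at_emb[OF \<iota>(2) ef(1) c(2,3), of k] onb_closed[OF x] c onb_nonzero[OF c(3,2)]
      by (auto simp: g_def s_def a_def emb_eq_iff H.uminus_eq_scale)
  qed
  have sA: "(\<Prod>j<n. s k (A l ! j)) = (if k = l then -1 else 1)" for k l
    using ab_ne by (auto simp: A_def m prod.lessThan_Suc_shift s_def simp del: prod.lessThan_Suc)
  have sB: "(\<Prod>j<n. s k (B l ! j)) = 1" for k l
    using ab_ne by (auto simp: B_def m prod.lessThan_Suc_shift s_def simp del: prod.lessThan_Suc)
  have delta_inner: "hinner (L n) (delta es) (delta fs) = (if es = fs then 1 else 0)"
    if "es \<in> Tup n" "fs \<in> Tup n" for es fs
    using that by (simp add: inner_delta) (simp add: delta_def)
  \<comment> \<open>In each position the two entries lie in the same summand, so the factors of this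
    matrix unit are block-diagonal.\<close>
  have rank_one: "l2.rank_one (Tup n) (delta (A l)) (delta (B l)) \<in> linf_tensor_power I X n" for l
  proof -
    have "H.rank_one (A l ! j) (B l ! j) \<in> linf_alg I X" if "j < n" for j
      using that \<iota> ef by (cases j) (auto simp: A_def B_def m a_def b_def onb_carrier rank_one_emb_linf_alg)
    then have "set (map2 H.rank_one (A l) (B l)) \<subseteq> linf_alg I X"
      using tuples_length[OF AB(1)] tuples_length[OF AB(2)] by (auto simp: set_zip)
    then have "l2.rank_one (Tup n) (delta (A l)) (delta (B l)) \<in> elementary n"
      using rank_one_delta_tensor_op[OF AB(1) AB(2)] tuples_length[OF AB(1)] tuples_length[OF AB(2)]
      unfolding elementary_def by (auto intro!: exI[of _ "map2 H.rank_one (A l) (B l)"])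
    then show ?thesis using elementary_subset by blast
  qed
  show ?thesis
    unfolding tensor_conj_jointly_continuous_iff
  proof (rule l2.not_conj_jointly_continuousI[where a = "\<lambda>k. delta (A k)" and b = "\<lambda>k. delta (B k)"
        and ?g0.0 = one_tuple and g = g and W' = "\<lambda>k. tens n (adj (g k))"])
    show "tens n one_tuple = hid (L n)"
    proof (rule l2_hops_ext[OF tens_hops[OF one_tuple_topspace] l2.hid_hops])
      fix es assume es: "es \<in> Tup n"
      have "Op one_tuple x = hscale \<H> 1 x" if "x \<in> \<E>" for x
        using onb_closed[OF that] by (simp add: one_tuple_Op)
      from tens_fixing_onb[OF one_tuple_topspace this es]
      show "tens n one_tuple (delta es) = hid (L n) (delta es)" using es by simp
    qed
    show "\<exists>K. \<forall>k\<ge>K. g k \<in> N" if "openin \<U> N" "one_tuple \<in> N" for N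
      by (rule reflections_tendsto_one[OF \<iota>(1) that top]) (simp add: g_def reflection_at_def)
    show "l2.adj_pair (Tup n) (tens n (adj (g k))) (tens n (g k))" for k by (rule tens_adj_pair[OF top])
    show "tens n (g k) (delta (A l)) = (if k = l then - delta (A l) else delta (A l))" for k l
      using tens_fixing_onb[OF top eig AB(1), of k l] l2.uminus_eq_scale[OF delta_closed[OF AB(1)]] AB(1)[of l]
      by (simp add: sA)
    show "tens n (g k) (delta (B l)) = delta (B l)" for k l
      using tens_fixing_onb[OF top eig AB(2), of k l] AB(2)[of l] by (simp add: sB)
    show "(\<lambda>x. \<Sum>l\<in>S. hscale (L n) (t l) (l2.rank_one (Tup n) (delta (A l)) (delta (B l)) x))
        \<in> linf_tensor_power I X n" for S t
      using rank_one unfolding linf_tensor_power_eq by (intro l2.commutant_sum l2.commutant_hops)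
    show "hinner (L n) (delta (A k)) (delta (A l)) = (if k = l then 1 else 0)"
      "hinner (L n) (delta (B k)) (delta (B l)) = (if k = l then 1 else 0)" for k l
      using AB ab_ne by (auto simp: delta_inner A_def B_def)
  qed (use AB one_tuple_topspace in auto)
qed

end

theorem proposition2p2:
  fixes I :: "'i set" and X :: "'i \<Rightarrow> 'v::ab_group_add hilb"
  assumes "quantum_set I X"
  shows "(virtually_classical I X \<longleftrightarrow> (\<forall>n\<ge>1. tensor_conj_jointly_continuous I X n)) \<and>
         (virtually_classical I X \<longleftrightarrow> conj_jointly_continuous I X) \<and>
         (virtually_classical I X \<longleftrightarrow> (\<exists>n\<ge>1. tensor_conj_jointly_continuous I X n))"
proof -
  interpret q_set I X by (rule q_set.intro[OF assms])
  \<comment> \<open>If the quantum set is not virtually classical, continuity fails for every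
    \<open>n \<ge> 1\<close>, so a single \<open>n\<close> suffices for the converse; in the other
    direction \<open>n = 1\<close> is a witness.\<close>
  show ?thesis
    using tensor_conj_jointly_continuous_if tensor_conj_jointly_continuous_only_if
      conj_jointly_continuous_if conj_jointly_continuous_only_if by blast
qed

end
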